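(* Let $X(K,U)$ be an Oeljeklaus-Toma manifold of type $(s,t)$. The following are equivalent: (1) $X(K,U)$ admits a pluriclosed metric. (2) $s\le t$ and, after possibly relabeling the embeddings (that is, permuting the real embeddings $\sigma_1,\ldots,\sigma_s$ among themselves and permuting the complex embeddings $\sigma_{s+1},\ldots,\sigma_{s+t}$ among themselves), $$|\sigma_{s+i}(u)|^2\,\sigma_i(u)=1\quad\text{for all }u\in U\text{ and all }i\in\{1,\ldots,s\},$$ and $$|\sigma_{s+i}(u)|=1\quad\text{for all }u\in U\text{ and all } s<i\le t.$$
   Context: **Oeljeklaus-Toma (OT) manifolds.** Let $K$ be an algebraic number field of degree $[K:\mathbb{Q}]=s+2t$ with $s\ge 1$ real embeddings $\sigma_1,\ldots,\sigma_s:K\hookrightarrow\mathbb{R}$ and $2t$ ($t\ge 1$) non-real complex embeddings $\sigma_{s+1},\ldots,\sigma_{s+2t}:K\hookrightarrow\mathbb{C}$, ordered so that $\sigma_{s+t+i}=\overline{\sigma_{s+i}}$ for $1\le i\le t$. Let $\mathcal{O}_K$ be the ring of integers of $K$ and $\mathcal{O}_K^{*,+}$ the group of totally positive units, i.e. units $u$ with $\sigma_i(u)>0$ for all $1\le i\le s$. Let $\mathbb{H}=\{z\in\mathbb{C}:\mathrm{Im}\,z>0\}$. The group $\mathcal{O}_K$ acts on $\mathbb{H}^s\times\mathbb{C}^t$ by translations $$T_a(w_1,\ldots,w_s,z_1,\ldots,z_t)=(w_1+\sigma_1(a),\ldots,w_s+\sigma_s(a),z_1+\sigma_{s+1}(a),\ldots,z_t+\sigma_{s+t}(a)),$$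 and $\mathcal{O}_K^{*,+}$ acts by $$R_u(w_1,\ldots,w_s,z_1,\ldots,z_t)=(\sigma_1(u)w_1,\ldots,\sigma_s(u)w_s,\sigma_{s+1}(u)z_1,\ldots,\sigma_{s+t}(u)z_t).$$ Define $l:\mathcal{O}_K^{*,+}\to\mathbb{R}^{s+t}$ by $l(u)=(\log\sigma_1(u),\ldots,\log\sigma_s(u),2\log|\sigma_{s+1}(u)|,\ldots,2\log|\sigma_{s+t}(u)|)$. A subgroup $U\subseteq\mathcal{O}_K^{*,+}$ is called admissible if it is free of rank $s$ and the projection of $l(U)$ to the first $s$ coordinates is a lattice of rank $s$ in $\mathbb{R}^s$. For admissible $U$ the action of $U\ltimes\mathcal{O}_K$ on $\mathbb{H}^s\times\mathbb{C}^t$ is fixed-point-free, properly discontinuous and cocompact, and the OT manifold of type $(s,t)$ associated to $K$ and the admissible subgroup $U$ is the compact complex manifold $X(K,U)=(\mathbb{H}^s\times\mathbb{C}^t)/(U\ltimes\mathcal{O}_K)$, of complex dimension $n=s+t$. **Metrics.** A Hermitian metric is identified with its (smooth, real, positive) fundamental $(1,1)$-form $\Omega$. It is called pluriclosed (or strongly Kähler with torsion, SKT) if $dd^c\Omega=0$, equivalently $\partial\overline{\partial}\Omega=0$. *)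

theory Defs
  imports
    "HOL-Analysis.Analysis"
    "HOL-Computational_Algebra.Polynomial"
    "HOL-Algebra.Free_Abelian_Groups"
begin

definition number_field_of_degree :: "'k::field_char_0 itself \<Rightarrow> nat \<Rightarrow> bool" where
  "number_field_of_degree _ n \<longleftrightarrow>
     (\<exists>B::'k set. finite_dimensional_vector_space (\<lambda>(q::rat) x. of_rat q * x) B \<and> card B = n)"

definition field_embedding :: "('k::field \<Rightarrow> 'l::field) \<Rightarrow> bool" where
  "field_embedding f \<longleftrightarrow>
     f 1 = 1 \<and> (\<forall>x y. f (x + y) = f x + f y) \<and> (\<forall>x y. f (x * y) = f x * f y)"

text \<open>
  The \<open>s\<close> real embeddings are indexed by a finite type \<open>'r\<close> with \<open>CARD('r) = s\<close>; the finite
  type \<open>'c\<close> with \<open>CARD('c) = t\<close> indexes one embedding out of each pair of conjugate non-real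
  embeddings, so that \<open>\<tau> j\<close> and \<open>cnj \<circ> \<tau> j\<close> correspond to \<open>\<sigma>\<^bsub>s+j\<^esub>\<close> and \<open>\<sigma>\<^bsub>s+t+j\<^esub>\<close>.
  As types are inhabited, \<open>s \<ge> 1\<close> and \<open>t \<ge> 1\<close> hold automatically.
\<close>

definition embedding_labelling ::
    "('r::finite \<Rightarrow> 'k::field_char_0 \<Rightarrow> real) \<Rightarrow> ('c::finite \<Rightarrow> 'k \<Rightarrow> complex) \<Rightarrow> bool" where
  "embedding_labelling \<sigma> \<tau> \<longleftrightarrow>
     bij_betw \<sigma> UNIV {f. field_embedding f} \<and>
     bij_betw (\<lambda>(j, conj). if conj then cnj \<circ> \<tau> j else \<tau> j) (UNIV \<times> UNIV)
       {f. field_embedding f \<and> \<not> range f \<subseteq> \<real>}"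

definition ring_of_integers :: "'k::field_char_0 set" where
  "ring_of_integers = {x. algebraic_int x}"

definition totally_positive_units ::
    "('r \<Rightarrow> 'k::field_char_0 \<Rightarrow> real) \<Rightarrow> 'k set" where
  "totally_positive_units \<sigma> =
     {u \<in> ring_of_integers. (\<exists>v\<in>ring_of_integers. u * v = 1) \<and> (\<forall>i. \<sigma> i u > 0)}"

definition totally_positive_unit_group ::
    "('r \<Rightarrow> 'k::field_char_0 \<Rightarrow> real) \<Rightarrow> 'k monoid" where
  "totally_positive_unit_group \<sigma> =
     \<lparr>carrier = totally_positive_units \<sigma>, monoid.mult = (*), one = 1\<rparr>"

definition log_embedding ::
    "('r::finite \<Rightarrow> 'k \<Rightarrow> real) \<Rightarrow> ('c::finite \<Rightarrow> 'k \<Rightarrow> complex) \<Rightarrow> 'k \<Rightarrow> (real^'r) \<times> (real^'c)" where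
  "log_embedding \<sigma> \<tau> u = ((\<chi> i. ln (\<sigma> i u)), (\<chi> j. 2 * ln (cmod (\<tau> j u))))"

definition lattice_of_rank :: "nat \<Rightarrow> 'v::euclidean_space set \<Rightarrow> bool" where
  "lattice_of_rank n L \<longleftrightarrow>
     (\<exists>B. independent B \<and> card B = n \<and> L = {\<Sum>b\<in>B. of_int (k b) *\<^sub>R b | k. True})"

definition admissible ::
    "('r::finite \<Rightarrow> 'k::field_char_0 \<Rightarrow> real) \<Rightarrow> ('c::finite \<Rightarrow> 'k \<Rightarrow> complex) \<Rightarrow> 'k set \<Rightarrow> bool" where
  "admissible \<sigma> \<tau> U \<longleftrightarrow>
     subgroup U (totally_positive_unit_group \<sigma>) \<and>
     (totally_positive_unit_group \<sigma>)\<lparr>carrier := U\<rparr> \<cong> free_Abelian_group (UNIV :: 'r set) \<and>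
     lattice_of_rank CARD('r) (fst ` log_embedding \<sigma> \<tau> ` U)"

type_synonym ('r, 'c) cspace = "(complex^'r) \<times> (complex^'c)"

definition ot_domain :: "('r::finite, 'c::finite) cspace set" where
  "ot_domain = {(w, z). \<forall>i. Im (w $ i) > 0}"

definition translation ::
    "('r::finite \<Rightarrow> 'k \<Rightarrow> real) \<Rightarrow> ('c::finite \<Rightarrow> 'k \<Rightarrow> complex) \<Rightarrow> 'k
      \<Rightarrow> ('r, 'c) cspace \<Rightarrow> ('r, 'c) cspace" where
  "translation \<sigma> \<tau> a = (\<lambda>(w, z). ((\<chi> i. w $ i + of_real (\<sigma> i a)), (\<chi> j. z $ j + \<tau> j a)))"

definition rotation ::
    "('r::finite \<Rightarrow> 'k \<Rightarrow> real) \<Rightarrow> ('c::finite \<Rightarrow> 'k \<Rightarrow> complex) \<Rightarrow> 'k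
      \<Rightarrow> ('r, 'c) cspace \<Rightarrow> ('r, 'c) cspace" where
  "rotation \<sigma> \<tau> u = (\<lambda>(w, z). ((\<chi> i. of_real (\<sigma> i u) * w $ i), (\<chi> j. \<tau> j u * z $ j)))"

definition ot_orbit_rel ::
    "('r::finite \<Rightarrow> 'k::field_char_0 \<Rightarrow> real) \<Rightarrow> ('c::finite \<Rightarrow> 'k \<Rightarrow> complex) \<Rightarrow> 'k set
      \<Rightarrow> ('r, 'c) cspace rel" where
  "ot_orbit_rel \<sigma> \<tau> U =
     {(x, y). x \<in> ot_domain \<and> y \<in> ot_domain \<and>
        (\<exists>u\<in>U. \<exists>a\<in>ring_of_integers. y = translation \<sigma> \<tau> a (rotation \<sigma> \<tau> u x))}"

definition ot_manifold ::
    "('r::finite \<Rightarrow> 'k::field_char_0 \<Rightarrow> real) \<Rightarrow> ('c::finite \<Rightarrow> 'k \<Rightarrow> complex) \<Rightarrow> 'k set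
      \<Rightarrow> ('r, 'c) cspace set set" where
  "ot_manifold \<sigma> \<tau> U = ot_domain // ot_orbit_rel \<sigma> \<tau> U"

definition ot_proj ::
    "('r::finite \<Rightarrow> 'k::field_char_0 \<Rightarrow> real) \<Rightarrow> ('c::finite \<Rightarrow> 'k \<Rightarrow> complex) \<Rightarrow> 'k set
      \<Rightarrow> ('r, 'c) cspace \<Rightarrow> ('r, 'c) cspace set" where
  "ot_proj \<sigma> \<tau> U x = ot_orbit_rel \<sigma> \<tau> U `` {x}"

text \<open>
  A chart is a pair of its domain and its coordinate map. The quotient complex structure is
  given by the local inverses of the quotient map; since \<open>U \<ltimes> O\<^sub>K\<close> acts freely and
  properly discontinuously, their domains cover the quotient.
\<close>

type_synonym ('x, 'v) chart = "'x set \<times> ('x \<Rightarrow> 'v)"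

definition ot_atlas ::
    "('r::finite \<Rightarrow> 'k::field_char_0 \<Rightarrow> real) \<Rightarrow> ('c::finite \<Rightarrow> 'k \<Rightarrow> complex) \<Rightarrow> 'k set
      \<Rightarrow> (('r, 'c) cspace set, ('r, 'c) cspace) chart set" where
  "ot_atlas \<sigma> \<tau> U =
     {(P, inv_into V (ot_proj \<sigma> \<tau> U)) | P V. P \<subseteq> ot_manifold \<sigma> \<tau> U \<and>
        open V \<and> V \<subseteq> ot_domain \<and> bij_betw (ot_proj \<sigma> \<tau> U) V P}"

text \<open>
  A real \<open>k\<close>-form \<open>\<omega>\<close> on an open subset of a real vector space is given by its values
  \<open>\<omega> x [v\<^sub>1, \<dots>, v\<^sub>k]\<close>; its values on lists of other lengths are irrelevant.
\<close>

type_synonym 'v form = "'v \<Rightarrow> 'v list \<Rightarrow> real"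

definition ext_deriv :: "'v::euclidean_space form \<Rightarrow> 'v form" where
  "ext_deriv \<omega> x vs =
     (\<Sum>i<length vs. (-1) ^ i *
        frechet_derivative (\<lambda>y. \<omega> y (take i vs @ drop (Suc i) vs)) (at x) (vs ! i))"

definition Jmult :: "('r::finite, 'c::finite) cspace \<Rightarrow> ('r, 'c) cspace" where
  "Jmult = (\<lambda>(w, z). ((\<chi> i. \<i> * w $ i), (\<chi> j. \<i> * z $ j)))"

text \<open>
  \<open>d\<^sup>c = J\<inverse> d J\<close>, where \<open>(J \<alpha>)(v\<^sub>1, \<dots>, v\<^sub>k) = \<alpha>(J v\<^sub>1, \<dots>, J v\<^sub>k)\<close>. As \<open>J\<close> acts on
  \<open>(p, q)\<close>-forms as \<open>\<i>\<^bsup>p-q\<^esup>\<close>, this is \<open>\<i> (\<partial>\<^bsub>bar\<^esub> - \<partial>)\<close>, whence \<open>d d\<^sup>c = 2 \<i> \<partial> \<partial>\<^bsub>bar\<^esub>\<close>.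
\<close>

definition dc :: "('r::finite, 'c::finite) cspace form \<Rightarrow> ('r, 'c) cspace form" where
  "dc \<omega> x vs = ext_deriv (\<lambda>y ws. \<omega> y (map Jmult ws)) x (map (\<lambda>v. - Jmult v) vs)"

fun times_differentiable_on :: "nat \<Rightarrow> ('v::euclidean_space \<Rightarrow> real) \<Rightarrow> 'v set \<Rightarrow> bool" where
  "times_differentiable_on 0 f S \<longleftrightarrow> continuous_on S f"
| "times_differentiable_on (Suc n) f S \<longleftrightarrow>
     (\<forall>x\<in>S. f differentiable (at x)) \<and>
     (\<forall>v. times_differentiable_on n (\<lambda>x. frechet_derivative f (at x) v) S)"

definition smooth_fun_on :: "('v::euclidean_space \<Rightarrow> real) \<Rightarrow> 'v set \<Rightarrow> bool" where
  "smooth_fun_on f S \<longleftrightarrow> (\<forall>n. times_differentiable_on n f S)"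

text \<open>
  Smooth positive real \<open>(1,1)\<close>-forms on an open set. The associated Riemannian metric is
  \<open>g(v, w) = \<omega>(v, J w)\<close>.
\<close>

definition hermitian_form_on :: "('r::finite, 'c::finite) cspace set \<Rightarrow> ('r, 'c) cspace form \<Rightarrow> bool" where
  "hermitian_form_on S \<omega> \<longleftrightarrow>
     (\<forall>v w. smooth_fun_on (\<lambda>x. \<omega> x [v, w]) S) \<and>
     (\<forall>x\<in>S. bilinear (\<lambda>v w. \<omega> x [v, w]) \<and>
        (\<forall>v. \<omega> x [v, v] = 0) \<and>
        (\<forall>v w. \<omega> x [Jmult v, Jmult w] = \<omega> x [v, w]) \<and>
        (\<forall>v. v \<noteq> 0 \<longrightarrow> \<omega> x [v, Jmult v] > 0))"

text \<open>
  A Hermitian metric on the manifold with atlas \<open>A\<close>, identified with its fundamental form, is a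
  family of coordinate representations \<open>\<Omega> c\<close> on the images of the charts \<open>c\<close> which are related
  by pullback along the coordinate changes.
\<close>

definition hermitian_metric ::
    "('x, ('r::finite, 'c::finite) cspace) chart set
      \<Rightarrow> (('x, ('r, 'c) cspace) chart \<Rightarrow> ('r, 'c) cspace form) \<Rightarrow> bool" where
  "hermitian_metric A \<Omega> \<longleftrightarrow>
     (\<forall>(P, \<phi>)\<in>A. hermitian_form_on (\<phi> ` P) (\<Omega> (P, \<phi>))) \<and>
     (\<forall>(P, \<phi>)\<in>A. \<forall>(Q, \<psi>)\<in>A. \<forall>x\<in>\<phi> ` (P \<inter> Q). \<forall>v w.
        (let f = \<psi> \<circ> inv_into P \<phi>; Df = frechet_derivative f (at x)
         in \<Omega> (P, \<phi>) x [v, w] = \<Omega> (Q, \<psi>) (f x) [Df v, Df w]))"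

definition pluriclosed ::
    "('x, ('r::finite, 'c::finite) cspace) chart set
      \<Rightarrow> (('x, ('r, 'c) cspace) chart \<Rightarrow> ('r, 'c) cspace form) \<Rightarrow> bool" where
  "pluriclosed A \<Omega> \<longleftrightarrow>
     (\<forall>(P, \<phi>)\<in>A. \<forall>x\<in>\<phi> ` P. \<forall>vs. length vs = 4 \<longrightarrow> ext_deriv (dc (\<Omega> (P, \<phi>))) x vs = 0)"

end

theory Submission
  imports Defs "Jordan_Normal_Form.Char_Poly"
begin

text \<open>
  Let \<open>H\<close> be the upper half plane. Write \<open>w = x + i y\<close> for the coordinates in \<open>H\<^sup>s\<close> and \<open>z\<close> for those
  in \<open>\<complex>\<^sup>t\<close>.

  Let a pluriclosed metric be given. Pulled back to \<open>H\<^sup>s \<times> \<complex>\<^sup>t\<close>, it is a form \<open>\<omega>\<close> which is invariant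
  under the integers, acting by translations, and under \<open>U\<close>, acting by multiplication. The
  integers contain a basis of the real span \<open>\<real>\<^sup>s \<times> \<complex>\<^sup>t\<close> of the directions \<open>x, z\<close>
  (\<open>span_ring_of_integers\<close>, by the linear independence of field embeddings), so that the
  coefficients of \<open>\<omega>\<close> are periodic in these directions and can be averaged over a period
  parallelepiped. The averages depend on \<open>y\<close> alone, and averaging commutes with all derivatives. Let
  \<open>g\<close> be the average of the coefficient of \<open>i dz\<^sub>j \<and> dz\<^sub>j\<^sup>*\<close>, where the star denotes conjugation. In
  the coefficient of \<open>dw\<^sub>a \<and> dw\<^sub>b\<^sup>* \<and> dz\<^sub>j \<and> dz\<^sub>j\<^sup>*\<close> of the averaged equation \<open>d d\<^sup>c \<omega> = 0\<close> all terms but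
  one contain a derivative with respect to \<open>z\<close>, and what remains says that the second derivatives
  of \<open>g\<close> vanish (\<open>second_derivative_of_mean_vanishes\<close>). Hence \<open>g = c\<^sub>0 + \<Sum> c\<^sub>i y\<^sub>i\<close>; it is positive, and
  invariance under \<open>u \<in> U\<close> reads \<open>|\<tau>\<^sub>j(u)|\<^sup>2 g(\<sigma>(u) y) = g(y)\<close>. A coefficient \<open>c\<^sub>0 \<noteq> 0\<close> forces \<open>|\<tau>\<^sub>j| = 1\<close>
  on \<open>U\<close>, a coefficient \<open>c\<^sub>i \<noteq> 0\<close> forces \<open>|\<tau>\<^sub>j|\<^sup>2 \<sigma>\<^sub>i = 1\<close> on \<open>U\<close>
  (\<open>alternative_for_complex_embedding\<close>). Thus each complex embedding gets a label, namely
  nothing or a real embedding. Taking logarithms in \<open>\<Prod> \<sigma>\<^sub>i(u) \<Prod> |\<tau>\<^sub>j(u)|\<^sup>2 = 1\<close> and using that the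
  logarithms of the \<open>\<sigma>\<^sub>i\<close> map \<open>U\<close> onto a lattice of full rank, one sees that every real embedding is
  the label of exactly one complex embedding (\<open>each_real_embedding_compensated_once\<close>); this is the
  required relabelling.

  Conversely, labels define the form \<open>\<Sum> y\<^sub>i\<^sup>-\<^sup>2 i dw\<^sub>i \<and> dw\<^sub>i\<^sup>* + \<Sum> h\<^sub>j i dz\<^sub>j \<and> dz\<^sub>j\<^sup>*\<close>, up to constant
  factors, with \<open>h\<^sub>j = y\<^sub>i\<close> if \<open>j\<close> has the label \<open>i\<close> and \<open>h\<^sub>j = 1\<close> if it has none. The label relations
  say that it is invariant, and it is pluriclosed because each summand of the first kind lives on
  a curve while the weights \<open>h\<^sub>j\<close> are affine.

  To pass between the quotient and \<open>H\<^sup>s \<times> \<complex>\<^sup>t\<close> one needs that small open sets are charts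
  (\<open>chart_domain_exists\<close>). This uses the discreteness of the lattice of logarithms and of the
  integers; the latter follows from the integrality of the norm.
\<close>

text \<open>
  The matrix library uses the notations for components and inner products of Euclidean vectors for
  its own vectors.
\<close>

no_notation vec_index (infixl \<open>$\<close> 100)
no_notation scalar_prod (infix \<open>\<bullet>\<close> 70)

section \<open>Algebraic integers form a ring\<close>

text \<open>
  The assumption says that \<open>v\<close> is an eigenvector, with eigenvalue \<open>x\<close>, of an integer matrix; so \<open>x\<close>
  is a root of its characteristic polynomial.
\<close>

lemma algebraic_int_if_stable_module:
  fixes x :: "'a::field_char_0" and v :: "'i \<Rightarrow> 'a"
  assumes fin: "finite I" and nz: "\<exists>i\<in>I. v i \<noteq> 0"
    and stable: "\<And>i. i \<in> I \<Longrightarrow> \<exists>c::'i \<Rightarrow> int. x * v i = (\<Sum>j\<in>I. of_int (c j) * v j)"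
  shows "algebraic_int x"
proof -
  obtain h where h: "bij_betw h {0..<card I} I"
    using ex_bij_betw_nat_finite[OF fin] by blast
  obtain c :: "'i \<Rightarrow> 'i \<Rightarrow> int" where c: "\<And>i. i \<in> I \<Longrightarrow> x * v i = (\<Sum>j\<in>I. of_int (c i j) * v j)"
    using stable by metis
  define n where "n = card I"
  define A where "A = Matrix.mat n n (\<lambda>(i, j). c (h i) (h j))"
  define A' :: "'a Matrix.mat" where "A' = map_mat of_int A"
  define w where "w = Matrix.vec n (\<lambda>i. v (h i))"
  have A: "A \<in> carrier_mat n n" and A': "A' \<in> carrier_mat n n" and w: "w \<in> carrier_vec n"
    by (auto simp: A_def A'_def w_def)
  have hI: "h i \<in> I" if "i < n" for i
    using h that by (auto simp: bij_betw_def n_def)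
  have "A' *\<^sub>v w = x \<cdot>\<^sub>v w"
  proof (rule eq_vecI)
    fix i assume "i < dim_vec (x \<cdot>\<^sub>v w)"
    then have i: "i < n" by (simp add: w_def)
    have "(\<Sum>j\<in>I. of_int (c (h i) j) * v j) = (\<Sum>j\<in>{0..<n}. of_int (c (h i) (h j)) * v (h j))"
      using sum.reindex_bij_betw[OF h, of "\<lambda>j. of_int (c (h i) j) * v j"] by (simp add: n_def)
    then show "vec_index (A' *\<^sub>v w) i = vec_index (x \<cdot>\<^sub>v w) i"
      using i c[OF hI[OF i]] by (simp add: A'_def A_def w_def scalar_prod_def)
  qed (auto simp: A'_def A_def w_def)
  moreover have "w \<noteq> 0\<^sub>v n"
  proof -
    obtain i where "i \<in> I" "v i \<noteq> 0" using nz by blast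
    then obtain k where "k < n" "h k = i"
      using bij_betw_imp_surj_on[OF h] unfolding n_def by (metis atLeastLessThan_iff imageE)
    then have "vec_index w k \<noteq> 0" using \<open>v i \<noteq> 0\<close> by (simp add: w_def)
    then show ?thesis using \<open>k < n\<close> by auto
  qed
  ultimately have "eigenvalue A' x"
    unfolding eigenvalue_def eigenvector_def using w A' by auto
  then have "poly (char_poly A') x = 0"
    using eigenvalue_root_char_poly[OF A'] by simp
  moreover have "char_poly A' = map_poly of_int (char_poly A)"
    unfolding A'_def by (rule of_int_hom.char_poly_hom[OF A])
  ultimately show ?thesis
    unfolding algebraic_int_altdef_ipoly using degree_monic_char_poly[OF A] by metis
qed

definition int_span :: "('i \<Rightarrow> 'a::ring_1) \<Rightarrow> 'i set \<Rightarrow> 'a set" where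
  "int_span v I = {x. \<exists>c::'i \<Rightarrow> int. x = (\<Sum>i\<in>I. of_int (c i) * v i)}"

lemma int_spanI: "x = (\<Sum>i\<in>I. of_int (c i) * v i) \<Longrightarrow> x \<in> int_span v I"
  unfolding int_span_def by blast

lemma int_span_add: "x \<in> int_span v I \<Longrightarrow> y \<in> int_span v I \<Longrightarrow> x + y \<in> int_span v I"
proof -
  assume "x \<in> int_span v I" "y \<in> int_span v I"
  then obtain c d where "x = (\<Sum>i\<in>I. of_int (c i) * v i)" "y = (\<Sum>i\<in>I. of_int (d i) * v i)"
    by (auto simp: int_span_def)
  then have "x + y = (\<Sum>i\<in>I. of_int (c i + d i) * v i)"
    by (simp add: sum.distrib distrib_right)
  then show ?thesis by (rule int_spanI)
qed

lemma int_span_scale: "x \<in> int_span v I \<Longrightarrow> of_int k * x \<in> int_span v I"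
proof -
  assume "x \<in> int_span v I"
  then obtain c where "x = (\<Sum>i\<in>I. of_int (c i) * v i)"
    by (auto simp: int_span_def)
  then have "of_int k * x = (\<Sum>i\<in>I. of_int (k * c i) * v i)"
    by (simp add: sum_distrib_left mult.assoc)
  then show ?thesis by (rule int_spanI)
qed

lemma int_span_sum:
  "(\<And>a. a \<in> A \<Longrightarrow> f a \<in> int_span v I) \<Longrightarrow> sum f A \<in> int_span v I"
proof (induction A rule: infinite_finite_induct)
  case (infinite A)
  then show ?case by (auto simp: int_span_def intro!: exI[of _ "\<lambda>_. 0"])
next
  case empty
  then show ?case by (auto simp: int_span_def intro!: exI[of _ "\<lambda>_. 0"])
qed (auto intro: int_span_add)

lemma int_span_base: "finite I \<Longrightarrow> i \<in> I \<Longrightarrow> v i \<in> int_span v I"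
proof -
  assume "finite I" "i \<in> I"
  then have "v i = (\<Sum>j\<in>I. of_int (if j = i then 1 else 0) * v j)"
    by (simp add: if_distrib[of of_int] if_distrib[of "\<lambda>x. x * _"] cong: if_cong)
  then show ?thesis by (rule int_spanI)
qed

lemma power_reduction_algebraic_int:
  fixes x :: "'a::field_char_0"
  assumes "algebraic_int x"
  obtains m where "m > 0" and "x ^ m \<in> int_span (\<lambda>i. x ^ i) {..<m}"
proof -
  obtain p :: "int poly" where p: "poly (map_poly of_int p) x = 0" "lead_coeff p = 1"
    using assms unfolding algebraic_int_altdef_ipoly by blast
  define m where "m = degree p"
  have "m > 0"
  proof (rule ccontr)
    assume "\<not> m > 0"
    then have "p = [:1:]" using p(2) unfolding m_def by (metis degree_eq_zeroE lead_coeff_pCons(2) not_gr_zero)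
    then show False using p(1) by simp
  qed
  have "0 = (\<Sum>i\<le>m. of_int (coeff p i) * x ^ i)"
    using p(1) by (simp add: poly_altdef m_def degree_map_poly coeff_map_poly)
  also have "\<dots> = (\<Sum>i<m. of_int (coeff p i) * x ^ i) + x ^ m"
    using p(2) by (simp add: m_def lessThan_Suc_atMost[symmetric])
  finally have "x ^ m = (\<Sum>i<m. of_int (- coeff p i) * x ^ i)"
    by (simp add: sum_negf eq_neg_iff_add_eq_0 add.commute)
  then have "x ^ m \<in> int_span (\<lambda>i. x ^ i) {..<m}"
    by (rule int_spanI)
  with \<open>m > 0\<close> show ?thesis using that by blast
qed

text \<open>
  The \<open>\<int>\<close>-module generated by the finitely many monomials \<open>x\<^sup>i y\<^sup>j\<close> below the two degrees is stable under
  multiplication by \<open>x\<close> and by \<open>y\<close>, hence by their sum and product.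
\<close>

lemma algebraic_int_add_mult:
  fixes x y :: "'a::field_char_0"
  assumes "algebraic_int x" "algebraic_int y"
  shows "algebraic_int (x + y) \<and> algebraic_int (x * y)"
proof -
  obtain m where m: "m > 0" "x ^ m \<in> int_span (\<lambda>i. x ^ i) {..<m}"
    using power_reduction_algebraic_int[OF assms(1)] .
  obtain n where n: "n > 0" "y ^ n \<in> int_span (\<lambda>i. y ^ i) {..<n}"
    using power_reduction_algebraic_int[OF assms(2)] .
  define I where "I = {..<m} \<times> {..<n}"
  define v where "v = (\<lambda>(i, j). x ^ i * y ^ j)"
  have fin: "finite I" by (simp add: I_def)
  have vI: "x ^ i * y ^ j \<in> int_span v I" if "i < m" "j < n" for i j
    using int_span_base[OF fin, of "(i, j)" v] that by (simp add: I_def v_def)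
  have x: "x * z \<in> int_span v I" if z: "z \<in> int_span v I" for z
  proof -
    have "x * v k \<in> int_span v I" if "k \<in> I" for k
    proof -
      obtain i j where k: "k = (i, j)" "i < m" "j < n" using \<open>k \<in> I\<close> by (auto simp: I_def)
      show ?thesis
      proof (cases "Suc i < m")
        case True
        then show ?thesis using vI[of "Suc i" j] k by (simp add: v_def mult.assoc)
      next
        case False
        then have "Suc i = m" using k by simp
        then have "x * v k = x ^ m * y ^ j" using k by (auto simp: v_def)
        moreover obtain c where "x ^ m = (\<Sum>i<m. of_int (c i) * x ^ i)"
          using m(2) unfolding int_span_def by blast
        ultimately have "x * v k = (\<Sum>i<m. of_int (c i) * (x ^ i * y ^ j))"
          by (simp add: sum_distrib_right mult.assoc)
        also have "\<dots> \<in> int_span v I"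
          using vI k by (intro int_span_sum int_span_scale) auto
        finally show ?thesis .
      qed
    qed
    moreover obtain c where "z = (\<Sum>k\<in>I. of_int (c k) * v k)"
      using z unfolding int_span_def by blast
    then have "x * z = (\<Sum>k\<in>I. of_int (c k) * (x * v k))"
      by (simp add: sum_distrib_left mult.left_commute)
    ultimately show ?thesis by (auto intro!: int_span_sum int_span_scale)
  qed
  have y: "y * z \<in> int_span v I" if z: "z \<in> int_span v I" for z
  proof -
    have "y * v k \<in> int_span v I" if "k \<in> I" for k
    proof -
      obtain i j where k: "k = (i, j)" "i < m" "j < n" using \<open>k \<in> I\<close> by (auto simp: I_def)
      show ?thesis
      proof (cases "Suc j < n")
        case True
        then show ?thesis using vI[of i "Suc j"] k by (simp add: v_def mult.left_commute)
      next
        case False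
        then have "Suc j = n" using k by simp
        then have "y * v k = x ^ i * y ^ n" using k by (auto simp: v_def)
        moreover obtain c where "y ^ n = (\<Sum>i<n. of_int (c i) * y ^ i)"
          using n(2) unfolding int_span_def by blast
        ultimately have "y * v k = (\<Sum>j<n. of_int (c j) * (x ^ i * y ^ j))"
          by (simp add: sum_distrib_left mult.left_commute)
        also have "\<dots> \<in> int_span v I"
          using vI k by (intro int_span_sum int_span_scale) auto
        finally show ?thesis .
      qed
    qed
    moreover obtain c where "z = (\<Sum>k\<in>I. of_int (c k) * v k)"
      using z unfolding int_span_def by blast
    then have "y * z = (\<Sum>k\<in>I. of_int (c k) * (y * v k))"
      by (simp add: sum_distrib_left mult.left_commute)
    ultimately show ?thesis by (auto intro!: int_span_sum int_span_scale)
  qed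
  have nz: "\<exists>i\<in>I. v i \<noteq> 0"
    using m(1) n(1) by (intro bexI[of _ "(0, 0)"]) (auto simp: v_def I_def)
  have base: "v i \<in> int_span v I" if "i \<in> I" for i
    using int_span_base[OF fin that] .
  show ?thesis
  proof
    show "algebraic_int (x + y)"
    proof (rule algebraic_int_if_stable_module[OF fin nz])
      fix i assume "i \<in> I"
      then have "(x + y) * v i \<in> int_span v I"
        unfolding distrib_right by (intro int_span_add x y base)
      then show "\<exists>c::_ \<Rightarrow> int. (x + y) * v i = (\<Sum>j\<in>I. of_int (c j) * v j)"
        unfolding int_span_def by blast
    qed
    show "algebraic_int (x * y)"
    proof (rule algebraic_int_if_stable_module[OF fin nz])
      fix i assume "i \<in> I"
      then have "(x * y) * v i \<in> int_span v I"
        unfolding mult.assoc by (intro x y base)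
      then show "\<exists>c::_ \<Rightarrow> int. (x * y) * v i = (\<Sum>j\<in>I. of_int (c j) * v j)"
        unfolding int_span_def by blast
    qed
  qed
qed

lemmas algebraic_int_add = conjunct1[OF algebraic_int_add_mult]
  and algebraic_int_mult = conjunct2[OF algebraic_int_add_mult]

section \<open>Field embeddings and the norm\<close>

lemma field_embedding_simps:
  assumes f: "field_embedding f"
  shows "f 1 = 1" "f (x + y) = f x + f y" "f (x * y) = f x * f y" "f 0 = 0" "f (- x) = - f x"
    "f (x - y) = f x - f y" "f (x ^ n) = f x ^ n" "f (of_nat n) = of_nat n" "f (of_int k) = of_int k"
    "f (sum g A) = (\<Sum>a\<in>A. f (g a))"
proof -
  show 1: "f 1 = 1" and add: "f (x + y) = f x + f y" and mult: "f (x * y) = f x * f y" for x y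
    using f by (auto simp: field_embedding_def)
  show zero: "f 0 = 0" using add[of 0 0] by (metis add.right_neutral add_left_cancel)
  show minus: "f (- x) = - f x" for x
    using add[of x "- x"] zero by (simp add: eq_neg_iff_add_eq_0 add.commute)
  show diff: "f (x - y) = f x - f y"
    using add[of x "- y"] minus by simp
  show "f (x ^ n) = f x ^ n" by (induction n) (simp_all add: 1 mult)
  show nat: "f (of_nat n) = of_nat n" for n by (induction n) (simp_all add: 1 add zero)
  show "f (of_int k) = of_int k" by (cases k) (simp_all only: of_int_of_nat_eq of_int_minus nat minus)
  show "f (sum g A) = (\<Sum>a\<in>A. f (g a))"
    by (induction A rule: infinite_finite_induct) (simp_all add: add zero)
qed

lemma field_embedding_eq_0_iff:
  assumes f: "field_embedding f"
  shows "f x = 0 \<longleftrightarrow> x = 0"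
proof
  assume "f x = 0"
  show "x = 0"
  proof (rule ccontr)
    assume "x \<noteq> 0"
    then have "f x * f (inverse x) = 1"
      using field_embedding_simps(1,3)[OF f] by (metis right_inverse)
    then show False using \<open>f x = 0\<close> by simp
  qed
qed (simp add: field_embedding_simps(4)[OF f])

lemma field_embedding_inject:
  assumes f: "field_embedding f"
  shows "f x = f y \<longleftrightarrow> x = y"
  using field_embedding_eq_0_iff[OF f, of "x - y"] field_embedding_simps(6)[OF f, of x y] by auto

lemma field_embedding_of_rat:
  fixes f :: "'k::field_char_0 \<Rightarrow> 'l::field_char_0"
  assumes f: "field_embedding f"
  shows "f (of_rat q) = of_rat q"
proof (cases q)
  case (Fract a b)
  have q: "of_rat q = (of_int a / of_int b :: 'k)" "of_rat q = (of_int a / of_int b :: 'l)"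
    and b: "of_int b \<noteq> (0::'k)" "of_int b \<noteq> (0::'l)"
    using Fract by (simp_all add: of_rat_rat)
  have "f (of_rat q) * of_int b = f (of_rat q * of_int b)"
    by (simp add: field_embedding_simps[OF f])
  also have "\<dots> = of_int a"
    using b by (simp add: q field_embedding_simps[OF f])
  finally show ?thesis
    using b(2) by (simp only: q eq_divide_eq if_False not_False_eq_True if_True)
qed

lemma field_embedding_algebraic_int:
  fixes f :: "'k::field_char_0 \<Rightarrow> 'l::field_char_0"
  assumes f: "field_embedding f" and x: "algebraic_int x"
  shows "algebraic_int (f x)"
proof -
  obtain p :: "int poly" where p: "poly (map_poly of_int p) x = 0" "lead_coeff p = 1"
    using x unfolding algebraic_int_altdef_ipoly by blast
  have "f (poly (map_poly of_int p) x) = poly (map_poly of_int p) (f x)"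
    by (simp add: poly_altdef degree_map_poly coeff_map_poly field_embedding_simps[OF f])
  then have "poly (map_poly of_int p) (f x) = 0"
    using p(1) by (simp add: field_embedding_simps[OF f])
  then show ?thesis
    unfolding algebraic_int_altdef_ipoly using p(2) by blast
qed

text \<open>
  Dedekind's argument: replacing \<open>x\<close> by \<open>y * x\<close> in a relation and subtracting \<open>g y\<close> times the relation
  removes \<open>g\<close> and multiplies the other coefficients by \<open>f y - g y\<close>, which is nonzero for a suitable \<open>y\<close>.
\<close>

lemma field_embeddings_independent_set:
  fixes c :: "('k::field \<Rightarrow> 'l::field) \<Rightarrow> 'l"
  assumes "finite F" and "\<And>f. f \<in> F \<Longrightarrow> field_embedding f" and "\<And>x. (\<Sum>f\<in>F. c f * f x) = 0"
  shows "\<forall>f\<in>F. c f = 0"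
  using assms
proof (induction F arbitrary: c rule: finite_induct)
  case (insert g F)
  have g: "field_embedding g" using insert.prems by simp
  have eq: "(\<Sum>f\<in>F. c f * f x) = - (c g * g x)" for x
    using insert.prems(2)[of x] insert.hyps by (simp add: eq_neg_iff_add_eq_0 add.commute)
  have "c f = 0" if f: "f \<in> F" for f
  proof -
    obtain y where y: "f y \<noteq> g y" using insert.hyps f by (metis ext)
    have "(\<Sum>f\<in>F. (c f * (f y - g y)) * f x) = 0" for x
    proof -
      have "(\<Sum>f\<in>F. (c f * (f y - g y)) * f x) = (\<Sum>f\<in>F. c f * f (y * x)) - g y * (\<Sum>f\<in>F. c f * f x)"
        unfolding sum_distrib_left sum_subtractf[symmetric]
      proof (rule sum.cong[OF refl])
        fix f' assume "f' \<in> F"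
        then have "f' (y * x) = f' y * f' x"
          using insert.prems(1) field_embedding_simps(3) by blast
        then show "c f' * (f' y - g y) * f' x = c f' * f' (y * x) - g y * (c f' * f' x)"
          by (simp only: algebra_simps)
      qed
      also have "\<dots> = 0"
        unfolding eq by (simp add: field_embedding_simps(3)[OF g])
      finally show ?thesis .
    qed
    then have "\<forall>f\<in>F. c f * (f y - g y) = 0"
      using insert.prems(1) by (intro insert.IH) auto
    then show ?thesis using f y by auto
  qed
  moreover have "c g = 0"
    using eq[of 1] calculation by (simp add: field_embedding_simps(1)[OF g])
  ultimately show ?case by simp
qed simp

lemma field_embeddings_independent:
  fixes \<phi> :: "'i::finite \<Rightarrow> 'k::field \<Rightarrow> 'l::field"
  assumes "inj \<phi>" and emb: "\<And>i. field_embedding (\<phi> i)" and "\<And>x. (\<Sum>i\<in>UNIV. c i * \<phi> i x) = 0"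
  shows "c i = 0"
proof -
  have "(\<Sum>f\<in>range \<phi>. c (inv_into UNIV \<phi> f) * f x) = 0" for x
    unfolding sum.reindex[OF assms(1)] o_def inv_f_f[OF assms(1)] by (rule assms(3))
  then have "\<forall>f\<in>range \<phi>. c (inv_into UNIV \<phi> f) = 0"
    using field_embeddings_independent_set[of "range \<phi>" "\<lambda>f. c (inv_into UNIV \<phi> f)"] emb by auto
  then show ?thesis by (simp add: inv_f_f[OF assms(1)])
qed

lemma number_field_basis:
  assumes "number_field_of_degree TYPE('k::field_char_0) n"
  obtains B :: "'k::field_char_0 set" where "finite B" "card B = n"
    "\<And>x. \<exists>q. x = (\<Sum>b\<in>B. of_rat (q b) * b)"
proof -
  obtain B :: "'k set" where B: "finite_dimensional_vector_space (\<lambda>(q::rat) x. of_rat q * x) B"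
    and card: "card B = n"
    using assms unfolding number_field_of_degree_def by blast
  interpret V: finite_dimensional_vector_space "\<lambda>(q::rat) (x::'k). of_rat q * x" B by fact
  have "\<exists>q. x = (\<Sum>b\<in>B. of_rat (q b) * b)" for x
  proof -
    have "x \<in> range (\<lambda>q. \<Sum>b\<in>B. of_rat (q b) * b)"
      using V.span_finite[OF V.finite_Basis] V.span_Basis by simp
    then show ?thesis by blast
  qed
  with V.finite_Basis card show ?thesis using that by blast
qed

lemma common_denominator:
  assumes "finite (Q :: rat set)"
  obtains d :: int where "d > 0" "\<And>q. q \<in> Q \<Longrightarrow> of_int d * q \<in> \<int>"
proof -
  have "\<exists>d::int. d > 0 \<and> (\<forall>q\<in>Q. of_int d * q \<in> \<int>)"
    using assms
  proof (induction Q rule: finite_induct)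
    case (insert p Q)
    then obtain d :: int where d: "d > 0" "\<forall>q\<in>Q. of_int d * q \<in> \<int>" by blast
    obtain a b where p: "p = Rat.Fract a b" "b > 0" by (cases p) blast
    have "of_int (d * b) * p = of_int (d * a)"
      using p by (simp add: Fract_of_int_quotient)
    then have "of_int (d * b) * p \<in> \<int>" by (metis Ints_of_int)
    moreover have "of_int (d * b) * q \<in> \<int>" if "q \<in> Q" for q
    proof -
      have "of_int (d * b) * q = of_int b * (of_int d * q)" by simp
      then show ?thesis using d(2) that by (metis Ints_mult Ints_of_int)
    qed
    ultimately show ?case using d(1) p(2) by (intro exI[of _ "d * b"]) auto
  qed (auto intro: exI[of _ 1])
  then show ?thesis using that by blast
qed

text \<open>
  Multiplication by \<open>x\<close> is a rational matrix in a basis of the field; if \<open>d\<close> is a common denominator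
  of its entries, multiplication by \<open>d * x\<close> preserves the \<open>\<int>\<close>-module generated by the basis.
\<close>

lemma algebraic_int_multiple:
  fixes x :: "'k::field_char_0"
  assumes "number_field_of_degree TYPE('k) n"
  obtains d :: int where "d > 0" "algebraic_int (of_int d * x)"
proof -
  obtain B :: "'k set" where fin: "finite B" and B: "\<And>x. \<exists>q. x = (\<Sum>b\<in>B. of_rat (q b) * b)"
    using number_field_basis[OF assms] by metis
  have "\<forall>b. \<exists>q. x * b = (\<Sum>b'\<in>B. of_rat (q b') * b')" using B by blast
  then obtain q where q: "\<And>b. x * b = (\<Sum>b'\<in>B. of_rat (q b b') * b')" by metis
  obtain d :: int where d: "d > 0" "\<And>r. r \<in> (\<lambda>(b, b'). q b b') ` (B \<times> B) \<Longrightarrow> of_int d * r \<in> \<int>"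
    using common_denominator[of "(\<lambda>(b, b'). q b b') ` (B \<times> B)"] fin by blast
  have "\<exists>k. of_int d * q b b' = of_int k" if "b \<in> B" "b' \<in> B" for b b'
    using d(2)[of "q b b'"] that by (auto elim: Ints_cases)
  then obtain k where k: "\<And>b b'. b \<in> B \<Longrightarrow> b' \<in> B \<Longrightarrow> of_int d * q b b' = of_int (k b b')"
    by metis
  have "algebraic_int (of_int d * x)"
  proof (rule algebraic_int_if_stable_module[OF fin, of "\<lambda>b. b"])
    show "\<exists>i\<in>B. i \<noteq> 0"
    proof (rule ccontr)
      assume "\<not> (\<exists>i\<in>B. i \<noteq> 0)"
      moreover obtain q where "(1::'k) = (\<Sum>b\<in>B. of_rat (q b) * b)" using B by blast
      ultimately have "(1::'k) = 0" by (metis (no_types, lifting) mult_zero_right sum.neutral)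
      then show False by simp
    qed
    fix b assume b: "b \<in> B"
    have "of_int d * x * b = (\<Sum>b'\<in>B. of_rat (of_int d * q b b') * b')"
      by (simp add: mult.assoc q sum_distrib_left of_rat_mult)
    also have "\<dots> = (\<Sum>b'\<in>B. of_int (k b b') * b')"
      using k b by simp
    finally show "\<exists>c::'k \<Rightarrow> int. of_int d * x * b = (\<Sum>j\<in>B. of_int (c j) * j)" by (intro exI)
  qed
  with d(1) show ?thesis using that by blast
qed

text \<open>
  The embeddings diagonalize the rational matrix \<open>A\<close> of multiplication by \<open>a\<close>: the matrix \<open>E\<close> of the
  embeddings of a basis satisfies \<open>E A = diag(\<phi>\<^sub>i(a)) E\<close>. It is invertible by the independence of the
  embeddings, so the product is \<open>det A\<close>. Here the number of embeddings has to equal the degree.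
\<close>

lemma prod_embeddings_in_Rats:
  fixes \<phi> :: "'i::finite \<Rightarrow> 'k::field_char_0 \<Rightarrow> complex"
  assumes deg: "number_field_of_degree TYPE('k) CARD('i)"
    and inj: "inj \<phi>" and emb: "\<And>i. field_embedding (\<phi> i)"
  shows "(\<Prod>i\<in>UNIV. \<phi> i a) \<in> \<rat>"
proof -
  obtain B :: "'k set" where fin: "finite B" "card B = CARD('i)"
      and B: "\<And>x. \<exists>q. x = (\<Sum>b\<in>B. of_rat (q b) * b)"
    using number_field_basis[OF deg] by metis
  obtain h :: "'i \<Rightarrow> 'k" where h: "bij_betw h UNIV B"
    using finite_same_card_bij[of "UNIV :: 'i set" B] fin by auto
  have basis: "\<exists>q. x = (\<Sum>i\<in>UNIV. of_rat (q i) * h i)" for x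
  proof -
    obtain q where "x = (\<Sum>b\<in>B. of_rat (q b) * b)" using B by blast
    also have "\<dots> = (\<Sum>i\<in>UNIV. of_rat (q (h i)) * h i)"
      by (rule sum.reindex_bij_betw[OF h, symmetric])
    finally show ?thesis by (rule exI[of _ "\<lambda>i. q (h i)"])
  qed
  then have "\<forall>j. \<exists>q. a * h j = (\<Sum>k\<in>UNIV. of_rat (q k) * h k)" by blast
  from choice[OF this] obtain q
    where q: "\<And>j. a * h j = (\<Sum>k\<in>UNIV. of_rat (q j k) * h k)" by blast
  define E :: "complex^'i^'i" where "E = (\<chi> i j. \<phi> i (h j))"
  define A :: "complex^'i^'i" where "A = (\<chi> k j. of_rat (q j k))"
  have EA: "E ** A = (\<chi> i. \<phi> i a *s E $ i)"
  proof -
    have "(\<Sum>k\<in>UNIV. \<phi> i (h k) * of_rat (q j k)) = \<phi> i a * \<phi> i (h j)" for i j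
    proof -
      have "\<phi> i a * \<phi> i (h j) = \<phi> i (\<Sum>k\<in>UNIV. of_rat (q j k) * h k)"
        using arg_cong[OF q[of j], of "\<phi> i"] unfolding field_embedding_simps(3)[OF emb] .
      also have "\<dots> = (\<Sum>k\<in>UNIV. \<phi> i (h k) * of_rat (q j k))"
        unfolding field_embedding_simps(3,10)[OF emb] field_embedding_of_rat[OF emb]
        by (intro sum.cong refl mult.commute)
      finally show ?thesis by (rule sym)
    qed
    then show ?thesis
      by (simp add: vec_eq_iff matrix_matrix_mult_def E_def A_def vector_scalar_mult_def fun_eq_iff)
  qed
  have "\<exists>E'. E ** E' = Finite_Cartesian_Product.mat 1"
    unfolding matrix_right_invertible_independent_rows
  proof (intro allI impI)
    fix c i assume rows: "(\<Sum>i\<in>UNIV. c i *s Finite_Cartesian_Product.row i E) = 0"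
    then have col: "(\<Sum>i\<in>UNIV. c i * \<phi> i (h j)) = 0" for j
    proof -
      have "(\<Sum>i\<in>UNIV. c i *s Finite_Cartesian_Product.row i E) $ j = 0"
        unfolding rows by simp
      then show ?thesis
        by (simp only: sum_component vector_smult_component Finite_Cartesian_Product.row_def
            vec_lambda_beta E_def)
    qed
    have "(\<Sum>i\<in>UNIV. c i * \<phi> i x) = 0" for x
    proof -
      obtain r where "x = (\<Sum>j\<in>UNIV. of_rat (r j) * h j)" using basis by blast
      then have "(\<Sum>i\<in>UNIV. c i * \<phi> i x) = (\<Sum>i\<in>UNIV. \<Sum>j\<in>UNIV. of_rat (r j) * (c i * \<phi> i (h j)))"
        by (simp add: field_embedding_simps[OF emb] field_embedding_of_rat[OF emb] sum_distrib_left mult.left_commute)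
      also have "\<dots> = (\<Sum>j\<in>UNIV. of_rat (r j) * (\<Sum>i\<in>UNIV. c i * \<phi> i (h j)))"
        unfolding sum_distrib_left by (rule sum.swap)
      finally show ?thesis using col by simp
    qed
    then show "c i = 0" using field_embeddings_independent[OF inj emb] by blast
  qed
  then obtain E' where "E ** E' = Finite_Cartesian_Product.mat 1" by blast
  then have "Determinants.det E * Determinants.det E' = 1"
    by (metis Determinants.det_mul Determinants.det_I)
  then have "Determinants.det E \<noteq> 0" by auto
  moreover have "Determinants.det E * Determinants.det A = (\<Prod>i\<in>UNIV. \<phi> i a) * Determinants.det E"
    using arg_cong[OF EA, of Determinants.det] Determinants.det_rows_mul[of "\<lambda>i. \<phi> i a" "\<lambda>i. E $ i"]
    by (simp add: Determinants.det_mul)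
  ultimately have "(\<Prod>i\<in>UNIV. \<phi> i a) = Determinants.det A" by simp
  also have "\<dots> \<in> \<rat>"
    unfolding Determinants.det_def A_def by (auto intro!: Rats_sum Rats_mult Rats_prod)
  finally show ?thesis .
qed

lemma prod_embeddings_in_Ints:
  fixes \<phi> :: "'i::finite \<Rightarrow> 'k::field_char_0 \<Rightarrow> complex"
  assumes deg: "number_field_of_degree TYPE('k) CARD('i)"
    and inj: "inj \<phi>" and emb: "\<And>i. field_embedding (\<phi> i)" and a: "algebraic_int a"
  shows "(\<Prod>i\<in>UNIV. \<phi> i a) \<in> \<int>"
proof -
  have "algebraic_int (\<Prod>i\<in>I. \<phi> i a)" if "finite I" for I
    using that
    by (induction I) (auto intro: algebraic_int_mult field_embedding_algebraic_int[OF emb a] int_imp_algebraic_int)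
  then have "algebraic_int (\<Prod>i\<in>UNIV. \<phi> i a)" by simp
  then show ?thesis
    by (rule rational_algebraic_int_is_int[OF _ prod_embeddings_in_Rats[OF deg inj emb]])
qed

section \<open>The lattice of integers\<close>

definition all_embeddings ::
    "('r \<Rightarrow> 'k \<Rightarrow> real) \<Rightarrow> ('c \<Rightarrow> 'k \<Rightarrow> complex) \<Rightarrow> 'r + 'c \<times> bool \<Rightarrow> 'k \<Rightarrow> complex" where
  "all_embeddings \<sigma> \<tau> e =
     (case e of Inl i \<Rightarrow> complex_of_real \<circ> \<sigma> i | Inr (j, b) \<Rightarrow> if b then cnj \<circ> \<tau> j else \<tau> j)"

definition lattice_point ::
    "('r::finite \<Rightarrow> 'k \<Rightarrow> real) \<Rightarrow> ('c::finite \<Rightarrow> 'k \<Rightarrow> complex) \<Rightarrow> 'k \<Rightarrow> ('r, 'c) cspace" where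
  "lattice_point \<sigma> \<tau> a = ((\<chi> i. of_real (\<sigma> i a)), (\<chi> j. \<tau> j a))"

text \<open>
  The directions \<open>x\<close> and \<open>z\<close>, in which the translations by integers act.
\<close>

definition real_directions :: "('r::finite, 'c::finite) cspace set" where
  "real_directions = {v. \<forall>i. Im (fst v $ i) = 0}"

lemma subspace_real_directions: "subspace (real_directions :: ('r::finite, 'c::finite) cspace set)"
  by (auto simp: subspace_def real_directions_def)

lemma translation_eq: "translation \<sigma> \<tau> a x = x + lattice_point \<sigma> \<tau> a"
  by (cases x) (simp add: translation_def lattice_point_def Finite_Cartesian_Product.vec_eq_iff)

lemma lattice_point_nth [simp]:
  "fst (lattice_point \<sigma> \<tau> a) $ i = of_real (\<sigma> i a)" "snd (lattice_point \<sigma> \<tau> a) $ j = \<tau> j a"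
  by (simp_all add: lattice_point_def)

locale labelled_number_field =
  fixes \<sigma> :: "'r::finite \<Rightarrow> 'k::field_char_0 \<Rightarrow> real"
    and \<tau> :: "'c::finite \<Rightarrow> 'k \<Rightarrow> complex"
  assumes degree: "number_field_of_degree TYPE('k) (CARD('r) + 2 * CARD('c))"
    and labelling: "embedding_labelling \<sigma> \<tau>"
begin

lemma \<sigma>_embedding: "field_embedding (\<sigma> i)"
  using labelling unfolding embedding_labelling_def bij_betw_def by blast

lemma \<tau>_embedding: "field_embedding (\<tau> j)" and \<tau>_not_real: "\<not> range (\<tau> j) \<subseteq> \<real>"
  and cnj_\<tau>_not_real: "\<not> range (cnj \<circ> \<tau> j) \<subseteq> \<real>"
proof -
  have im: "(\<lambda>(j, conj). if conj then cnj \<circ> \<tau> j else \<tau> j) ` (UNIV \<times> UNIV)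
      = {f. field_embedding f \<and> \<not> range f \<subseteq> \<real>}"
    using labelling unfolding embedding_labelling_def bij_betw_def by blast
  have "(\<lambda>(j, conj). if conj then cnj \<circ> \<tau> j else \<tau> j) (j, b) \<in> {f. field_embedding f \<and> \<not> range f \<subseteq> \<real>}" for b
    unfolding im[symmetric] by (rule imageI) simp
  from this[of False] this[of True]
  show "field_embedding (\<tau> j)" "\<not> range (\<tau> j) \<subseteq> \<real>" "\<not> range (cnj \<circ> \<tau> j) \<subseteq> \<real>" by auto
qed

lemmas \<sigma>_simps = field_embedding_simps[OF \<sigma>_embedding]
lemmas \<tau>_simps = field_embedding_simps[OF \<tau>_embedding]

lemma all_embeddings_embedding: "field_embedding (all_embeddings \<sigma> \<tau> e)"
proof (cases e)
  case (Inl i)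
  then show ?thesis by (simp add: all_embeddings_def field_embedding_def \<sigma>_simps(1-3))
next
  case (Inr p)
  then show ?thesis
    by (cases p) (simp add: all_embeddings_def field_embedding_def \<tau>_simps(1-3))
qed

lemma inj_all_embeddings: "inj (all_embeddings \<sigma> \<tau>)"
proof (rule injI)
  fix e e' assume eq: "all_embeddings \<sigma> \<tau> e = all_embeddings \<sigma> \<tau> e'"
  have inj\<sigma>: "inj \<sigma>"
    using labelling unfolding embedding_labelling_def bij_betw_def by blast
  have inj\<tau>: "inj (\<lambda>(j, conj). if conj then cnj \<circ> \<tau> j else \<tau> j)"
    using labelling unfolding embedding_labelling_def bij_betw_def by simp
  have real: "range (all_embeddings \<sigma> \<tau> (Inl i)) \<subseteq> \<real>" for i
    by (auto simp: all_embeddings_def)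
  have nonreal: "\<not> range (all_embeddings \<sigma> \<tau> (Inr p)) \<subseteq> \<real>" for p
    using \<tau>_not_real cnj_\<tau>_not_real by (cases p) (simp add: all_embeddings_def)
  show "e = e'"
  proof (cases e)
    case (Inl i)
    with eq real nonreal obtain i' where i': "e' = Inl i'"
      by (cases e') metis+
    have "\<sigma> i = \<sigma> i'"
    proof
      fix x show "\<sigma> i x = \<sigma> i' x"
        using fun_cong[OF eq, of x] Inl i' by (simp add: all_embeddings_def)
    qed
    then show ?thesis using injD[OF inj\<sigma>] Inl i' by simp
  next
    case (Inr p)
    with eq real nonreal obtain p' where p': "e' = Inr p'"
      by (cases e') metis+
    show ?thesis
      using eq Inr p' injD[OF inj\<tau>, of p p'] by (simp add: all_embeddings_def split_def)
  qed
qed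

lemma prod_all_embeddings:
  "(\<Prod>e\<in>UNIV. all_embeddings \<sigma> \<tau> e a)
     = of_real ((\<Prod>i\<in>UNIV. \<sigma> i a) * (\<Prod>j\<in>UNIV. (cmod (\<tau> j a))\<^sup>2))"
proof -
  have pair: "(\<Prod>b\<in>UNIV. all_embeddings \<sigma> \<tau> (Inr (j, b)) a) = of_real ((cmod (\<tau> j a))\<^sup>2)" for j
    unfolding complex_norm_square by (simp add: UNIV_bool all_embeddings_def mult.commute)
  have "(\<Prod>e\<in>UNIV. all_embeddings \<sigma> \<tau> e a)
      = (\<Prod>i\<in>UNIV. all_embeddings \<sigma> \<tau> (Inl i) a) * (\<Prod>p\<in>UNIV. all_embeddings \<sigma> \<tau> (Inr p) a)"
    unfolding UNIV_Plus_UNIV[symmetric] by (subst prod.Plus) auto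
  also have "(\<Prod>p\<in>UNIV. all_embeddings \<sigma> \<tau> (Inr p) a)
      = (\<Prod>j\<in>UNIV. \<Prod>b\<in>UNIV. all_embeddings \<sigma> \<tau> (Inr (j, b)) a)"
    unfolding UNIV_Times_UNIV[symmetric] by (subst prod.cartesian_product) (simp add: split_def)
  finally show ?thesis
    unfolding pair by (simp add: all_embeddings_def)
qed

lemma norm_in_Ints:
  assumes "a \<in> ring_of_integers"
  shows "(\<Prod>i\<in>UNIV. \<sigma> i a) * (\<Prod>j\<in>UNIV. (cmod (\<tau> j a))\<^sup>2) \<in> \<int>"
proof -
  have "CARD('r + 'c \<times> bool) = CARD('r) + 2 * CARD('c)" by simp
  then have "number_field_of_degree TYPE('k) CARD('r + 'c \<times> bool)"
    using degree by (simp only:)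
  then have "(\<Prod>e\<in>UNIV. all_embeddings \<sigma> \<tau> e a) \<in> \<int>"
    using prod_embeddings_in_Ints inj_all_embeddings all_embeddings_embedding assms
    unfolding ring_of_integers_def by blast
  then obtain k where "(\<Prod>e\<in>UNIV. all_embeddings \<sigma> \<tau> e a) = of_int k" by (elim Ints_cases)
  then have "(\<Prod>i\<in>UNIV. \<sigma> i a) * (\<Prod>j\<in>UNIV. (cmod (\<tau> j a))\<^sup>2) = of_int k"
    unfolding prod_all_embeddings by (metis of_real_eq_iff of_real_of_int_eq)
  then show ?thesis by simp
qed

lemma ring_of_integers_closed:
  assumes "a \<in> ring_of_integers" "b \<in> (ring_of_integers :: 'k set)"
  shows "a + b \<in> ring_of_integers" "a * b \<in> ring_of_integers" "- a \<in> ring_of_integers"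
  using assms algebraic_int_add algebraic_int_mult by (auto simp: ring_of_integers_def)

lemma one_in_ring_of_integers: "1 \<in> (ring_of_integers :: 'k set)" "0 \<in> (ring_of_integers :: 'k set)"
  by (auto simp: ring_of_integers_def intro: int_imp_algebraic_int)

text \<open>
  Discreteness of the ring of integers: the norm of \<open>a\<close> is an integer of absolute value below \<open>1\<close>.
\<close>

lemma integer_zero_if_small:
  assumes a: "a \<in> ring_of_integers" and "\<And>i. \<bar>\<sigma> i a\<bar> < 1" and "\<And>j. cmod (\<tau> j a) < 1"
  shows "a = 0"
proof -
  let ?N = "(\<Prod>i\<in>UNIV. \<sigma> i a) * (\<Prod>j\<in>UNIV. (cmod (\<tau> j a))\<^sup>2)"
  obtain i0 :: 'r where True by simp
  have "\<bar>?N\<bar> = \<bar>\<sigma> i0 a\<bar> * (\<Prod>i\<in>UNIV - {i0}. \<bar>\<sigma> i a\<bar>) * (\<Prod>j\<in>UNIV. (cmod (\<tau> j a))\<^sup>2)"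
    by (simp add: abs_mult abs_prod prod.remove[of UNIV i0])
  also have "\<dots> \<le> \<bar>\<sigma> i0 a\<bar> * 1 * 1"
  proof (intro mult_mono prod_le_1 conjI)
    show "(cmod (\<tau> j a))\<^sup>2 \<le> 1" for j
      using assms(3)[of j] by (simp add: power_le_one)
  qed (use assms(2) in \<open>auto intro: less_imp_le prod_nonneg\<close>)
  also have "\<dots> < 1" using assms(2) by simp
  finally have "?N = 0"
    using norm_in_Ints[OF a] by (metis Ints_nonzero_abs_less1)
  then show ?thesis
    using field_embedding_eq_0_iff[OF \<sigma>_embedding] field_embedding_eq_0_iff[OF \<tau>_embedding] by auto
qed

text \<open>
  The norms of \<open>u\<close> and its inverse are integers with product \<open>1\<close>, and that of \<open>u\<close> is positive.
\<close>

lemma unit_norm_one: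
  assumes "u \<in> totally_positive_units \<sigma>"
  shows "(\<Prod>i\<in>UNIV. \<sigma> i u) * (\<Prod>j\<in>UNIV. (cmod (\<tau> j u))\<^sup>2) = 1"
proof -
  let ?N = "\<lambda>a. (\<Prod>i\<in>UNIV. \<sigma> i a) * (\<Prod>j\<in>UNIV. (cmod (\<tau> j a))\<^sup>2)"
  obtain v where v: "v \<in> ring_of_integers" "u * v = 1"
    and u: "u \<in> ring_of_integers" "\<And>i. \<sigma> i u > 0"
    using assms unfolding totally_positive_units_def by blast
  have nz: "u \<noteq> 0" "v \<noteq> 0" using v(2) by auto
  have "?N u * ?N v = ?N (u * v)"
    by (simp add: \<sigma>_simps(3) \<tau>_simps(3) norm_mult power_mult_distrib prod.distrib)
  also have "\<dots> = 1"
    unfolding v(2) by (simp add: \<sigma>_simps(1) \<tau>_simps(1))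
  finally have one: "?N u * ?N v = 1" .
  obtain m where m: "?N u = of_int m" using norm_in_Ints[OF u(1)] by (elim Ints_cases)
  obtain n where n: "?N v = of_int n" using norm_in_Ints[OF v(1)] by (elim Ints_cases)
  have "of_int (m * n) = (1::real)" using one unfolding m n by simp
  then have "m * n = 1" by linarith
  moreover have "?N u > 0"
    using u(2) nz field_embedding_eq_0_iff[OF \<tau>_embedding] by (intro mult_pos_pos prod_pos) auto
  then have "m > 0" using m by simp
  ultimately have "m = 1" using zmult_eq_1_iff by auto
  then show ?thesis using m by simp
qed

lemma lattice_point_in_real_directions: "lattice_point \<sigma> \<tau> a \<in> real_directions"
  by (simp add: lattice_point_def real_directions_def)

text \<open>
  A vector of \<open>real_directions\<close> orthogonal to all lattice points gives a linear relation between the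
  embeddings, at first on the integers and then, by clearing denominators, on the whole field.
  So it is zero.
\<close>

lemma span_ring_of_integers:
  "span (lattice_point \<sigma> \<tau> ` ring_of_integers) = real_directions"
proof
  show "span (lattice_point \<sigma> \<tau> ` ring_of_integers) \<subseteq> real_directions"
    using lattice_point_in_real_directions subspace_real_directions by (intro span_minimal) auto
  show "real_directions \<subseteq> span (lattice_point \<sigma> \<tau> ` ring_of_integers)"
  proof
    fix v :: "('r, 'c) cspace" assume v: "v \<in> real_directions"
    obtain y z where y: "y \<in> span (lattice_point \<sigma> \<tau> ` ring_of_integers)"
      and orth: "\<And>w. w \<in> span (lattice_point \<sigma> \<tau> ` ring_of_integers) \<Longrightarrow> Linear_Algebra.orthogonal z w"
      and vyz: "v = y + z"
      using orthogonal_subspace_decomp_exists by blast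
    have "y \<in> real_directions"
      using y span_minimal[OF _ subspace_real_directions] lattice_point_in_real_directions by blast
    then have z: "z \<in> real_directions"
      using v vyz subspace_diff[OF subspace_real_directions v, of y] by simp
    have zero: "(\<Sum>i\<in>UNIV. Re (fst z $ i) * \<sigma> i x) + (\<Sum>j\<in>UNIV. inner (snd z $ j) (\<tau> j x)) = 0" for x
    proof -
      obtain d :: int where d: "d > 0" "algebraic_int (of_int d * x)"
        using algebraic_int_multiple[OF degree] by blast
      then have "of_int d * x \<in> ring_of_integers" by (simp add: ring_of_integers_def)
      then have "inner z (lattice_point \<sigma> \<tau> (of_int d * x)) = 0"
        using orth[OF span_base[OF imageI]] by (simp add: Linear_Algebra.orthogonal_def)
      then have "(\<Sum>i\<in>UNIV. Re (fst z $ i) * (of_int d * \<sigma> i x))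
          + (\<Sum>j\<in>UNIV. inner (snd z $ j) (of_int d * \<tau> j x)) = 0"
        by (simp add: inner_prod_def inner_vec_def lattice_point_def \<sigma>_simps(3,9) \<tau>_simps(3,9) inner_complex_def)
      moreover have "inner (snd z $ j) (of_int d * \<tau> j x) = of_int d * inner (snd z $ j) (\<tau> j x)" for j
        by (simp add: inner_complex_def algebra_simps)
      ultimately have "of_int d * ((\<Sum>i\<in>UNIV. Re (fst z $ i) * \<sigma> i x) + (\<Sum>j\<in>UNIV. inner (snd z $ j) (\<tau> j x))) = 0"
        by (simp add: sum_distrib_left distrib_left mult.left_commute)
      then show ?thesis using d(1) by simp
    qed
    \<comment> \<open>the coefficients of the relation, a real part being half the sum of two conjugates\<close>
  define c where "c = (\<lambda>e. case e of Inl i \<Rightarrow> of_real (Re (fst z $ i))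
       | Inr (j, b) \<Rightarrow> if b then snd z $ j / 2 else cnj (snd z $ j) / 2)"
    have "(\<Sum>e\<in>UNIV. c e * all_embeddings \<sigma> \<tau> e x) = 0" for x
    proof -
      have half: "(\<Sum>b\<in>UNIV. c (Inr (j, b)) * all_embeddings \<sigma> \<tau> (Inr (j, b)) x) = of_real (inner (snd z $ j) (\<tau> j x))" for j
        by (simp add: UNIV_bool c_def all_embeddings_def inner_complex_def complex_eq_iff field_simps)
      have "(\<Sum>e\<in>UNIV. c e * all_embeddings \<sigma> \<tau> e x) = (\<Sum>i\<in>UNIV. c (Inl i) * all_embeddings \<sigma> \<tau> (Inl i) x)
          + (\<Sum>p\<in>UNIV. c (Inr p) * all_embeddings \<sigma> \<tau> (Inr p) x)"
        unfolding UNIV_Plus_UNIV[symmetric] by (subst sum.Plus) auto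
      also have "(\<Sum>p\<in>UNIV. c (Inr p) * all_embeddings \<sigma> \<tau> (Inr p) x)
          = (\<Sum>j\<in>UNIV. \<Sum>b\<in>UNIV. c (Inr (j, b)) * all_embeddings \<sigma> \<tau> (Inr (j, b)) x)"
        unfolding UNIV_Times_UNIV[symmetric] by (subst sum.cartesian_product) (simp add: split_def)
      finally have "(\<Sum>e\<in>UNIV. c e * all_embeddings \<sigma> \<tau> e x)
          = of_real ((\<Sum>i\<in>UNIV. Re (fst z $ i) * \<sigma> i x) + (\<Sum>j\<in>UNIV. inner (snd z $ j) (\<tau> j x)))"
        unfolding half by (simp add: c_def all_embeddings_def)
      then show ?thesis unfolding zero by simp
    qed
    then have c: "c e = 0" for e
      using field_embeddings_independent[OF inj_all_embeddings all_embeddings_embedding] by blast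
    have "fst z $ i = 0" for i
      using c[of "Inl i"] z by (simp add: c_def real_directions_def complex_eq_iff)
    moreover have "snd z $ j = 0" for j
      using c[of "Inr (j, True)"] by (simp add: c_def)
    ultimately have "z = 0" by (simp add: prod_eq_iff Finite_Cartesian_Product.vec_eq_iff)
    then show "v \<in> span (lattice_point \<sigma> \<tau> ` ring_of_integers)" using vyz y by simp
  qed
qed

end

section \<open>Smooth functions and directional derivatives\<close>

text \<open>
  The directional derivative as a function of the point, so that derivatives can be iterated.
\<close>

definition dir_deriv :: "'v::euclidean_space \<Rightarrow> ('v \<Rightarrow> real) \<Rightarrow> 'v \<Rightarrow> real" where
  "dir_deriv v f x = frechet_derivative f (at x) v"

lemma dir_deriv_eqI:
  assumes "(f has_derivative f') (at x)"
  shows "dir_deriv v f x = f' v"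
  unfolding dir_deriv_def frechet_derivative_at[OF assms, symmetric] ..

lemma has_derivative_dir_deriv:
  "f differentiable (at x) \<Longrightarrow> (f has_derivative (\<lambda>v. dir_deriv v f x)) (at x)"
  unfolding dir_deriv_def by (simp add: frechet_derivative_works)

lemma has_derivative_shift:
  assumes "(f has_derivative f') (at (x + v))"
  shows "((\<lambda>y. f (y + v)) has_derivative f') (at x within A)"
proof -
  have "((\<lambda>y. y + v) has_derivative (\<lambda>h. h)) (at x within A)"
    by (auto intro!: derivative_eq_intros)
  from has_derivative_compose[OF this assms] show ?thesis .
qed

lemma has_derivative_along_line:
  assumes "(f has_derivative f') (at (x + t *\<^sub>R b))"
  shows "((\<lambda>r. f (x + r *\<^sub>R b)) has_derivative (\<lambda>h. f' (h *\<^sub>R b))) (at t within A)"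
proof -
  have "((\<lambda>r. x + r *\<^sub>R b) has_derivative (\<lambda>h. h *\<^sub>R b)) (at t within A)"
    by (auto intro!: derivative_eq_intros)
  from has_derivative_compose[OF this assms] show ?thesis .
qed

lemma linear_dir_deriv: "f differentiable (at x) \<Longrightarrow> linear (\<lambda>v. dir_deriv v f x)"
  using has_derivative_dir_deriv has_derivative_linear by blast

lemma dir_deriv_cong:
  assumes "open S" "x \<in> S" "\<And>y. y \<in> S \<Longrightarrow> f y = g y"
  shows "dir_deriv v f x = dir_deriv v g x"
proof -
  have "(f has_derivative D) (at x) \<longleftrightarrow> (g has_derivative D) (at x)" for D :: "'a \<Rightarrow> real"
    
  proof
    assume "(f has_derivative D) (at x)"
    then show "(g has_derivative D) (at x)"
      by (rule has_derivative_transform_within_open[OF _ assms])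
  next
    assume "(g has_derivative D) (at x)"
    then show "(f has_derivative D) (at x)"
      by (rule has_derivative_transform_within_open[OF _ assms(1,2)]) (simp add: assms(3))
  qed
  then show ?thesis unfolding dir_deriv_def frechet_derivative_def by simp
qed

lemma times_differentiable_on_Suc:
  "times_differentiable_on (Suc n) f S \<longleftrightarrow>
     (\<forall>x\<in>S. f differentiable (at x)) \<and> (\<forall>v. times_differentiable_on n (dir_deriv v f) S)"
  unfolding dir_deriv_def[abs_def] by simp

declare times_differentiable_on.simps(2) [simp del]

lemma times_differentiable_on_cong:
  assumes "open S" "\<And>x. x \<in> S \<Longrightarrow> f x = g x" "times_differentiable_on n f S"
  shows "times_differentiable_on n g S"
  using assms(2,3)
proof (induction n arbitrary: f g)
  case 0
  then show ?case using continuous_on_cong[of S S f g] by simp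
next
  case (Suc n)
  have "g differentiable (at x)" if "x \<in> S" for x
  proof -
    have "f differentiable (at x)" using Suc.prems(2) that by (simp add: times_differentiable_on_Suc)
    then obtain D where "(f has_derivative D) (at x)" by (auto simp: differentiable_def)
    then have "(g has_derivative D) (at x)"
      by (rule has_derivative_transform_within_open[OF _ assms(1) that Suc.prems(1)])
    then show ?thesis by (auto simp: differentiable_def)
  qed
  moreover have "times_differentiable_on n (dir_deriv v g) S" for v
  proof (rule Suc.IH)
    show "times_differentiable_on n (dir_deriv v f) S"
      using Suc.prems(2) by (simp add: times_differentiable_on_Suc)
    show "dir_deriv v f x = dir_deriv v g x" if "x \<in> S" for x
      by (rule dir_deriv_cong[OF assms(1) that Suc.prems(1)])
  qed
  ultimately show ?case by (simp add: times_differentiable_on_Suc)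
qed

lemma times_differentiable_on_imp_continuous_on:
  "times_differentiable_on n f S \<Longrightarrow> continuous_on S f"
proof (cases n)
  case (Suc m)
  assume "times_differentiable_on n f S"
  then show ?thesis
    using Suc by (auto simp: times_differentiable_on_Suc intro!: continuous_at_imp_continuous_on differentiable_imp_continuous_within)
qed simp

lemma times_differentiable_on_local:
  assumes "\<And>x. x \<in> S \<Longrightarrow> \<exists>V. open V \<and> x \<in> V \<and> times_differentiable_on n f V"
  shows "times_differentiable_on n f S"
  using assms
proof (induction n arbitrary: f)
  case 0
  have "isCont f x" if x: "x \<in> S" for x
  proof -
    obtain V where "open V" "x \<in> V" "continuous_on V f" using 0[OF x] by auto
    then show ?thesis by (simp add: continuous_on_eq_continuous_at)
  qed
  then show ?case by (simp add: continuous_at_imp_continuous_on)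
next
  case (Suc n)
  have "f differentiable (at x)" if "x \<in> S" for x
    using Suc.prems[OF that] by (auto simp: times_differentiable_on_Suc)
  moreover have "times_differentiable_on n (dir_deriv v f) S" for v
  proof (rule Suc.IH)
    fix x assume "x \<in> S"
    from Suc.prems[OF this]
    show "\<exists>V. open V \<and> x \<in> V \<and> times_differentiable_on n (dir_deriv v f) V"
      by (auto simp: times_differentiable_on_Suc)
  qed
  ultimately show ?case by (simp add: times_differentiable_on_Suc)
qed

lemma smooth_fun_on_local:
  assumes "\<And>x. x \<in> S \<Longrightarrow> \<exists>V. open V \<and> x \<in> V \<and> smooth_fun_on f V"
  shows "smooth_fun_on f S"
  unfolding smooth_fun_on_def
proof
  fix n show "times_differentiable_on n f S"
  proof (rule times_differentiable_on_local)
    fix x assume "x \<in> S"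
    from assms[OF this] show "\<exists>V. open V \<and> x \<in> V \<and> times_differentiable_on n f V"
      by (auto simp: smooth_fun_on_def)
  qed
qed

lemma smooth_fun_on_cong:
  assumes "open S" "\<And>x. x \<in> S \<Longrightarrow> f x = g x" "smooth_fun_on f S"
  shows "smooth_fun_on g S"
  using assms(3) times_differentiable_on_cong[OF assms(1,2)] by (simp add: smooth_fun_on_def)

lemma smooth_fun_on_Suc: "smooth_fun_on f S \<Longrightarrow> times_differentiable_on (Suc n) f S"
  by (simp add: smooth_fun_on_def)

lemma smooth_fun_on_dir_deriv: "smooth_fun_on f S \<Longrightarrow> smooth_fun_on (dir_deriv v f) S"
  using smooth_fun_on_Suc[of f S] unfolding times_differentiable_on_Suc smooth_fun_on_def[of "dir_deriv v f"] by simp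

lemma smooth_fun_on_differentiable: "smooth_fun_on f S \<Longrightarrow> x \<in> S \<Longrightarrow> f differentiable (at x)"
  using smooth_fun_on_Suc[of f S] unfolding times_differentiable_on_Suc by simp

lemma smooth_fun_on_continuous: "smooth_fun_on f S \<Longrightarrow> continuous_on S f"
  using times_differentiable_on_imp_continuous_on unfolding smooth_fun_on_def by blast

lemma smooth_fun_on_subset:
  fixes f :: "'a::euclidean_space \<Rightarrow> real"
  assumes "smooth_fun_on f S" "T \<subseteq> S"
  shows "smooth_fun_on f T"
proof -
  have "times_differentiable_on n f S \<Longrightarrow> times_differentiable_on n f T" for n and f :: "'a \<Rightarrow> real"
    by (induction n arbitrary: f) (use assms(2) in \<open>auto simp: times_differentiable_on_Suc intro: continuous_on_subset\<close>)
  then show ?thesis using assms(1) unfolding smooth_fun_on_def by simp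
qed

lemma times_differentiable_on_lincomb:
  assumes S: "open S"
  shows "times_differentiable_on n f S \<Longrightarrow> times_differentiable_on n g S
    \<Longrightarrow> times_differentiable_on n (\<lambda>x. a * f x + b * g x) S"
proof (induction n arbitrary: f g)
  case 0
  then show ?case by (auto intro!: continuous_intros)
next
  case (Suc n)
  have D: "((\<lambda>x. a * f x + b * g x) has_derivative (\<lambda>v. a * dir_deriv v f x + b * dir_deriv v g x)) (at x)"
    if "x \<in> S" for x
    using Suc.prems that unfolding times_differentiable_on_Suc
    by (intro has_derivative_add has_derivative_mult_right has_derivative_dir_deriv) auto
  have "times_differentiable_on n (dir_deriv v (\<lambda>x. a * f x + b * g x)) S" for v
  proof (rule times_differentiable_on_cong[OF S])
    show "a * dir_deriv v f x + b * dir_deriv v g x = dir_deriv v (\<lambda>x. a * f x + b * g x) x" if "x \<in> S" for x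
      by (rule dir_deriv_eqI[OF D[OF that], symmetric])
    show "times_differentiable_on n (\<lambda>x. a * dir_deriv v f x + b * dir_deriv v g x) S"
      using Suc.prems unfolding times_differentiable_on_Suc by (intro Suc.IH) auto
  qed
  then show ?case
    unfolding times_differentiable_on_Suc using differentiableI[OF D] by blast
qed

lemma smooth_fun_on_lincomb:
  assumes "open S" "smooth_fun_on f S" "smooth_fun_on g S"
  shows "smooth_fun_on (\<lambda>x. a * f x + b * g x) S"
  using assms times_differentiable_on_lincomb unfolding smooth_fun_on_def by blast

lemma dir_deriv_const [simp]: "dir_deriv v (\<lambda>x. c) x = 0"
  by (rule dir_deriv_eqI[OF has_derivative_const])

lemma smooth_fun_on_const: "smooth_fun_on (\<lambda>x. c) S"
  unfolding smooth_fun_on_def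
proof
  show "times_differentiable_on n (\<lambda>x. c) S" for n
  proof (induction n arbitrary: c)
    case (Suc n)
    have "dir_deriv v (\<lambda>x::'a. c) = (\<lambda>x. 0)" for v by (rule ext) simp
    then show ?case using Suc[of 0] by (simp add: times_differentiable_on_Suc)
  qed simp
qed

lemma smooth_fun_on_sum:
  assumes "open S" "\<And>i. i \<in> I \<Longrightarrow> smooth_fun_on (f i) S"
  shows "smooth_fun_on (\<lambda>x. \<Sum>i\<in>I. f i x) S"
  using assms(2)
proof (induction I rule: infinite_finite_induct)
  case (insert i I)
  then show ?case
    using smooth_fun_on_lincomb[OF assms(1), of "f i" "\<lambda>x. \<Sum>i\<in>I. f i x" 1 1] by simp
qed (simp_all add: smooth_fun_on_const)

text \<open>
  The first derivatives are constant on the convex set \<open>S\<close>, and so is the difference of \<open>f\<close> and its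
  linear part at \<open>p\<close>.
\<close>

lemma affine_if_second_derivatives_vanish:
  fixes f :: "'v::euclidean_space \<Rightarrow> real"
  assumes "open S" "convex S" and smooth: "smooth_fun_on f S"
    and zero: "\<And>v w x. x \<in> S \<Longrightarrow> dir_deriv v (dir_deriv w f) x = 0"
    and "p \<in> S" "x \<in> S"
  shows "f x = f p + dir_deriv (x - p) f p"
proof -
  have const: "dir_deriv w f y = dir_deriv w f p" if "y \<in> S" for w y
  proof (rule has_derivative_zero_unique[OF \<open>convex S\<close> _ that \<open>p \<in> S\<close>])
    fix z assume z: "z \<in> S"
    have "(dir_deriv w f has_derivative (\<lambda>v. dir_deriv v (dir_deriv w f) z)) (at z)"
      by (intro has_derivative_dir_deriv smooth_fun_on_differentiable[OF smooth_fun_on_dir_deriv[OF smooth] z])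
    then have "(dir_deriv w f has_derivative (\<lambda>v. 0)) (at z)" using zero[OF z] by simp
    then show "(dir_deriv w f has_derivative (\<lambda>v. 0)) (at z within S)"
      by (rule has_derivative_at_withinI)
  qed
  have lin: "bounded_linear (\<lambda>v. dir_deriv v f p)"
    using linear_dir_deriv[OF smooth_fun_on_differentiable[OF smooth \<open>p \<in> S\<close>]]
    by (rule linear_conv_bounded_linear[THEN iffD1])
  have "f x - dir_deriv (x - p) f p = f p - dir_deriv (p - p) f p"
  proof (rule has_derivative_zero_unique[OF \<open>convex S\<close> _ \<open>x \<in> S\<close> \<open>p \<in> S\<close>])
    fix y assume y: "y \<in> S"
    have "((\<lambda>x. f x - dir_deriv (x - p) f p) has_derivative (\<lambda>v. dir_deriv v f y - dir_deriv v f p)) (at y)"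
    proof (rule has_derivative_diff)
      show "(f has_derivative (\<lambda>v. dir_deriv v f y)) (at y)"
        by (rule has_derivative_dir_deriv[OF smooth_fun_on_differentiable[OF smooth y]])
      have "((\<lambda>x. x - p) has_derivative (\<lambda>v. v)) (at y)"
        by (auto intro!: derivative_eq_intros)
      then show "((\<lambda>x. dir_deriv (x - p) f p) has_derivative (\<lambda>v. dir_deriv v f p)) (at y)"
        by (rule bounded_linear.has_derivative[OF lin])
    qed
    then have "((\<lambda>x. f x - dir_deriv (x - p) f p) has_derivative (\<lambda>v. 0)) (at y)"
      using const[OF y] by simp
    then show "((\<lambda>x. f x - dir_deriv (x - p) f p) has_derivative (\<lambda>v. 0)) (at y within S)"
      by (rule has_derivative_at_withinI)
  qed
  then show ?thesis using linear_0[OF bounded_linear.linear[OF lin]] by simp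
qed

section \<open>Averaging along periods\<close>

definition segment_avg :: "'v::euclidean_space \<Rightarrow> ('v \<Rightarrow> real) \<Rightarrow> 'v \<Rightarrow> real" where
  "segment_avg b f x = integral {0..1} (\<lambda>t. f (x + t *\<^sub>R b))"

text \<open>
  For a basis \<open>bs\<close> of a lattice this is the average over a translated period parallelepiped, written
  as an iterated integral over segments.
\<close>

definition mean_along :: "'v::euclidean_space list \<Rightarrow> ('v \<Rightarrow> real) \<Rightarrow> 'v \<Rightarrow> real" where
  "mean_along bs f = foldr segment_avg bs f"

lemma mean_along_simps [simp]:
  "mean_along [] f = f" "mean_along (b # bs) f = segment_avg b (mean_along bs f)"
  by (simp_all add: mean_along_def)

lemma mean_along_linear_image:
  assumes "linear R"
  shows "mean_along (map R bs) f (R x) = mean_along bs (f \<circ> R) x"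
proof (induction bs arbitrary: x)
  case (Cons b bs)
  have "R x + t *\<^sub>R R b = R (x + t *\<^sub>R b)" for t
    using assms by (simp add: linear_add linear_scale)
  then show ?case
    using Cons by (simp add: segment_avg_def)
qed simp

text \<open>
  Functions on \<open>S\<close> are averaged along vectors of \<open>W\<close>. Convexity of \<open>S\<close> serves the differentiation under
  the integral sign.
\<close>

locale translation_domain =
  fixes S W :: "'v::euclidean_space set"
  assumes open_S: "open S" and convex_S: "convex S" and subspace_W: "subspace W"
    and shift: "x \<in> S \<Longrightarrow> w \<in> W \<Longrightarrow> x + w \<in> S"
begin

lemma shift_scaleR: "x \<in> S \<Longrightarrow> w \<in> W \<Longrightarrow> x + t *\<^sub>R w \<in> S"
  using shift subspace_scale[OF subspace_W] by blast

definition periodic :: "'v \<Rightarrow> ('v \<Rightarrow> real) \<Rightarrow> bool" where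
  "periodic b f \<longleftrightarrow> (\<forall>x\<in>S. f (x + b) = f x)"

definition invariant :: "'v \<Rightarrow> ('v \<Rightarrow> real) \<Rightarrow> bool" where
  "invariant b f \<longleftrightarrow> (\<forall>x\<in>S. \<forall>t. f (x + t *\<^sub>R b) = f x)"

lemma continuous_on_shifted:
  assumes "continuous_on S f" "b \<in> W"
  shows "continuous_on (S \<times> cbox 0 1) (\<lambda>(x, t::real). f (x + t *\<^sub>R b))"
  unfolding split_def
  by (rule continuous_on_compose2[OF assms(1)])
     (auto intro!: continuous_intros shift_scaleR assms(2))

lemma continuous_on_segment:
  assumes "continuous_on S f" "b \<in> W" "x \<in> S"
  shows "continuous_on A (\<lambda>t::real. f (x + t *\<^sub>R b))"
  by (rule continuous_on_compose2[OF assms(1)])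
     (auto intro!: continuous_intros shift_scaleR assms(2,3))

lemma segment_avg_cong:
  "(\<And>y. y \<in> S \<Longrightarrow> f y = g y) \<Longrightarrow> b \<in> W \<Longrightarrow> x \<in> S \<Longrightarrow> segment_avg b f x = segment_avg b g x"
  unfolding segment_avg_def by (intro integral_cong) (simp add: shift_scaleR)

lemma segment_avg_continuous:
  assumes "continuous_on S f" "b \<in> W"
  shows "continuous_on S (segment_avg b f)"
  using integral_continuous_on_param[OF continuous_on_shifted[OF assms]]
  by (simp add: segment_avg_def[abs_def])

lemma segment_avg_has_derivative:
  assumes f: "smooth_fun_on f S" and b: "b \<in> W" and x: "x \<in> S"
  shows "(segment_avg b f has_derivative (\<lambda>v. segment_avg b (dir_deriv v f) x)) (at x)"
proof -
  define fx where "fx = (\<lambda>x t. Blinfun (\<lambda>v. dir_deriv v f (x + t *\<^sub>R b)))"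
  have lin: "bounded_linear (\<lambda>v. dir_deriv v f y)" if "y \<in> S" for y
    using linear_dir_deriv[OF smooth_fun_on_differentiable[OF f that]]
    by (rule linear_conv_bounded_linear[THEN iffD1])
  have fx: "blinfun_apply (fx y t) v = dir_deriv v f (y + t *\<^sub>R b)" if "y \<in> S" for y t v
    unfolding fx_def by (simp add: bounded_linear_Blinfun_apply[OF lin[OF shift_scaleR[OF that b]]])
  have cont: "continuous_on (S \<times> cbox 0 1) (\<lambda>(x, t). fx x t)"
  proof (rule continuous_on_blinfun_componentwise)
    fix i :: 'v assume "i \<in> Basis"
    have "continuous_on (S \<times> cbox 0 1) (\<lambda>(x, t::real). dir_deriv i f (x + t *\<^sub>R b))"
      by (intro continuous_on_shifted smooth_fun_on_continuous smooth_fun_on_dir_deriv f b)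
    then show "continuous_on (S \<times> cbox 0 1) (\<lambda>p. blinfun_apply (case p of (x, t) \<Rightarrow> fx x t) i)"
      by (rule continuous_on_eq) (auto simp: fx)
  qed
  have "((\<lambda>x. integral (cbox 0 1) (\<lambda>t. f (x + t *\<^sub>R b))) has_derivative
      blinfun_apply (integral (cbox 0 1) (fx x))) (at x within S)"
  proof (rule leibniz_rule[OF _ _ cont x convex_S])
    fix y and t :: real assume y: "y \<in> S"
    have "(f has_derivative (\<lambda>v. dir_deriv v f (y + t *\<^sub>R b))) (at (y + t *\<^sub>R b))"
      by (intro has_derivative_dir_deriv smooth_fun_on_differentiable[OF f] shift_scaleR y b)
    then have "((\<lambda>y. f (y + t *\<^sub>R b)) has_derivative (\<lambda>v. dir_deriv v f (y + t *\<^sub>R b))) (at y within S)"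
      by (rule has_derivative_shift)
    moreover have "blinfun_apply (fx y t) = (\<lambda>v. dir_deriv v f (y + t *\<^sub>R b))"
      using fx[OF y] by auto
    ultimately show "((\<lambda>y. f (y + t *\<^sub>R b)) has_derivative blinfun_apply (fx y t)) (at y within S)"
      by simp
  next
    fix y assume "y \<in> S"
    then show "(\<lambda>t. f (y + t *\<^sub>R b)) integrable_on cbox 0 1"
      by (intro integrable_continuous continuous_on_segment smooth_fun_on_continuous f b)
  qed
  moreover have "blinfun_apply (integral (cbox 0 1) (fx x)) = (\<lambda>v. segment_avg b (dir_deriv v f) x)"
  proof
    fix v
    have "continuous_on (cbox 0 1) (fx x)"
      using continuous_on_compose2[OF cont continuous_on_Pair[OF continuous_on_const continuous_on_id]] x
      by auto
    then have "integral (cbox 0 1) ((\<lambda>A. blinfun_apply A v) \<circ> fx x) = blinfun_apply (integral (cbox 0 1) (fx x)) v"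
      by (intro integral_linear integrable_continuous blinfun.bounded_linear_left)
    then show "blinfun_apply (integral (cbox 0 1) (fx x)) v = segment_avg b (dir_deriv v f) x"
      by (simp add: segment_avg_def o_def fx[OF x])
  qed
  ultimately show ?thesis
    unfolding at_within_open[OF x open_S] by (simp add: segment_avg_def[abs_def])
qed

lemma dir_deriv_segment_avg:
  assumes "smooth_fun_on f S" "b \<in> W" "x \<in> S"
  shows "dir_deriv v (segment_avg b f) x = segment_avg b (dir_deriv v f) x"
  using segment_avg_has_derivative[OF assms] by (rule dir_deriv_eqI)

lemma smooth_segment_avg:
  assumes "smooth_fun_on f S" "b \<in> W"
  shows "smooth_fun_on (segment_avg b f) S"
  unfolding smooth_fun_on_def
proof
  fix n show "times_differentiable_on n (segment_avg b f) S"
    using assms(1)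
  proof (induction n arbitrary: f)
    case 0
    then show ?case using segment_avg_continuous[OF smooth_fun_on_continuous[OF 0] assms(2)] by simp
  next
    case (Suc n)
    have "times_differentiable_on n (dir_deriv v (segment_avg b f)) S" for v
    proof (rule times_differentiable_on_cong[OF open_S])
      show "segment_avg b (dir_deriv v f) x = dir_deriv v (segment_avg b f) x" if "x \<in> S" for x
        by (rule dir_deriv_segment_avg[OF Suc.prems assms(2) that, symmetric])
      show "times_differentiable_on n (segment_avg b (dir_deriv v f)) S"
        by (rule Suc.IH[OF smooth_fun_on_dir_deriv[OF Suc.prems]])
    qed
    moreover have "segment_avg b f differentiable (at x)" if "x \<in> S" for x
      by (rule differentiableI[OF segment_avg_has_derivative[OF Suc.prems assms(2) that]])
    ultimately show ?case by (simp add: times_differentiable_on_Suc)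
  qed
qed

text \<open>
  The derivative of the average in the direction \<open>b\<close> is the average of the derivative, that is,
  \<open>f (y + b) - f y = 0\<close> by the fundamental theorem of calculus.
\<close>

lemma invariant_segment_avg_self:
  assumes f: "smooth_fun_on f S" and b: "b \<in> W" and per: "periodic b f"
  shows "invariant b (segment_avg b f)"
  unfolding invariant_def
proof (intro ballI allI)
  fix x t assume x: "x \<in> S"
  have "((\<lambda>s. segment_avg b f (x + s *\<^sub>R b)) has_real_derivative 0) (at s)" for s
  proof -
    define y where "y = x + s *\<^sub>R b"
    have y: "y \<in> S" using shift_scaleR[OF x b] by (simp add: y_def)
    have "((\<lambda>r. dir_deriv b f (y + r *\<^sub>R b)) has_integral (f (y + 1 *\<^sub>R b) - f (y + 0 *\<^sub>R b))) {0..1}"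
    proof (rule fundamental_theorem_of_calculus)
      fix r :: real
      have D: "(f has_derivative (\<lambda>v. dir_deriv v f (y + r *\<^sub>R b))) (at (y + r *\<^sub>R b))"
        by (intro has_derivative_dir_deriv smooth_fun_on_differentiable[OF f] shift_scaleR y b)
      have "((\<lambda>r. f (y + r *\<^sub>R b)) has_derivative (\<lambda>h. dir_deriv (h *\<^sub>R b) f (y + r *\<^sub>R b))) (at r within {0..1})"
        by (rule has_derivative_along_line[OF D])
      moreover have "dir_deriv (h *\<^sub>R b) f (y + r *\<^sub>R b) = h *\<^sub>R dir_deriv b f (y + r *\<^sub>R b)" for h
        by (rule linear_scale[OF has_derivative_linear[OF D]])
      ultimately show "((\<lambda>r. f (y + r *\<^sub>R b)) has_vector_derivative dir_deriv b f (y + r *\<^sub>R b)) (at r within {0..1})"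
        by (simp add: has_vector_derivative_def)
    qed simp
    moreover have "f (y + b) = f y" using per y by (simp add: periodic_def)
    ultimately have zero: "segment_avg b (dir_deriv b f) y = 0"
      unfolding segment_avg_def by (simp add: integral_unique)
    have "((\<lambda>s. segment_avg b f (x + s *\<^sub>R b)) has_derivative (\<lambda>h. segment_avg b (dir_deriv (h *\<^sub>R b) f) y)) (at s)"
      using segment_avg_has_derivative[OF f b y]
      unfolding y_def by (rule has_derivative_along_line)
    moreover have "segment_avg b (dir_deriv (h *\<^sub>R b) f) y = 0" for h
      using linear_scale[OF has_derivative_linear[OF segment_avg_has_derivative[OF f b y]], of h b] zero by simp
    ultimately show ?thesis by (simp add: has_field_derivative_def mult_zero_left[abs_def])
  qed
  then show "segment_avg b f (x + t *\<^sub>R b) = segment_avg b f x"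
    using DERIV_isconst_all[of "\<lambda>s. segment_avg b f (x + s *\<^sub>R b)" t 0] by simp
qed

lemma periodic_segment_avg:
  assumes "periodic c f" "b \<in> W" "c \<in> W"
  shows "periodic c (segment_avg b f)"
  unfolding periodic_def segment_avg_def
proof (intro ballI integral_cong)
  fix x and s :: real assume "x \<in> S"
  have "f (x + c + s *\<^sub>R b) = f ((x + s *\<^sub>R b) + c)" by (simp add: algebra_simps)
  also have "\<dots> = f (x + s *\<^sub>R b)"
    using assms(1) shift_scaleR[OF \<open>x \<in> S\<close> assms(2)] by (auto simp: periodic_def)
  finally show "f (x + c + s *\<^sub>R b) = f (x + s *\<^sub>R b)" .
qed

lemma invariant_segment_avg:
  assumes "invariant c f" "b \<in> W" "c \<in> W"
  shows "invariant c (segment_avg b f)"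
  unfolding invariant_def segment_avg_def
proof (intro ballI allI integral_cong)
  fix x t and s :: real assume "x \<in> S"
  have "f (x + t *\<^sub>R c + s *\<^sub>R b) = f ((x + s *\<^sub>R b) + t *\<^sub>R c)" by (simp add: algebra_simps)
  also have "\<dots> = f (x + s *\<^sub>R b)"
    using assms(1) shift_scaleR[OF \<open>x \<in> S\<close> assms(2)] by (auto simp: invariant_def)
  finally show "f (x + t *\<^sub>R c + s *\<^sub>R b) = f (x + s *\<^sub>R b)" .
qed

lemma segment_avg_commute:
  assumes f: "continuous_on S f" and "b \<in> W" "c \<in> W" "x \<in> S"
  shows "segment_avg b (segment_avg c f) x = segment_avg c (segment_avg b f) x"
proof -
  have "continuous_on (cbox (0, 0) (1, 1)) (\<lambda>(s::real, t::real). f (x + s *\<^sub>R b + t *\<^sub>R c))"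
    unfolding split_def
  proof (rule continuous_on_compose2[OF f])
    show "continuous_on (cbox (0, 0) (1, 1)) (\<lambda>p::real \<times> real. x + fst p *\<^sub>R b + snd p *\<^sub>R c)"
      by (intro continuous_on_add continuous_on_scaleR continuous_on_const continuous_on_fst
          continuous_on_snd continuous_on_id)
    show "(\<lambda>p::real \<times> real. x + fst p *\<^sub>R b + snd p *\<^sub>R c) ` cbox (0, 0) (1, 1) \<subseteq> S"
      by (intro image_subsetI shift_scaleR assms)
  qed
  from integral_swap_continuous[OF this]
  have swap: "integral {0..1} (\<lambda>s. integral {0..1} (\<lambda>t. f (x + s *\<^sub>R b + t *\<^sub>R c)))
      = integral {0..1} (\<lambda>t. integral {0..1} (\<lambda>s. f (x + s *\<^sub>R b + t *\<^sub>R c)))"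
    unfolding cbox_interval .
  have comm: "x + s *\<^sub>R b + t *\<^sub>R c = x + t *\<^sub>R c + s *\<^sub>R b" for s t :: real
    by (simp add: ac_simps)
  show ?thesis
    unfolding segment_avg_def
    by (rule trans[OF swap], rule integral_cong, rule integral_cong, rule arg_cong[OF comm])
qed

lemma smooth_mean_along:
  assumes "smooth_fun_on f S"
  shows "set bs \<subseteq> W \<Longrightarrow> smooth_fun_on (mean_along bs f) S"
  by (induction bs) (simp_all add: assms smooth_segment_avg)

lemma dir_deriv_mean_along:
  assumes "smooth_fun_on f S" "set bs \<subseteq> W" "x \<in> S"
  shows "dir_deriv v (mean_along bs f) x = mean_along bs (dir_deriv v f) x"
  using assms(2,3)
proof (induction bs arbitrary: x)
  case (Cons b bs)
  have "dir_deriv v (mean_along (b # bs) f) x = segment_avg b (dir_deriv v (mean_along bs f)) x"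
    using Cons.prems dir_deriv_segment_avg[OF smooth_mean_along[OF assms(1)]] by simp
  also have "\<dots> = segment_avg b (mean_along bs (dir_deriv v f)) x"
    using Cons by (intro segment_avg_cong) auto
  finally show ?case by simp
qed simp

lemma periodic_mean_along:
  assumes "periodic c f" "c \<in> W"
  shows "set bs \<subseteq> W \<Longrightarrow> periodic c (mean_along bs f)"
  by (induction bs) (simp_all add: assms periodic_segment_avg)

lemma invariant_mean_along:
  assumes "smooth_fun_on f S" "set bs \<subseteq> W" "\<forall>b\<in>set bs. periodic b f"
  shows "\<forall>b\<in>set bs. invariant b (mean_along bs f)"
  using assms(2,3)
proof (induction bs)
  case (Cons b bs)
  then have W: "b \<in> W" "set bs \<subseteq> W" and per: "periodic b f"
    and IH: "\<forall>c\<in>set bs. invariant c (mean_along bs f)" by auto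
  have "invariant b (segment_avg b (mean_along bs f))"
    by (intro invariant_segment_avg_self smooth_mean_along periodic_mean_along assms(1) W per)
  moreover have "invariant c (segment_avg b (mean_along bs f))" if "c \<in> set bs" for c
    using IH W that by (intro invariant_segment_avg) auto
  ultimately show ?case by simp
qed simp

lemma invariant_on_span:
  assumes "B \<subseteq> W" "\<forall>b\<in>B. invariant b f" "w \<in> span B"
  shows "invariant w f"
proof -
  have "subspace {w \<in> W. invariant w f}"
    unfolding subspace_def
  proof (intro conjI ballI allI)
    show "0 \<in> {w \<in> W. invariant w f}"
      using subspace_0[OF subspace_W] by (simp add: invariant_def)
    fix v assume v: "v \<in> {w \<in> W. invariant w f}"
    show "c *\<^sub>R v \<in> {w \<in> W. invariant w f}" for c
      using v subspace_scale[OF subspace_W] by (simp add: invariant_def)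
    fix w assume w: "w \<in> {w \<in> W. invariant w f}"
    have "f (x + t *\<^sub>R (v + w)) = f x" if "x \<in> S" for x t
    proof -
      have "f (x + t *\<^sub>R (v + w)) = f ((x + t *\<^sub>R v) + t *\<^sub>R w)" by (simp add: algebra_simps)
      also have "\<dots> = f (x + t *\<^sub>R v)"
        using w shift_scaleR[OF that] v unfolding invariant_def by blast
      finally show ?thesis using v that by (simp add: invariant_def)
    qed
    then show "v + w \<in> {w \<in> W. invariant w f}"
      using v w subspace_add[OF subspace_W] by (simp add: invariant_def)
  qed
  then have "span B \<subseteq> {w \<in> W. invariant w f}"
    using assms(1,2) by (intro span_minimal) auto
  then show ?thesis using assms(3) by blast
qed

lemma mean_along_of_invariant:
  assumes "set bs \<subseteq> W" "\<forall>b\<in>set bs. invariant b f" "x \<in> S"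
  shows "mean_along bs f x = f x"
  using assms
proof (induction bs arbitrary: x)
  case (Cons b bs)
  have "segment_avg b (mean_along bs f) x = segment_avg b f x"
    using Cons by (intro segment_avg_cong) auto
  also have "\<dots> = f x"
    using Cons.prems by (simp add: segment_avg_def invariant_def)
  finally show ?case by simp
qed simp

lemma mean_along_segment_avg:
  assumes "smooth_fun_on f S" "b \<in> W" "set bs \<subseteq> W" "x \<in> S"
  shows "mean_along bs (segment_avg b f) x = segment_avg b (mean_along bs f) x"
  using assms(3,4)
proof (induction bs arbitrary: x)
  case (Cons c bs)
  have "mean_along (c # bs) (segment_avg b f) x = segment_avg c (segment_avg b (mean_along bs f)) x"
    using Cons by (auto intro!: segment_avg_cong)
  also have "\<dots> = segment_avg b (segment_avg c (mean_along bs f)) x"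
    using Cons.prems assms
    by (intro segment_avg_commute smooth_fun_on_continuous smooth_mean_along) auto
  finally show ?case by simp
qed simp

lemma mean_along_commute:
  assumes "smooth_fun_on f S" "set bs \<subseteq> W" "set cs \<subseteq> W" "x \<in> S"
  shows "mean_along bs (mean_along cs f) x = mean_along cs (mean_along bs f) x"
  using assms(2,4)
proof (induction bs arbitrary: x)
  case (Cons b bs)
  have "mean_along (b # bs) (mean_along cs f) x = segment_avg b (mean_along cs (mean_along bs f)) x"
    using Cons by (auto intro!: segment_avg_cong)
  also have "\<dots> = mean_along cs (segment_avg b (mean_along bs f)) x"
    using Cons.prems assms(1,3) by (intro mean_along_segment_avg[symmetric] smooth_mean_along) auto
  finally show ?case by simp
qed simp

text \<open>
  Both averages are invariant under \<open>W\<close>, so averaging either of them once more along the other basis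
  changes nothing; but the two iterated averages agree, as integrals commute.
\<close>

lemma mean_along_unique:
  assumes f: "smooth_fun_on f S" and "span (set bs) = W" "span (set cs) = W"
    and bs: "\<forall>b\<in>set bs. periodic b f" and cs: "\<forall>c\<in>set cs. periodic c f" and x: "x \<in> S"
  shows "mean_along bs f x = mean_along cs f x"
proof -
  have sub: "set bs \<subseteq> W" "set cs \<subseteq> W" using assms(2,3) span_superset by blast+
  have inv: "invariant w (mean_along bs f)" "invariant w (mean_along cs f)" if "w \<in> W" for w
    using invariant_on_span[OF sub(1) invariant_mean_along[OF f sub(1) bs]]
      invariant_on_span[OF sub(2) invariant_mean_along[OF f sub(2) cs]] that assms(2,3) by simp_all
  have "mean_along bs f x = mean_along cs (mean_along bs f) x"
    using inv sub x by (intro mean_along_of_invariant[symmetric]) auto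
  also have "\<dots> = mean_along bs (mean_along cs f) x"
    by (rule mean_along_commute[OF f sub(2,1) x])
  also have "\<dots> = mean_along cs f x"
    using inv sub x by (intro mean_along_of_invariant) auto
  finally show ?thesis .
qed

lemma mean_along_cong:
  assumes "\<And>y. y \<in> S \<Longrightarrow> f y = g y" "set bs \<subseteq> W" "x \<in> S"
  shows "mean_along bs f x = mean_along bs g x"
  using assms(2,3)
  by (induction bs arbitrary: x) (auto intro!: segment_avg_cong assms(1))

lemma mean_along_add:
  assumes "smooth_fun_on f S" "smooth_fun_on g S" "set bs \<subseteq> W" "x \<in> S"
  shows "mean_along bs (\<lambda>y. f y + g y) x = mean_along bs f x + mean_along bs g x"
  using assms(3,4)
proof (induction bs arbitrary: x)
  case (Cons b bs)
  have "mean_along (b # bs) (\<lambda>y. f y + g y) x = segment_avg b (\<lambda>y. mean_along bs f y + mean_along bs g y) x"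
    using Cons by (auto intro!: segment_avg_cong)
  also have "\<dots> = segment_avg b (mean_along bs f) x + segment_avg b (mean_along bs g) x"
    unfolding segment_avg_def using Cons.prems assms(1,2)
    by (intro integral_add integrable_continuous_real continuous_on_segment smooth_fun_on_continuous smooth_mean_along) auto
  finally show ?case by simp
qed simp

lemma mean_along_cmult: "mean_along bs (\<lambda>y. c * f y) x = c * mean_along bs f x"
proof (induction bs arbitrary: x)
  case (Cons b bs)
  then show ?case by (simp add: segment_avg_def)
qed simp

lemma mean_along_pos:
  assumes f: "smooth_fun_on f S" and pos: "\<And>y. y \<in> S \<Longrightarrow> f y > 0" and "set bs \<subseteq> W" "x \<in> S"
  shows "mean_along bs f x > 0"
  using assms(3,4)
proof (induction bs arbitrary: x)
  case (Cons b bs)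
  let ?g = "\<lambda>t. mean_along bs f (x + t *\<^sub>R b)"
  have cont: "continuous_on {0..1} ?g"
    using Cons.prems f by (intro continuous_on_segment smooth_fun_on_continuous smooth_mean_along) auto
  have pos: "?g t > 0" for t using Cons shift_scaleR[of x b t] by auto
  obtain m where m: "m \<in> {0..1}" "\<forall>t\<in>{0..1}. ?g m \<le> ?g t"
    using continuous_attains_inf[of "{0..1::real}" ?g] cont by auto
  have "?g m = integral {0..1} (\<lambda>t::real. ?g m)" by simp
  also have "\<dots> \<le> integral {0..1} ?g"
    using cont m(2) by (intro integral_le integrable_continuous_real) auto
  finally show ?case using pos[of m] by (simp add: segment_avg_def)
qed (use pos in simp)

lemma periodic_dir_deriv:
  assumes f: "smooth_fun_on f S" and "b \<in> W" and per: "periodic b f"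
  shows "periodic b (dir_deriv v f)"
  unfolding periodic_def
proof
  fix x assume x: "x \<in> S"
  have "(f has_derivative (\<lambda>v. dir_deriv v f (x + b))) (at (x + b))"
    by (rule has_derivative_dir_deriv[OF smooth_fun_on_differentiable[OF f shift[OF x \<open>b \<in> W\<close>]]])
  then have "((\<lambda>y. f (y + b)) has_derivative (\<lambda>v. dir_deriv v f (x + b))) (at x)"
    by (rule has_derivative_shift)
  then have "dir_deriv v (\<lambda>y. f (y + b)) x = dir_deriv v f (x + b)"
    by (rule dir_deriv_eqI)
  moreover have "dir_deriv v (\<lambda>y. f (y + b)) x = dir_deriv v f x"
    by (rule dir_deriv_cong[OF open_S x]) (use per in \<open>simp add: periodic_def\<close>)
  ultimately show "dir_deriv v f (x + b) = dir_deriv v f x" by simp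
qed

lemma invariant_dir_deriv:
  assumes f: "smooth_fun_on f S" and "b \<in> W" and inv: "invariant b f"
  shows "invariant b (dir_deriv v f)"
  unfolding invariant_def
proof (intro ballI allI)
  fix x t assume x: "x \<in> S"
  have "periodic (t *\<^sub>R b) f" using inv by (simp add: periodic_def invariant_def)
  then have "periodic (t *\<^sub>R b) (dir_deriv v f)"
    by (rule periodic_dir_deriv[OF f subspace_scale[OF subspace_W \<open>b \<in> W\<close>]])
  then show "dir_deriv v f (x + t *\<^sub>R b) = dir_deriv v f x" using x by (simp add: periodic_def)
qed

lemma dir_deriv_invariant:
  assumes f: "smooth_fun_on f S" and inv: "invariant w f" and x: "x \<in> S"
  shows "dir_deriv w f x = 0"
proof -
  have D: "(f has_derivative (\<lambda>v. dir_deriv v f x)) (at x)"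
    by (intro has_derivative_dir_deriv smooth_fun_on_differentiable[OF f x])
  have "((\<lambda>t. f (x + t *\<^sub>R w)) has_derivative (\<lambda>h. dir_deriv (h *\<^sub>R w) f x)) (at 0)"
    by (rule has_derivative_along_line) (use D in simp)
  then have "((\<lambda>t::real. f x) has_derivative (\<lambda>h. dir_deriv (h *\<^sub>R w) f x)) (at 0)"
    using inv x by (simp add: invariant_def)
  then have "(\<lambda>h::real. dir_deriv (h *\<^sub>R w) f x) = (\<lambda>h. 0)"
    by (rule has_derivative_unique) (rule has_derivative_const)
  from fun_cong[OF this, of 1] show ?thesis by simp
qed

lemma mean_along_const: "mean_along bs (\<lambda>x. c) x = c"
  by (induction bs arbitrary: x) (simp_all add: segment_avg_def)

lemma mean_along_sum_list:
  assumes "\<And>p. p \<in> set L \<Longrightarrow> smooth_fun_on (f p) S" "set bs \<subseteq> W" "x \<in> S"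
  shows "mean_along bs (\<lambda>y. \<Sum>p\<leftarrow>L. c p * f p y) x = (\<Sum>p\<leftarrow>L. c p * mean_along bs (f p) x)
    \<and> smooth_fun_on (\<lambda>y. \<Sum>p\<leftarrow>L. c p * f p y) S"
  using assms(1)
proof (induction L)
  case Nil
  then show ?case by (simp add: mean_along_const smooth_fun_on_const)
next
  case (Cons p L)
  have IH: "mean_along bs (\<lambda>y. \<Sum>p\<leftarrow>L. c p * f p y) x = (\<Sum>p\<leftarrow>L. c p * mean_along bs (f p) x)"
    "smooth_fun_on (\<lambda>y. \<Sum>p\<leftarrow>L. c p * f p y) S" and p: "smooth_fun_on (f p) S"
    using Cons by auto
  have cp: "smooth_fun_on (\<lambda>y. c p * f p y) S"
    using smooth_fun_on_lincomb[OF open_S p p, of "c p" 0] by simp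
  show ?case
    using mean_along_add[OF cp IH(2) assms(2,3)] IH
      smooth_fun_on_lincomb[OF open_S cp IH(2), of 1 1] by (simp add: mean_along_cmult)
qed

end

section \<open>The operator \<open>d d\<^sup>c\<close> in coordinates\<close>

lemma Jmult_nth [simp]: "fst (Jmult v) $ i = \<i> * fst v $ i" "snd (Jmult v) $ j = \<i> * snd v $ j"
  by (simp_all add: Jmult_def split_def)

lemma cspace_eqI:
  fixes v w :: "('r::finite, 'c::finite) cspace"
  assumes "\<And>i. fst v $ i = fst w $ i" "\<And>j. snd v $ j = snd w $ j"
  shows "v = w"
  using assms by (simp add: prod_eq_iff Finite_Cartesian_Product.vec_eq_iff)

lemma Jmult_Jmult [simp]: "Jmult (Jmult v) = - v"
  by (rule cspace_eqI) (simp_all add: mult.assoc[symmetric])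

lemma Jmult_minus [simp]: "Jmult (- v) = - Jmult v"
  by (rule cspace_eqI) simp_all

lemma dc_expand:
  "dc \<omega> y [u1, u2, u3]
     = dir_deriv (- Jmult u1) (\<lambda>z. \<omega> z [u2, u3]) y - dir_deriv (- Jmult u2) (\<lambda>z. \<omega> z [u1, u3]) y
       + dir_deriv (- Jmult u3) (\<lambda>z. \<omega> z [u1, u2]) y"
  by (simp add: dc_def ext_deriv_def dir_deriv_def lessThan_Suc numeral_3_eq_3)

lemma ext_deriv_expand:
  "ext_deriv \<eta> x [v1, v2, v3, v4]
     = dir_deriv v1 (\<lambda>z. \<eta> z [v2, v3, v4]) x - dir_deriv v2 (\<lambda>z. \<eta> z [v1, v3, v4]) x
       + dir_deriv v3 (\<lambda>z. \<eta> z [v1, v2, v4]) x - dir_deriv v4 (\<lambda>z. \<eta> z [v1, v2, v3]) x"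
  by (simp add: ext_deriv_def dir_deriv_def lessThan_Suc)

text \<open>
  The terms of \<open>d d\<^sup>c \<omega> (v1, v2, v3, v4)\<close>: an entry \<open>(c, v, w, a, b)\<close> stands for \<open>c\<close> times the derivative of
  \<open>\<omega>(a, b)\<close> in the directions \<open>J w\<close> and \<open>v\<close>.
\<close>

definition ddc_terms ::
    "'v \<Rightarrow> 'v \<Rightarrow> 'v \<Rightarrow> 'v \<Rightarrow> (real \<times> 'v \<times> 'v \<times> 'v \<times> 'v) list" where
  "ddc_terms v1 v2 v3 v4 =
     [(-1, v1, v2, v3, v4), (1, v1, v3, v2, v4), (-1, v1, v4, v2, v3),
      (1, v2, v1, v3, v4), (-1, v2, v3, v1, v4), (1, v2, v4, v1, v3),
      (-1, v3, v1, v2, v4), (1, v3, v2, v1, v4), (-1, v3, v4, v1, v2),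
      (1, v4, v1, v2, v3), (-1, v4, v2, v1, v3), (1, v4, v3, v1, v2)]"

lemma ddc_expand:
  assumes S: "open S" and x: "x \<in> S" and smooth: "\<And>v w. smooth_fun_on (\<lambda>x. \<omega> x [v, w]) S"
  shows "ext_deriv (dc \<omega>) x [v1, v2, v3, v4]
    = (\<Sum>(c, v, w, a, b)\<leftarrow>ddc_terms v1 v2 v3 v4. c * dir_deriv v (dir_deriv (Jmult w) (\<lambda>z. \<omega> z [a, b])) x)"
proof -
  let ?D = "\<lambda>v w a b. dir_deriv v (dir_deriv (Jmult w) (\<lambda>z. \<omega> z [a, b])) x"
  have minus: "dir_deriv (- v) (\<lambda>z. \<omega> z [a, b]) y = - dir_deriv v (\<lambda>z. \<omega> z [a, b]) y" if "y \<in> S" for v a b y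
    by (rule linear_neg[OF linear_dir_deriv[OF smooth_fun_on_differentiable[OF smooth that]]])
  have "dir_deriv v (\<lambda>z. dc \<omega> z [u1, u2, u3]) x = - ?D v u1 u2 u3 + ?D v u2 u1 u3 - ?D v u3 u1 u2" for v u1 u2 u3
  proof -
    let ?f = "\<lambda>w a b. dir_deriv (Jmult w) (\<lambda>z. \<omega> z [a, b])"
    have "dir_deriv v (\<lambda>z. dc \<omega> z [u1, u2, u3]) x
        = dir_deriv v (\<lambda>z. - ?f u1 u2 u3 z + ?f u2 u1 u3 z - ?f u3 u1 u2 z) x"
      by (rule dir_deriv_cong[OF S x]) (simp add: dc_expand minus)
    also have "\<dots> = - ?D v u1 u2 u3 + ?D v u2 u1 u3 - ?D v u3 u1 u2"
      by (rule dir_deriv_eqI)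
         (intro has_derivative_diff has_derivative_add has_derivative_minus has_derivative_dir_deriv
           smooth_fun_on_differentiable[OF smooth_fun_on_dir_deriv[OF smooth] x])
    finally show ?thesis .
  qed
  then show ?thesis
    unfolding ext_deriv_expand by (simp add: ddc_terms_def)
qed

lemma in_ot_domain: "x \<in> ot_domain \<longleftrightarrow> (\<forall>i. Im (fst x $ i) > 0)"
  by (simp add: ot_domain_def split_def)

lemma open_ot_domain: "open (ot_domain :: ('r::finite, 'c::finite) cspace set)"
proof -
  have "ot_domain = (\<Inter>i. {x :: ('r, 'c) cspace. 0 < Im (fst x $ i)})"
    by (auto simp: in_ot_domain)
  also have "open \<dots>"
    by (intro open_INT ballI open_Collect_less) (auto intro!: continuous_intros)
  finally show ?thesis .
qed

lemma convex_ot_domain: "convex (ot_domain :: ('r::finite, 'c::finite) cspace set)"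
proof (rule convexI)
  fix x y :: "('r, 'c) cspace" and u v :: real
  assume xy: "x \<in> ot_domain" "y \<in> ot_domain" and uv: "0 \<le> u" "0 \<le> v" "u + v = 1"
  have "u * Im (fst x $ i) + v * Im (fst y $ i) > 0" for i
  proof (cases "u = 0")
    case False
    have "u * Im (fst x $ i) > 0" "v * Im (fst y $ i) \<ge> 0"
      using False uv xy by (auto simp: in_ot_domain less_imp_le)
    then show ?thesis by simp
  qed (use uv xy in \<open>auto simp: in_ot_domain\<close>)
  then show "u *\<^sub>R x + v *\<^sub>R y \<in> ot_domain" by (simp add: in_ot_domain)
qed

interpretation ot: translation_domain
  "ot_domain :: ('r::finite, 'c::finite) cspace set" real_directions
proof
  show "subspace (real_directions :: ('r, 'c) cspace set)"
    by (rule subspace_real_directions)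
  show "x + w \<in> ot_domain" if "x \<in> ot_domain" "w \<in> real_directions" for x w :: "('r, 'c) cspace"
    using that by (simp add: in_ot_domain real_directions_def)
qed (rule open_ot_domain convex_ot_domain)+

lemma length_4_eq: "length vs = 4 \<longleftrightarrow> (\<exists>v1 v2 v3 v4. vs = [v1, v2, v3, v4])"
  by (auto simp: numeral_eq_Suc length_Suc_conv)

lemma ext_deriv_dc_cong:
  fixes \<omega> \<omega>' :: "('r::finite, 'c::finite) cspace form"
  assumes V: "open V" "x \<in> V" and smooth: "\<And>v w. smooth_fun_on (\<lambda>x. \<omega> x [v, w]) V"
    and eq: "\<And>y v w. y \<in> V \<Longrightarrow> \<omega> y [v, w] = \<omega>' y [v, w]" and len: "length vs = 4"
  shows "ext_deriv (dc \<omega>) x vs = ext_deriv (dc \<omega>') x vs"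
proof -
  obtain v1 v2 v3 v4 where vs: "vs = [v1, v2, v3, v4]" using len unfolding length_4_eq by blast
  have smooth': "smooth_fun_on (\<lambda>x. \<omega>' x [v, w]) V" for v w
    by (rule smooth_fun_on_cong[OF V(1) eq smooth])
  have "dir_deriv v (dir_deriv w (\<lambda>z. \<omega> z [a, b])) x = dir_deriv v (dir_deriv w (\<lambda>z. \<omega>' z [a, b])) x" for v w a b
    by (rule dir_deriv_cong[OF V]) (rule dir_deriv_cong[OF V(1) _ eq])
  then show ?thesis
    unfolding vs ddc_expand[where \<omega> = \<omega>, OF V smooth] ddc_expand[where \<omega> = \<omega>', OF V smooth'] by simp
qed

lemma hermitian_form_onD:
  assumes "hermitian_form_on S \<omega>"
  shows "smooth_fun_on (\<lambda>x. \<omega> x [v, w]) S"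
    and "x \<in> S \<Longrightarrow> bilinear (\<lambda>v w. \<omega> x [v, w])"
    and "x \<in> S \<Longrightarrow> \<omega> x [v, v] = 0"
    and "x \<in> S \<Longrightarrow> \<omega> x [Jmult v, Jmult w] = \<omega> x [v, w]"
    and "x \<in> S \<Longrightarrow> v \<noteq> 0 \<Longrightarrow> \<omega> x [v, Jmult v] > 0"
proof -
  note S = assms[unfolded hermitian_form_on_def, THEN conjunct1]
    and P = assms[unfolded hermitian_form_on_def, THEN conjunct2, rule_format]
  show "smooth_fun_on (\<lambda>x. \<omega> x [v, w]) S" by (rule S[rule_format])
  show "x \<in> S \<Longrightarrow> bilinear (\<lambda>v w. \<omega> x [v, w])" by (rule P[THEN conjunct1])
  show "x \<in> S \<Longrightarrow> \<omega> x [v, v] = 0" by (rule P[THEN conjunct2, THEN conjunct1, rule_format])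
  show "x \<in> S \<Longrightarrow> \<omega> x [Jmult v, Jmult w] = \<omega> x [v, w]"
    by (rule P[THEN conjunct2, THEN conjunct2, THEN conjunct1, rule_format])
  show "x \<in> S \<Longrightarrow> v \<noteq> 0 \<Longrightarrow> \<omega> x [v, Jmult v] > 0"
    by (rule P[THEN conjunct2, THEN conjunct2, THEN conjunct2, rule_format])
qed

lemma hermitian_form_on_subset:
  fixes S T :: "('r::finite, 'c::finite) cspace set"
  assumes herm: "hermitian_form_on S \<omega>" and sub: "T \<subseteq> S"
  shows "hermitian_form_on T \<omega>"
  unfolding hermitian_form_on_def
proof (rule conjI; intro ballI allI)
  show "smooth_fun_on (\<lambda>x. \<omega> x [v, w]) T" for v w
    by (rule smooth_fun_on_subset[OF hermitian_form_onD(1)[OF herm] sub])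
  fix x assume "x \<in> T"
  then have x: "x \<in> S" using sub by blast
  show "bilinear (\<lambda>v w. \<omega> x [v, w]) \<and> (\<forall>v. \<omega> x [v, v] = 0) \<and>
      (\<forall>v w. \<omega> x [Jmult v, Jmult w] = \<omega> x [v, w]) \<and> (\<forall>v. v \<noteq> 0 \<longrightarrow> \<omega> x [v, Jmult v] > 0)"
    using hermitian_form_onD(2-5)[OF herm x] by (intro conjI allI impI)
qed

section \<open>Averages of coefficients of pluriclosed forms\<close>

lemma real_directions_minus: "v \<in> real_directions \<Longrightarrow> - v \<in> real_directions"
  by (simp add: real_directions_def)

text \<open>
  Evaluate the averaged equation \<open>d d\<^sup>c \<omega> = 0\<close> on \<open>J a, b, e, J e\<close>. Averages are invariant under
  \<open>real_directions\<close>, so a term with derivatives in the directions \<open>v\<close> and \<open>J w\<close> vanishes as soon as \<open>v\<close> or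
  \<open>J w\<close> lies there. The only term left is the one with \<open>v = J a\<close> and \<open>w = b\<close>.
\<close>

lemma second_derivative_of_mean_vanishes:
  fixes \<omega> :: "('r::finite, 'c::finite) cspace form"
  assumes smooth: "\<And>v w. smooth_fun_on (\<lambda>x. \<omega> x [v, w]) ot_domain"
    and ddc: "\<And>x vs. x \<in> ot_domain \<Longrightarrow> length vs = 4 \<Longrightarrow> ext_deriv (dc \<omega>) x vs = 0"
    and bs: "span (set bs) = real_directions"
    and per: "\<And>b v w. b \<in> set bs \<Longrightarrow> ot.periodic b (\<lambda>x. \<omega> x [v, w])"
    and a: "a \<in> real_directions" and b: "b \<in> real_directions"
    and e: "e \<in> real_directions" "Jmult e \<in> real_directions"
    and x: "x \<in> ot_domain"
  shows "dir_deriv (Jmult a) (dir_deriv (Jmult b) (mean_along bs (\<lambda>x. \<omega> x [e, Jmult e]))) x = 0"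
proof -
  have sub: "set bs \<subseteq> real_directions" using bs span_superset by blast
  define g where "g = (\<lambda>(c' :: real, v, w, p, q) y. dir_deriv v (dir_deriv (Jmult w) (\<lambda>z. \<omega> z [p, q])) y)"
  define G where "G = (\<lambda>v w p q. dir_deriv v (dir_deriv (Jmult w) (mean_along bs (\<lambda>z. \<omega> z [p, q]))) x)"
  have smooth_g: "smooth_fun_on (g p) ot_domain" for p
    unfolding g_def by (cases p) (simp add: smooth_fun_on_dir_deriv smooth)
  have mean_g: "mean_along bs (g (c, v, w, p, q)) x = G v w p q" for c v w p q
  proof -
    have "mean_along bs (g (c, v, w, p, q)) x
        = dir_deriv v (mean_along bs (dir_deriv (Jmult w) (\<lambda>z. \<omega> z [p, q]))) x"
      unfolding g_def prod.case
      by (rule ot.dir_deriv_mean_along[symmetric, OF smooth_fun_on_dir_deriv[OF smooth] sub x])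
    also have "\<dots> = G v w p q"
      unfolding G_def
      by (rule dir_deriv_cong[OF open_ot_domain x])
         (rule ot.dir_deriv_mean_along[symmetric, OF smooth sub])
    finally show ?thesis .
  qed
  have inv: "ot.invariant w (mean_along bs (\<lambda>z. \<omega> z [p, q]))" if "w \<in> real_directions" for w p q
    by (rule ot.invariant_on_span[OF sub ot.invariant_mean_along[OF smooth sub]])
       (use per bs that in auto)
  have D0: "dir_deriv w (mean_along bs (\<lambda>z. \<omega> z [p, q])) y = 0"
    if "w \<in> real_directions" "y \<in> ot_domain" for w y p q
    by (rule ot.dir_deriv_invariant[OF ot.smooth_mean_along[OF smooth sub] inv[OF that(1)] that(2)])
  have G1: "G v w p q = 0" if "Jmult w \<in> real_directions" for v w p q
  proof -
    have "G v w p q = dir_deriv v (\<lambda>_. 0) x"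
      unfolding G_def by (rule dir_deriv_cong[OF open_ot_domain x D0[OF that]])
    then show ?thesis by simp
  qed
  have G2: "G v w p q = 0" if "v \<in> real_directions" for v w p q
  proof -
    have "ot.invariant v (dir_deriv (Jmult w) (mean_along bs (\<lambda>z. \<omega> z [p, q])))"
      by (rule ot.invariant_dir_deriv[OF ot.smooth_mean_along[OF smooth sub] that inv[OF that]])
    then show ?thesis
      unfolding G_def
      by (intro ot.dir_deriv_invariant[OF smooth_fun_on_dir_deriv[OF ot.smooth_mean_along[OF smooth sub]] _ x])
  qed
  let ?L = "ddc_terms (Jmult a) b e (Jmult e)"
  have "0 = mean_along bs (\<lambda>y. 0) x" by (simp add: ot.mean_along_const)
  also have "\<dots> = mean_along bs (\<lambda>y. \<Sum>p\<leftarrow>?L. fst p * g p y) x"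
  proof (rule ot.mean_along_cong[OF _ sub x])
    fix y :: "('r, 'c) cspace" assume y: "y \<in> ot_domain"
    have "ext_deriv (dc \<omega>) y [Jmult a, b, e, Jmult e] = 0" by (rule ddc[OF y]) simp
    then show "0 = (\<Sum>p\<leftarrow>?L. fst p * g p y)"
      unfolding ddc_expand[where \<omega> = \<omega>, OF open_ot_domain y smooth] g_def
      by (simp add: split_def)
  qed
  also have "\<dots> = (\<Sum>p\<leftarrow>?L. fst p * mean_along bs (g p) x)"
    using ot.mean_along_sum_list[where f = g and c = fst and L = ?L, OF smooth_g sub x] by blast
  also have "\<dots> = - G (Jmult a) b e (Jmult e)"
    using a b e by (simp add: ddc_terms_def mean_g G1 G2 real_directions_minus)
  finally show ?thesis by (simp add: G_def)
qed

definition real_component :: "('r::finite, 'c::finite) cspace \<Rightarrow> ('r, 'c) cspace" where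
  "real_component v = ((\<chi> i. of_real (Re (fst v $ i))), snd v)"

definition imaginary_component :: "('r::finite, 'c::finite) cspace \<Rightarrow> ('r, 'c) cspace" where
  "imaginary_component v = ((\<chi> i. of_real (Im (fst v $ i))), 0)"

lemma components_in_real_directions:
  "real_component v \<in> real_directions" "imaginary_component v \<in> real_directions"
  by (simp_all add: real_component_def imaginary_component_def real_directions_def)

lemma component_decomposition: "v = real_component v + Jmult (imaginary_component v)"
  by (rule cspace_eqI) (simp_all add: real_component_def imaginary_component_def complex_eq_iff)

text \<open>
  Every vector is \<open>v1 + J v2\<close> with \<open>v1\<close> and \<open>v2\<close> real; derivatives along \<open>v1\<close> vanish by invariance, so all
  second derivatives vanish. The constants are read off at the point \<open>(i, \<dots>, i)\<close>.
\<close>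

lemma affine_in_imaginary_parts:
  fixes g :: "('r::finite, 'c::finite) cspace \<Rightarrow> real"
  assumes g: "smooth_fun_on g ot_domain"
    and inv: "\<And>w. w \<in> real_directions \<Longrightarrow> ot.invariant w g"
    and zero: "\<And>a b x. a \<in> real_directions \<Longrightarrow> b \<in> real_directions \<Longrightarrow> x \<in> ot_domain
      \<Longrightarrow> dir_deriv (Jmult a) (dir_deriv (Jmult b) g) x = 0"
  obtains c0 c where "\<And>x. x \<in> ot_domain \<Longrightarrow> g x = c0 + (\<Sum>i\<in>UNIV. c i * Im (fst x $ i))"
proof -
  have lin: "linear (\<lambda>v. dir_deriv v f x)" if "smooth_fun_on f ot_domain" "x \<in> ot_domain"
    for f and x :: "('r, 'c) cspace"
    by (rule linear_dir_deriv[OF smooth_fun_on_differentiable[OF that]])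
  have split: "dir_deriv (v1 + Jmult v2) f x = dir_deriv (Jmult v2) f x"
    if "smooth_fun_on f ot_domain" "x \<in> ot_domain" "v1 \<in> real_directions" "ot.invariant v1 f"
    for f v1 v2 and x :: "('r, 'c) cspace"
    using linear_add[OF lin[OF that(1,2)], of v1 "Jmult v2"] ot.dir_deriv_invariant[OF that(1,4,2)] by simp
  have all_zero: "dir_deriv v (dir_deriv w g) x = 0" if x: "x \<in> ot_domain" for v w x
  proof -
    let ?v1 = "real_component v" and ?v2 = "imaginary_component v"
    let ?w1 = "real_component w" and ?w2 = "imaginary_component w"
    note W = components_in_real_directions
    have "dir_deriv v (dir_deriv w g) x = dir_deriv v (dir_deriv (?w1 + Jmult ?w2) g) x"
      using component_decomposition[of w] by simp
    also have "\<dots> = dir_deriv v (dir_deriv (Jmult ?w2) g) x"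
      by (rule dir_deriv_cong[OF open_ot_domain x split[OF g _ W(1) inv[OF W(1)]]])
    also have "\<dots> = dir_deriv (?v1 + Jmult ?v2) (dir_deriv (Jmult ?w2) g) x"
      using component_decomposition[of v] by simp
    also have "\<dots> = dir_deriv (Jmult ?v2) (dir_deriv (Jmult ?w2) g) x"
      by (rule split[OF smooth_fun_on_dir_deriv[OF g] x W(1)
            ot.invariant_dir_deriv[OF g W(1) inv[OF W(1)]]])
    also have "\<dots> = 0" by (rule zero[OF W(2) W(2) x])
    finally show ?thesis .
  qed
  define p :: "('r, 'c) cspace" where "p = ((\<chi> i. \<i>), 0)"
  define e :: "'r \<Rightarrow> ('r, 'c) cspace" where "e = (\<lambda>i. Jmult (axis i 1, 0))"
  define c where "c = (\<lambda>i. dir_deriv (e i) g p)"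
  have p: "p \<in> ot_domain" by (simp add: p_def in_ot_domain)
  have "g x = (g p - (\<Sum>i\<in>UNIV. c i)) + (\<Sum>i\<in>UNIV. c i * Im (fst x $ i))" if x: "x \<in> ot_domain" for x
  proof -
    let ?v1 = "real_component (x - p)" and ?v2 = "imaginary_component (x - p)"
    have "Jmult ?v2 = (\<Sum>i\<in>UNIV. (Im (fst x $ i) - 1) *\<^sub>R e i)"
    proof (rule cspace_eqI)
      fix k
      have "fst (\<Sum>i\<in>UNIV. (Im (fst x $ i) - 1) *\<^sub>R e i) $ k
          = (\<Sum>i\<in>UNIV. (Im (fst x $ i) - 1) *\<^sub>R (\<i> * (if k = i then 1 else 0)))"
        by (simp add: fst_sum e_def axis_def)
      also have "\<dots> = (\<Sum>i\<in>UNIV. if k = i then (Im (fst x $ i) - 1) *\<^sub>R \<i> else 0)"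
        by (rule sum.cong) auto
      also have "\<dots> = fst (Jmult ?v2) $ k"
        by (simp add: imaginary_component_def p_def complex_eq_iff)
      finally show "fst (Jmult ?v2) $ k = fst (\<Sum>i\<in>UNIV. (Im (fst x $ i) - 1) *\<^sub>R e i) $ k" ..
    next
      fix k
      show "snd (Jmult ?v2) $ k = snd (\<Sum>i\<in>UNIV. (Im (fst x $ i) - 1) *\<^sub>R e i) $ k"
        by (simp add: snd_sum e_def imaginary_component_def)
    qed
    moreover have "dir_deriv (x - p) g p = dir_deriv (?v1 + Jmult ?v2) g p"
      using component_decomposition[of "x - p"] by simp
    moreover have "\<dots> = dir_deriv (Jmult ?v2) g p"
      by (rule split[OF g p components_in_real_directions(1) inv[OF components_in_real_directions(1)]])
    ultimately have "dir_deriv (x - p) g p = dir_deriv (\<Sum>i\<in>UNIV. (Im (fst x $ i) - 1) *\<^sub>R e i) g p"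
      by simp
    also have "\<dots> = (\<Sum>i\<in>UNIV. (Im (fst x $ i) - 1) * c i)"
      by (simp add: linear_sum[OF lin[OF g p]] linear_scale[OF lin[OF g p]] c_def)
    finally have "dir_deriv (x - p) g p = (\<Sum>i\<in>UNIV. c i * Im (fst x $ i)) - (\<Sum>i\<in>UNIV. c i)"
      by (simp add: algebra_simps sum_subtractf)
    then show ?thesis
      using affine_if_second_derivatives_vanish[OF open_ot_domain convex_ot_domain g all_zero p x] by simp
  qed
  then show ?thesis by (rule that)
qed

text \<open>
  An affine function vanishing on the positive orthant has zero coefficients; compare both sides.
\<close>

lemma affine_semi_invariance:
  fixes c :: "'i::finite \<Rightarrow> real"
  assumes "\<And>y. (\<And>i. y i > 0) \<Longrightarrow> m * (c0 + (\<Sum>i\<in>UNIV. c i * (s i * y i))) = c0 + (\<Sum>i\<in>UNIV. c i * y i)"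
  shows "c0 \<noteq> 0 \<Longrightarrow> m = 1" and "c i \<noteq> 0 \<Longrightarrow> s i * m = 1"
proof -
  define d where "d = (\<lambda>i. c i * (m * s i - 1))"
  have d: "c0 * (m - 1) + (\<Sum>i\<in>UNIV. d i * y i) = 0" if y: "\<And>i. y i > 0" for y
  proof -
    have "(\<Sum>i\<in>UNIV. d i * y i) = m * (\<Sum>i\<in>UNIV. c i * (s i * y i)) - (\<Sum>i\<in>UNIV. c i * y i)"
      unfolding sum_distrib_left sum_subtractf[symmetric]
      by (rule sum.cong) (simp_all add: d_def algebra_simps)
    then show ?thesis using assms[of y, OF y] by (simp add: algebra_simps)
  qed
  have di: "d i = 0" for i
  proof -
    \<comment> \<open>evaluate at \<open>(1, \<dots>, 1)\<close> and at the same point with the entry \<open>i\<close> doubled\<close>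
    have "(\<Sum>k\<in>UNIV. d k * (if k = i then 2 else 1)) - (\<Sum>k\<in>UNIV. d k * 1)
        = (\<Sum>k\<in>UNIV. if k = i then d k else 0)"
      unfolding sum_subtractf[symmetric] by (rule sum.cong) auto
    moreover have "c0 * (m - 1) + (\<Sum>k\<in>UNIV. d k * (if k = i then 2 else 1)) = 0" by (rule d) simp
    ultimately show ?thesis using d[of "\<lambda>_. 1"] by simp
  qed
  then show "c0 \<noteq> 0 \<Longrightarrow> m = 1" using d[of "\<lambda>_. 1"] by simp
  show "c i \<noteq> 0 \<Longrightarrow> s i * m = 1" using di[of i] by (simp add: d_def mult.commute)
qed

section \<open>The model form\<close>

lemma linear_rotation: "linear (rotation \<sigma> \<tau> u)"
  by (rule linearI; rule cspace_eqI)
     (simp_all add: rotation_def split_def distrib_left scaleR_conv_of_real mult.left_commute)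

lemma rotation_nth [simp]:
  "fst (rotation \<sigma> \<tau> u x) $ i = of_real (\<sigma> i u) * fst x $ i"
  "snd (rotation \<sigma> \<tau> u x) $ j = \<tau> j u * snd x $ j"
  by (simp_all add: rotation_def split_def)

lemma linear_rotation_image_real_directions:
  "rotation \<sigma> \<tau> u ` real_directions \<subseteq> real_directions"
  by (auto simp: real_directions_def)

text \<open>
  The area form of the complex plane, that is, half of \<open>i dz \<and> dz\<^sup>*\<close>.
\<close>

definition area :: "complex \<Rightarrow> complex \<Rightarrow> real" where
  "area a b = Re a * Im b - Im a * Re b"

lemma area_mult: "area (c * a) (c * b) = (cmod c)\<^sup>2 * area a b"
  by (simp add: area_def cmod_power2) (simp add: algebra_simps power2_eq_square)

lemma area_self [simp]: "area a a = 0"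
  by (simp add: area_def)

lemma area_rotate: "area a (\<i> * a) = (cmod a)\<^sup>2"
  unfolding cmod_power2 by (simp add: area_def power2_eq_square)

definition weight :: "('c \<Rightarrow> 'r option) \<Rightarrow> 'c \<Rightarrow> ('r::finite, 'c::finite) cspace \<Rightarrow> real" where
  "weight m j x = (case m j of None \<Rightarrow> 1 | Some i \<Rightarrow> Im (fst x $ i))"

definition model_form :: "('c \<Rightarrow> 'r option) \<Rightarrow> ('r::finite, 'c::finite) cspace form" where
  "model_form m x vs =
     (\<Sum>i\<in>UNIV. inverse (Im (fst x $ i)) ^ 2 * area (fst (vs ! 0) $ i) (fst (vs ! 1) $ i))
     + (\<Sum>j\<in>UNIV. weight m j x * area (snd (vs ! 0) $ j) (snd (vs ! 1) $ j))"

lemma has_derivative_Im_component: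
  "((\<lambda>x :: ('r::finite, 'c::finite) cspace. Im (fst x $ i)) has_derivative (\<lambda>v. Im (fst v $ i))) (at x within A)"
proof -
  have "linear (\<lambda>x :: ('r, 'c) cspace. Im (fst x $ i))" by (rule linearI) simp_all
  then have "bounded_linear (\<lambda>x :: ('r, 'c) cspace. Im (fst x $ i))"
    by (rule linear_conv_bounded_linear[THEN iffD1])
  then show ?thesis by (rule bounded_linear_imp_has_derivative)
qed

lemma has_derivative_inverse_power:
  assumes "x \<in> ot_domain"
  shows "((\<lambda>x :: ('r::finite, 'c::finite) cspace. inverse (Im (fst x $ i)) ^ k)
    has_derivative (\<lambda>v. - real k * Im (fst v $ i) * inverse (Im (fst x $ i)) ^ Suc k)) (at x)"
proof -
  have pos: "Im (fst x $ i) > 0" using assms by (simp add: in_ot_domain)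
  have "((\<lambda>y. inverse y ^ k) has_real_derivative - real k * inverse (Im (fst x $ i)) ^ Suc k) (at (Im (fst x $ i)))"
  proof (cases k)
    case (Suc n)
    have "((\<lambda>y. inverse y ^ k) has_real_derivative
        real k * (- (inverse (Im (fst x $ i)) * inverse (Im (fst x $ i)))) * inverse (Im (fst x $ i)) ^ (k - Suc 0)) (at (Im (fst x $ i)))"
      using pos by (auto intro!: derivative_eq_intros simp: power2_eq_square)
    moreover have "real k * (- (a * a)) * a ^ (k - Suc 0) = - real k * a ^ Suc k" for a :: real
      using Suc by (simp del: of_nat_Suc add: mult_ac)
    ultimately show ?thesis by (simp only:)
  qed simp
  from has_derivative_compose[OF has_derivative_Im_component this[unfolded has_field_derivative_def]]
  show ?thesis by (rule has_derivative_eq_rhs) (auto simp: fun_eq_iff)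
qed

lemma smooth_inverse_power:
  "smooth_fun_on (\<lambda>x :: ('r::finite, 'c::finite) cspace. a * inverse (Im (fst x $ i)) ^ k) ot_domain"
  unfolding smooth_fun_on_def
proof
  fix n
  have D: "((\<lambda>x. a * inverse (Im (fst x $ i)) ^ k) has_derivative
      (\<lambda>v. a * (- real k * Im (fst v $ i) * inverse (Im (fst x $ i)) ^ Suc k))) (at x)"
    if "x \<in> ot_domain" for x :: "('r, 'c) cspace" and a k
    by (rule has_derivative_mult_right[OF has_derivative_inverse_power[OF that]])
  show "times_differentiable_on n (\<lambda>x :: ('r, 'c) cspace. a * inverse (Im (fst x $ i)) ^ k) ot_domain"
  proof (induction n arbitrary: a k)
    case 0
    show ?case
      using has_derivative_continuous[OF D] by (simp add: continuous_at_imp_continuous_on)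
  next
    case (Suc n)
    have "times_differentiable_on n (dir_deriv v (\<lambda>x :: ('r, 'c) cspace. a * inverse (Im (fst x $ i)) ^ k)) ot_domain" for v
    proof (rule times_differentiable_on_cong[OF open_ot_domain _ Suc.IH])
      fix x :: "('r, 'c) cspace" assume x: "x \<in> ot_domain"
      show "- real k * a * Im (fst v $ i) * inverse (Im (fst x $ i)) ^ Suc k
          = dir_deriv v (\<lambda>x. a * inverse (Im (fst x $ i)) ^ k) x"
        by (subst dir_deriv_eqI[OF D[OF x]]) simp
    qed
    then show ?case
      unfolding times_differentiable_on_Suc using differentiableI[OF D] by simp
  qed
qed

lemma has_derivative_weight:
  "(weight m j has_derivative (\<lambda>v. case m j of None \<Rightarrow> 0 | Some i \<Rightarrow> Im (fst v $ i))) (at x within A)"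
  unfolding weight_def[abs_def]
  by (cases "m j") (simp_all add: has_derivative_Im_component)

lemma smooth_weight: "smooth_fun_on (weight m j) ot_domain"
  unfolding smooth_fun_on_def
proof
  fix n show "times_differentiable_on n (weight m j) ot_domain"
  proof (cases n)
    case 0
    then show ?thesis
      using has_derivative_continuous[OF has_derivative_weight[of m j]] by (simp add: continuous_on_eq_continuous_within)
  next
    case (Suc k)
    have "dir_deriv v (weight m j) = (\<lambda>x. case m j of None \<Rightarrow> 0 | Some i \<Rightarrow> Im (fst v $ i))" for v
      by (rule ext) (rule dir_deriv_eqI[OF has_derivative_weight])
    then have "times_differentiable_on k (dir_deriv v (weight m j)) ot_domain" for v
      by (simp add: smooth_fun_on_const[unfolded smooth_fun_on_def, rule_format])
    then show ?thesis
      unfolding Suc times_differentiable_on_Suc using differentiableI[OF has_derivative_weight[of m j]] by simp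
  qed
qed

lemma smooth_model_form: "smooth_fun_on (\<lambda>x. model_form m x [v, w]) ot_domain"
proof -
  have 1: "smooth_fun_on (\<lambda>x. \<Sum>i\<in>UNIV. inverse (Im (fst x $ i)) ^ 2 * area (fst v $ i) (fst w $ i)) ot_domain"
    by (rule smooth_fun_on_sum[OF open_ot_domain])
       (subst mult.commute, rule smooth_inverse_power)
  have "smooth_fun_on (\<lambda>x. weight m j x * area (snd v $ j) (snd w $ j)) ot_domain" for j
    using smooth_fun_on_lincomb[OF open_ot_domain smooth_weight smooth_weight,
        of "area (snd v $ j) (snd w $ j)" m j 0 m j] by (simp add: mult.commute)
  then have 2: "smooth_fun_on (\<lambda>x. \<Sum>j\<in>UNIV. weight m j x * area (snd v $ j) (snd w $ j)) ot_domain"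
    by (rule smooth_fun_on_sum[OF open_ot_domain])
  show ?thesis
    using smooth_fun_on_lincomb[OF open_ot_domain 1 2, of 1 1] by (simp add: model_form_def)
qed

lemma weight_pos: "x \<in> ot_domain \<Longrightarrow> weight m j x > 0"
  by (cases "m j") (simp_all add: weight_def in_ot_domain)

lemma linear_area: "linear (\<lambda>v. k * area (f v) b)" "linear (\<lambda>v. k * area b (f v))" if "linear f"
  for f :: "'v::real_vector \<Rightarrow> complex"
  by (rule linearI; simp add: area_def linear_add[OF that] linear_scale[OF that] algebra_simps)+

lemma linear_components:
  "linear (\<lambda>v :: ('r::finite, 'c::finite) cspace. fst v $ i)"
  "linear (\<lambda>v :: ('r::finite, 'c::finite) cspace. snd v $ j)"
  by (rule linearI; simp)+

lemma hermitian_model_form: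
  fixes m :: "'c::finite \<Rightarrow> 'r::finite option"
  shows "hermitian_form_on ot_domain (model_form m)"
  unfolding hermitian_form_on_def
proof (intro conjI allI ballI impI)
  show "smooth_fun_on (\<lambda>x. model_form m x [v, w]) ot_domain" for v w by (rule smooth_model_form)
  fix x :: "('r, 'c) cspace" assume x: "x \<in> ot_domain"
  show "bilinear (\<lambda>v w. model_form m x [v, w])"
    unfolding bilinear_def model_form_def
    by (auto intro!: linear_compose_add linear_compose_sum linear_area linear_components)
  show "model_form m x [v, v] = 0" for v by (simp add: model_form_def)
  show "model_form m x [Jmult v, Jmult w] = model_form m x [v, w]" for v w
    by (simp add: model_form_def area_mult)
  fix v :: "('r, 'c) cspace" assume "v \<noteq> 0"
  have eq: "model_form m x [v, Jmult v]
      = (\<Sum>i\<in>UNIV. inverse (Im (fst x $ i)) ^ 2 * (cmod (fst v $ i))\<^sup>2)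
        + (\<Sum>j\<in>UNIV. weight m j x * (cmod (snd v $ j))\<^sup>2)"
    by (simp add: model_form_def area_rotate)
  have nn1: "inverse (Im (fst x $ i)) ^ 2 * (cmod (fst v $ i))\<^sup>2 \<ge> 0" for i by simp
  have nn2: "weight m j x * (cmod (snd v $ j))\<^sup>2 \<ge> 0" for j using weight_pos[OF x, of m j] by simp
  have "(\<exists>i. fst v $ i \<noteq> 0) \<or> (\<exists>j. snd v $ j \<noteq> 0)"
    using \<open>v \<noteq> 0\<close> cspace_eqI[of v 0] by auto
  then show "model_form m x [v, Jmult v] > 0"
  proof
    assume "\<exists>i. fst v $ i \<noteq> 0"
    then obtain i where i: "fst v $ i \<noteq> 0" ..
    have "Im (fst x $ i) > 0" using x by (simp add: in_ot_domain)
    then have "(\<Sum>i\<in>UNIV. inverse (Im (fst x $ i)) ^ 2 * (cmod (fst v $ i))\<^sup>2) > 0"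
      using i nn1 by (intro sum_pos2[of _ i]) auto
    then show ?thesis unfolding eq using sum_nonneg[where A = UNIV, OF nn2] by (intro add_pos_nonneg) auto
  next
    assume "\<exists>j. snd v $ j \<noteq> 0"
    then obtain j where j: "snd v $ j \<noteq> 0" ..
    then have "(\<Sum>j\<in>UNIV. weight m j x * (cmod (snd v $ j))\<^sup>2) > 0"
      using nn2 weight_pos[OF x, of m j] by (intro sum_pos2[of _ j]) auto
    then show ?thesis unfolding eq using sum_nonneg[where A = UNIV, OF nn1] by (intro add_nonneg_pos) auto
  qed
qed

text \<open>
  The weights are affine, so only the first sum contributes.
\<close>

lemma second_derivative_model_form:
  assumes x: "x \<in> ot_domain"
  shows "dir_deriv v (dir_deriv w (\<lambda>z. model_form m z [a, b])) x
    = (\<Sum>i\<in>UNIV. 6 * inverse (Im (fst x $ i)) ^ 4 * (Im (fst v $ i) * Im (fst w $ i) * area (fst a $ i) (fst b $ i)))"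
proof -
  let ?c = "\<Sum>j\<in>UNIV. (case m j of None \<Rightarrow> 0 | Some i \<Rightarrow> Im (fst w $ i)) * area (snd a $ j) (snd b $ j)"
  let ?D = "\<lambda>y. (\<Sum>i\<in>UNIV. (- real 2 * Im (fst w $ i) * inverse (Im (fst y $ i)) ^ Suc 2) * area (fst a $ i) (fst b $ i)) + ?c"
  have first: "dir_deriv w (\<lambda>z. model_form m z [a, b]) y = ?D y" if y: "y \<in> ot_domain" for y
  proof (rule dir_deriv_eqI)
    show "((\<lambda>z. model_form m z [a, b]) has_derivative (\<lambda>w.
        (\<Sum>i\<in>UNIV. (- real 2 * Im (fst w $ i) * inverse (Im (fst y $ i)) ^ Suc 2) * area (fst a $ i) (fst b $ i))
        + (\<Sum>j\<in>UNIV. (case m j of None \<Rightarrow> 0 | Some i \<Rightarrow> Im (fst w $ i)) * area (snd a $ j) (snd b $ j)))) (at y)"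
      unfolding model_form_def nth_Cons_0 One_nat_def nth_Cons_Suc
      by (intro has_derivative_add has_derivative_sum has_derivative_mult_left
          has_derivative_inverse_power[OF y] has_derivative_weight)
  qed
  have "dir_deriv v (dir_deriv w (\<lambda>z. model_form m z [a, b])) x = dir_deriv v ?D x"
    by (rule dir_deriv_cong[OF open_ot_domain x first])
  also have "\<dots> = (\<Sum>i\<in>UNIV. (- real 2 * Im (fst w $ i) *
      (- real (Suc 2) * Im (fst v $ i) * inverse (Im (fst x $ i)) ^ Suc (Suc 2))) * area (fst a $ i) (fst b $ i)) + 0"
    by (rule dir_deriv_eqI)
       (intro has_derivative_add has_derivative_sum has_derivative_mult_left has_derivative_mult_right
          has_derivative_inverse_power[OF x] has_derivative_const)
  also have "\<dots> = (\<Sum>i\<in>UNIV. 6 * inverse (Im (fst x $ i)) ^ 4 * (Im (fst v $ i) * Im (fst w $ i) * area (fst a $ i) (fst b $ i)))"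
    unfolding add_0_right by (rule sum.cong) (simp_all add: eval_nat_numeral mult_ac)
  finally show ?thesis .
qed

lemma sum_list_sum_swap: "(\<Sum>p\<leftarrow>L. \<Sum>i\<in>I. f p i) = (\<Sum>i\<in>I. \<Sum>p\<leftarrow>L. f p i)"
  by (induction L) (simp_all add: sum.distrib)

text \<open>
  By the preceding formula \<open>d d\<^sup>c\<close> is a sum of forms each of which comes from a single complex
  coordinate. A \<open>4\<close>-form on the plane is zero; in terms of coordinates this is a polynomial identity.
\<close>

lemma ddc_model_form:
  assumes x: "x \<in> ot_domain"
  shows "ext_deriv (dc (model_form m)) x [v1, v2, v3, v4] = 0"
proof -
  let ?L = "ddc_terms v1 v2 v3 v4"
  let ?t = "\<lambda>(c, v, w, a, b) i. c * (Im (fst v $ i) * Re (fst w $ i) * area (fst a $ i) (fst b $ i))"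
  have zero: "(\<Sum>p\<leftarrow>?L. ?t p i) = 0" for i
    by (simp add: ddc_terms_def area_def) (simp add: algebra_simps)
  have "ext_deriv (dc (model_form m)) x [v1, v2, v3, v4]
      = (\<Sum>p\<leftarrow>?L. \<Sum>i\<in>UNIV. 6 * inverse (Im (fst x $ i)) ^ 4 * ?t p i)"
    unfolding ddc_expand[where \<omega> = "model_form m", OF open_ot_domain x smooth_model_form]
    by (intro arg_cong[where f = sum_list] map_cong refl)
       (auto simp: second_derivative_model_form[OF x] sum_distrib_left mult_ac)
  also have "\<dots> = (\<Sum>i\<in>UNIV. 6 * inverse (Im (fst x $ i)) ^ 4 * (\<Sum>p\<leftarrow>?L. ?t p i))"
    unfolding sum_list_sum_swap sum_list_const_mult ..
  also have "\<dots> = 0" by (simp only: zero mult_zero_right sum.neutral_const)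
  finally show ?thesis .
qed

lemma model_form_equivariant:
  assumes "\<And>i. \<sigma> i u > 0"
    and "\<And>j. case m j of None \<Rightarrow> cmod (\<tau> j u) = 1 | Some i \<Rightarrow> (cmod (\<tau> j u))\<^sup>2 * \<sigma> i u = 1"
  shows "model_form m (translation \<sigma> \<tau> a (rotation \<sigma> \<tau> u x)) [rotation \<sigma> \<tau> u v, rotation \<sigma> \<tau> u w]
    = model_form m x [v, w]"
proof -
  have 1: "inverse (Im (fst (translation \<sigma> \<tau> a (rotation \<sigma> \<tau> u x)) $ i)) ^ 2
      * ((cmod (of_real (\<sigma> i u)))\<^sup>2 * area p q) = inverse (Im (fst x $ i)) ^ 2 * area p q" for i p q
  proof -
    have "inverse (\<sigma> i u * Im (fst x $ i)) * \<sigma> i u = inverse (Im (fst x $ i))"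
      using assms(1)[of i] by (simp add: field_simps)
    then have "(inverse (\<sigma> i u * Im (fst x $ i)))\<^sup>2 * (\<sigma> i u)\<^sup>2 = (inverse (Im (fst x $ i)))\<^sup>2"
      by (metis power_mult_distrib)
    then show ?thesis by (simp add: translation_eq mult.assoc[symmetric])
  qed
  have 2: "weight m j (translation \<sigma> \<tau> a (rotation \<sigma> \<tau> u x)) * ((cmod (\<tau> j u))\<^sup>2 * area p q)
      = weight m j x * area p q" for j p q
    using assms(2)[of j] by (cases "m j") (auto simp: weight_def translation_eq mult_ac)
  show ?thesis
    unfolding model_form_def nth_Cons_0 One_nat_def nth_Cons_Suc rotation_nth area_mult 1 2 ..
qed

section \<open>Admissible groups of units\<close>

text \<open>
  A lattice of full rank spans the space.
\<close>

lemma lattice_orthogonal_zero: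
  fixes d :: "real^'n"
  assumes "lattice_of_rank CARD('n) L" and "\<And>l. l \<in> L \<Longrightarrow> inner d l = 0"
  shows "d = 0"
proof -
  obtain B :: "(real^'n) set" where B: "independent B" "card B = CARD('n)"
    "L = {\<Sum>b\<in>B. of_int (k b) *\<^sub>R b | k. True}"
    using assms(1) unfolding lattice_of_rank_def by blast
  have fin: "finite B" using independent_bound[OF B(1)] by simp
  have "inner d b = 0" if "b \<in> B" for b
  proof (rule assms(2))
    have "b = (\<Sum>b'\<in>B. of_int (if b' = b then 1 else 0) *\<^sub>R b')"
      using that fin by (simp add: if_distrib[of of_int] if_distrib[of "\<lambda>r. r *\<^sub>R _"] cong: if_cong)
    then show "b \<in> L"
      unfolding B(3) mem_Collect_eq by (intro exI conjI TrueI)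
  qed
  moreover have "span B = UNIV"
    using card_ge_dim_independent[of B UNIV] B(1,2) by auto
  ultimately have "inner d d = 0"
    using orthogonal_to_span[of d B d] by (simp add: Linear_Algebra.orthogonal_def)
  then show ?thesis by simp
qed

text \<open>
  The coordinates with respect to the basis extend to linear, hence bounded, functionals; so they are
  integers below \<open>1\<close> in absolute value for short vectors.
\<close>

lemma lattice_discrete:
  fixes L :: "'v::euclidean_space set"
  assumes "lattice_of_rank n L" "n > 0"
  obtains \<delta> where "\<delta> > 0" "\<And>l. l \<in> L \<Longrightarrow> norm l < \<delta> \<Longrightarrow> l = 0"
proof -
  obtain B :: "'v set" where B: "independent B" "card B = n"
    "L = {\<Sum>b\<in>B. of_int (k b) *\<^sub>R b | k. True}"
    using assms(1) unfolding lattice_of_rank_def by blast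
  have fin: "finite B" using independent_bound[OF B(1)] by simp
  have "\<exists>\<delta>>0. \<forall>k :: 'v \<Rightarrow> int. norm (\<Sum>b\<in>B. of_int (k b) *\<^sub>R b) < \<delta> \<longrightarrow> k a = 0" if a: "a \<in> B" for a
  proof -
    obtain f :: "'v \<Rightarrow> real" where f: "linear f" "\<And>b. b \<in> B \<Longrightarrow> f b = (if b = a then 1 else 0)"
      using linear_independent_extend[OF B(1), of "\<lambda>b. if b = a then 1 else 0"] by auto
    obtain C where C: "C > 0" "\<And>x. norm (f x) \<le> C * norm x"
      by (rule linear_bounded_pos[OF f(1)]) (rule that, assumption+)
    have "k a = 0" if small: "norm (\<Sum>b\<in>B. of_int (k b) *\<^sub>R b) < 1 / C" for k :: "'v \<Rightarrow> int"
    proof -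
      have "f (\<Sum>b\<in>B. of_int (k b) *\<^sub>R b) = (\<Sum>b\<in>B. if b = a then of_int (k b) else 0)"
        unfolding linear_sum[OF f(1)] by (rule sum.cong) (simp_all add: linear_scale[OF f(1)] f(2))
      also have "\<dots> = of_int (k a)" using fin a by simp
      finally have "\<bar>of_int (k a)\<bar> \<le> C * norm (\<Sum>b\<in>B. of_int (k b) *\<^sub>R b)"
        using C(2)[of "\<Sum>b\<in>B. of_int (k b) *\<^sub>R b"] by simp
      also have "\<dots> < 1" using small C(1) by (simp add: field_simps)
      finally show ?thesis by linarith
    qed
    then show ?thesis using C(1) by (intro exI[of _ "1 / C"]) auto
  qed
  then have "\<forall>a\<in>B. \<exists>\<delta>. \<delta> > 0 \<and> (\<forall>k :: 'v \<Rightarrow> int. norm (\<Sum>b\<in>B. of_int (k b) *\<^sub>R b) < \<delta> \<longrightarrow> k a = 0)"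
    by (intro ballI) simp
  from bchoice[OF this] obtain \<delta> where \<delta>0: "\<forall>a\<in>B. \<delta> a > 0
      \<and> (\<forall>k :: 'v \<Rightarrow> int. norm (\<Sum>b\<in>B. of_int (k b) *\<^sub>R b) < \<delta> a \<longrightarrow> k a = 0)" ..
  then have \<delta>: "\<And>a. a \<in> B \<Longrightarrow> \<delta> a > 0"
    "\<And>a (k :: 'v \<Rightarrow> int). a \<in> B \<Longrightarrow> norm (\<Sum>b\<in>B. of_int (k b) *\<^sub>R b) < \<delta> a \<Longrightarrow> k a = 0"
    by simp_all
  have ne: "B \<noteq> {}" using B(2) assms(2) by auto
  show ?thesis
  proof (rule that)
    show "Min (\<delta> ` B) > 0" using \<delta>(1) fin ne by simp
    fix l assume l: "l \<in> L" "norm l < Min (\<delta> ` B)"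
    then obtain k :: "'v \<Rightarrow> int" where k: "l = (\<Sum>b\<in>B. of_int (k b) *\<^sub>R b)" by (auto simp: B(3))
    have "k a = 0" if "a \<in> B" for a
    proof (rule \<delta>(2)[OF that])
      have "Min (\<delta> ` B) \<le> \<delta> a" using fin that by simp
      then show "norm (\<Sum>b\<in>B. of_int (k b) *\<^sub>R b) < \<delta> a" using l(2) k by simp
    qed
    then show "l = 0" unfolding k by simp
  qed
qed

locale ot_data = labelled_number_field \<sigma> \<tau>
  for \<sigma> :: "'r::finite \<Rightarrow> 'k::field_char_0 \<Rightarrow> real" and \<tau> :: "'c::finite \<Rightarrow> 'k \<Rightarrow> complex" +
  fixes U :: "'k set"
  assumes admissible: "admissible \<sigma> \<tau> U"
begin

abbreviation "proj \<equiv> ot_proj \<sigma> \<tau> U"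
abbreviation "rot \<equiv> rotation \<sigma> \<tau>"
abbreviation "pt \<equiv> lattice_point \<sigma> \<tau>"
abbreviation "O\<^sub>K \<equiv> ring_of_integers :: 'k set"

lemma U_units: "U \<subseteq> totally_positive_units \<sigma>"
  using admissible subgroup.subset[of U "totally_positive_unit_group \<sigma>"]
  by (simp add: admissible_def totally_positive_unit_group_def)

lemma U_integers: "u \<in> U \<Longrightarrow> u \<in> O\<^sub>K" and \<sigma>_pos: "u \<in> U \<Longrightarrow> \<sigma> i u > 0"
  using U_units by (auto simp: totally_positive_units_def)

lemma U_nonzero: "u \<in> U \<Longrightarrow> u \<noteq> 0"
  using U_units by (auto simp: totally_positive_units_def)

lemma U_one: "1 \<in> U"
  using admissible subgroup.one_closed[of U "totally_positive_unit_group \<sigma>"]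
  by (simp add: admissible_def totally_positive_unit_group_def)

lemma U_mult: "u \<in> U \<Longrightarrow> v \<in> U \<Longrightarrow> u * v \<in> U"
  using admissible subgroup.m_closed[of U "totally_positive_unit_group \<sigma>" u v]
  by (simp add: admissible_def totally_positive_unit_group_def)

lemma U_inverse:
  assumes u: "u \<in> U"
  shows "inverse u \<in> U"
proof -
  let ?G = "totally_positive_unit_group \<sigma>"
  have unit: "u \<in> totally_positive_units \<sigma>" using U_units u by blast
  then obtain v where v: "v \<in> O\<^sub>K" "u * v = 1" unfolding totally_positive_units_def by blast
  have "v = inverse u" using v(2) by (simp add: inverse_unique)
  have pos: "\<sigma> i v > 0" for i
  proof -
    have "\<sigma> i u * \<sigma> i v = \<sigma> i (u * v)" by (simp add: \<sigma>_simps(3))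
    then have "0 < \<sigma> i u * \<sigma> i v" by (simp add: v(2) \<sigma>_simps(1))
    then show ?thesis using \<sigma>_pos[OF u, of i] by (rule zero_less_mult_pos)
  qed
  have carrier: "v \<in> totally_positive_units \<sigma>"
    using v pos U_integers[OF u] unfolding totally_positive_units_def
    by (auto simp: mult.commute)
  have "m_inv ?G u = v"
    unfolding m_inv_def totally_positive_unit_group_def
  proof (simp, rule the_equality)
    show "v \<in> totally_positive_units \<sigma> \<and> u * v = 1 \<and> v * u = 1"
      using carrier v(2) by (simp add: mult.commute)
    show "y = v" if "y \<in> totally_positive_units \<sigma> \<and> u * y = 1 \<and> y * u = 1" for y
      using that \<open>v = inverse u\<close> inverse_unique by blast
  qed
  moreover have "m_inv ?G u \<in> U"
    using admissible subgroup.m_inv_closed[of U ?G u] u by (simp add: admissible_def)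
  ultimately show ?thesis using \<open>v = inverse u\<close> by simp
qed

lemma norm_U: "u \<in> U \<Longrightarrow> (\<Prod>i\<in>UNIV. \<sigma> i u) * (\<Prod>j\<in>UNIV. (cmod (\<tau> j u))\<^sup>2) = 1"
  using unit_norm_one U_units by blast

lemma \<tau>_nonzero: "u \<in> U \<Longrightarrow> \<tau> j u \<noteq> 0"
  using field_embedding_eq_0_iff[OF \<tau>_embedding] U_nonzero by simp

definition log_vector :: "'k \<Rightarrow> real^'r" where
  "log_vector u = (\<chi> i. ln (\<sigma> i u))"

lemma log_lattice: "lattice_of_rank CARD('r) (log_vector ` U)"
proof -
  have "fst ` log_embedding \<sigma> \<tau> ` U = log_vector ` U"
    by (simp add: image_image log_embedding_def log_vector_def)
  then show ?thesis using admissible by (simp add: admissible_def)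
qed

text \<open>
  If \<open>n\<^sub>i\<close> complex embeddings have the label \<open>i\<close>, the logarithm of the norm equation becomes
  \<open>\<Sum> (1 - n\<^sub>i) log \<sigma>\<^sub>i(u) = 0\<close>. So \<open>(1 - n\<^sub>i)\<^sub>i\<close> is orthogonal to a lattice of full rank.
\<close>

lemma each_real_embedding_compensated_once:
  fixes m :: "'c \<Rightarrow> 'r option"
  assumes m: "\<And>u j. u \<in> U \<Longrightarrow>
    case m j of None \<Rightarrow> cmod (\<tau> j u) = 1 | Some i \<Rightarrow> (cmod (\<tau> j u))\<^sup>2 * \<sigma> i u = 1"
  shows "card {j. m j = Some i} = 1"
proof -
  define n where "n = (\<lambda>i. card {j. m j = Some i})"
  define d :: "real^'r" where "d = (\<chi> i. 1 - real (n i))"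
  have "inner d l = 0" if l: "l \<in> log_vector ` U" for l
  proof -
    obtain u where u: "u \<in> U" "l = log_vector u" using l by blast
    have ln_tau: "ln ((cmod (\<tau> j u))\<^sup>2) = - (\<Sum>i\<in>UNIV. if m j = Some i then ln (\<sigma> i u) else 0)" for j
    proof (cases "m j")
      case None
      then show ?thesis using m[OF u(1), of j] by simp
    next
      case (Some i)
      then have "ln ((cmod (\<tau> j u))\<^sup>2 * \<sigma> i u) = 0" using m[OF u(1), of j] by simp
      then have "ln ((cmod (\<tau> j u))\<^sup>2) = - ln (\<sigma> i u)"
        using \<tau>_nonzero[OF u(1), of j] \<sigma>_pos[OF u(1), of i] by (simp add: ln_mult_pos)
      moreover have "(\<Sum>i\<in>UNIV. if m j = Some i then ln (\<sigma> i u) else 0) = ln (\<sigma> i u)"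
        using Some by (simp add: if_distrib cong: if_cong)
      ultimately show ?thesis by simp
    qed
    have nz: "\<sigma> i u \<noteq> 0" for i using \<sigma>_pos[OF u(1), of i] by simp
    have "0 = ln ((\<Prod>i\<in>UNIV. \<sigma> i u) * (\<Prod>j\<in>UNIV. (cmod (\<tau> j u))\<^sup>2))"
      using norm_U[OF u(1)] by simp
    also have "\<dots> = ln (\<Prod>i\<in>UNIV. \<sigma> i u) + ln (\<Prod>j\<in>UNIV. (cmod (\<tau> j u))\<^sup>2)"
      using \<sigma>_pos[OF u(1)] \<tau>_nonzero[OF u(1)] by (intro ln_mult_pos prod_pos) auto
    also have "ln (\<Prod>i\<in>UNIV. \<sigma> i u) = (\<Sum>i\<in>UNIV. ln (\<sigma> i u))"
      using nz by (intro ln_prod) auto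
    also have "ln (\<Prod>j\<in>UNIV. (cmod (\<tau> j u))\<^sup>2) = (\<Sum>j\<in>UNIV. ln ((cmod (\<tau> j u))\<^sup>2))"
      using \<tau>_nonzero[OF u(1)] by (intro ln_prod) auto
    also have "\<dots> = - (\<Sum>j\<in>UNIV. \<Sum>i\<in>UNIV. if m j = Some i then ln (\<sigma> i u) else 0)"
      unfolding ln_tau by (simp add: sum_negf)
    also have "\<dots> = - (\<Sum>i\<in>UNIV. real (n i) * ln (\<sigma> i u))"
      by (subst sum.swap) (simp add: n_def sum.If_cases)
    finally have "(\<Sum>i\<in>UNIV. ln (\<sigma> i u)) - (\<Sum>i\<in>UNIV. real (n i) * ln (\<sigma> i u)) = 0" by simp
    then show ?thesis
      by (simp add: u(2) d_def log_vector_def inner_vec_def left_diff_distrib sum_subtractf)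
  qed
  then have "d = 0" by (rule lattice_orthogonal_zero[OF log_lattice])
  then have "d $ i = 0" by simp
  then show ?thesis by (simp add: d_def n_def)
qed

text \<open>
  By the preceding lemma the labels that are not \<open>None\<close> define a bijection onto the real embeddings.
  Its inverse gives the first \<open>s\<close> complex embeddings, the unlabelled ones come afterwards.
\<close>

lemma relabelling_exists:
  fixes m :: "'c \<Rightarrow> 'r option"
  assumes m: "\<And>u j. u \<in> U \<Longrightarrow>
    case m j of None \<Rightarrow> cmod (\<tau> j u) = 1 | Some i \<Rightarrow> (cmod (\<tau> j u))\<^sup>2 * \<sigma> i u = 1"
  shows "CARD('r) \<le> CARD('c) \<and>
     (\<exists>p q. bij_betw p {1..CARD('r)} (UNIV :: 'r set) \<and> bij_betw q {1..CARD('c)} (UNIV :: 'c set) \<and>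
        (\<forall>u\<in>U. \<forall>i\<in>{1..CARD('r)}. (cmod (\<tau> (q i) u))\<^sup>2 * \<sigma> (p i) u = 1) \<and>
        (\<forall>u\<in>U. \<forall>i. CARD('r) < i \<and> i \<le> CARD('c) \<longrightarrow> cmod (\<tau> (q i) u) = 1))"
proof -
  let ?s = "CARD('r)" and ?t = "CARD('c)"
  have "\<forall>i. \<exists>j. {j. m j = Some i} = {j}"
    using each_real_embedding_compensated_once[OF m] by (auto simp: card_1_singleton_iff)
  from choice[OF this] obtain f where "\<forall>i. {j. m j = Some i} = {f i}" ..
  then have f: "m j = Some i \<longleftrightarrow> j = f i" for i j by blast
  have "inj f" using f by (metis injI option.inject)
  have st: "?s \<le> ?t" using card_inj_on_le[OF \<open>inj f\<close>, of UNIV] by simp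
  obtain p where p: "bij_betw p {1..?s} (UNIV :: 'r set)"
    using ex_bij_betw_nat_finite_1[of "UNIV :: 'r set"] by auto
  have "card {?s<..?t} = card (UNIV - range f)"
    using card_Diff_subset[of "range f" UNIV] card_image[OF \<open>inj f\<close>] by simp
  then obtain q' where q': "bij_betw q' {?s<..?t} (UNIV - range f)"
    using finite_same_card_bij[of "{?s<..?t}" "UNIV - range f"] by auto
  define q where "q = (\<lambda>i. if i \<in> {1..?s} then f (p i) else q' i)"
  have "bij_betw (f \<circ> p) {1..?s} (range f)"
    using p \<open>inj f\<close> by (intro bij_betw_trans[OF p]) (simp add: bij_betw_def)
  then have q1: "bij_betw q {1..?s} (range f)"
    by (rule bij_betw_cong[THEN iffD1, rotated]) (simp add: q_def)
  have q2: "bij_betw q {?s<..?t} (UNIV - range f)"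
    by (rule bij_betw_cong[THEN iffD1, OF _ q']) (simp add: q_def)
  have "{1..?s} \<union> {?s<..?t} = {1..?t}" using st by auto
  then have q: "bij_betw q {1..?t} UNIV"
    using bij_betw_combine[OF q1 q2] by simp
  have 1: "(cmod (\<tau> (q i) u))\<^sup>2 * \<sigma> (p i) u = 1" if "u \<in> U" "i \<in> {1..?s}" for u i
    using m[OF that(1), of "q i"] f[of "q i" "p i"] that(2) by (simp add: q_def)
  have 2: "cmod (\<tau> (q i) u) = 1" if "u \<in> U" "?s < i \<and> i \<le> ?t" for u i
  proof -
    have "q i \<notin> range f" using bij_betwE[OF q2] that(2) by auto
    then have "m (q i) = None" using f by (metis not_None_eq rangeI)
    then show ?thesis using m[OF that(1), of "q i"] by simp
  qed
  show ?thesis using st p q 1 2 by blast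
qed

lemma labels_from_relabelling:
  assumes p: "bij_betw p {1..CARD('r)} (UNIV :: 'r set)" and q: "bij_betw q {1..CARD('c)} (UNIV :: 'c set)"
    and 1: "\<forall>u\<in>U. \<forall>i\<in>{1..CARD('r)}. (cmod (\<tau> (q i) u))\<^sup>2 * \<sigma> (p i) u = 1"
    and 2: "\<forall>u\<in>U. \<forall>i. CARD('r) < i \<and> i \<le> CARD('c) \<longrightarrow> cmod (\<tau> (q i) u) = 1"
  obtains m :: "'c \<Rightarrow> 'r option" where "\<And>u j. u \<in> U \<Longrightarrow>
    case m j of None \<Rightarrow> cmod (\<tau> j u) = 1 | Some i \<Rightarrow> (cmod (\<tau> j u))\<^sup>2 * \<sigma> i u = 1"
proof -
  define idx where "idx = the_inv_into {1..CARD('c)} q"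
  have idx: "idx j \<in> {1..CARD('c)}" "q (idx j) = j" for j
  proof -
    have "j \<in> q ` {1..CARD('c)}" using q by (simp add: bij_betw_def)
    then show "idx j \<in> {1..CARD('c)}" "q (idx j) = j"
      unfolding idx_def using q the_inv_into_into[of q "{1..CARD('c)}" j "{1..CARD('c)}"] f_the_inv_into_f[of q "{1..CARD('c)}" j]
      by (auto simp: bij_betw_def)
  qed
  define m where "m = (\<lambda>j. if idx j \<le> CARD('r) then Some (p (idx j)) else None)"
  have "case m j of None \<Rightarrow> cmod (\<tau> j u) = 1 | Some i \<Rightarrow> (cmod (\<tau> j u))\<^sup>2 * \<sigma> i u = 1" if "u \<in> U" for u j
  proof (cases "idx j \<le> CARD('r)")
    case True
    then have "idx j \<in> {1..CARD('r)}" using idx(1)[of j] by simp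
    then show ?thesis using 1 that True idx(2)[of j] by (force simp: m_def)
  next
    case False
    then have "CARD('r) < idx j \<and> idx j \<le> CARD('c)" using idx(1)[of j] by simp
    then show ?thesis using 2 that False idx(2)[of j] by (force simp: m_def)
  qed
  then show ?thesis by (rule that)
qed

section \<open>Charts of the quotient\<close>

lemma rot_linear: "linear (rot u)" by (rule linear_rotation)

lemma rot_rot: "rot u (rot v x) = rot (u * v) x"
  by (rule cspace_eqI) (simp_all add: \<sigma>_simps(3) \<tau>_simps(3))

lemma rot_one: "rot 1 x = x"
  by (rule cspace_eqI) (simp_all add: \<sigma>_simps(1) \<tau>_simps(1))

lemma rot_pt: "rot u (pt a) = pt (u * a)"
  by (rule cspace_eqI) (simp_all add: \<sigma>_simps(3) \<tau>_simps(3))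

lemma pt_add: "pt (a + b) = pt a + pt b"
  by (rule cspace_eqI) (simp_all add: \<sigma>_simps(2) \<tau>_simps(2))

lemma pt_zero: "pt 0 = 0"
  by (rule cspace_eqI) (simp_all add: \<sigma>_simps(4) \<tau>_simps(4))

text \<open>
  The element \<open>(u, a)\<close> of the semidirect product of \<open>U\<close> and the ring of integers.
\<close>

definition act :: "'k \<Rightarrow> 'k \<Rightarrow> ('r, 'c) cspace \<Rightarrow> ('r, 'c) cspace" where
  "act u a x = rot u x + pt a"

lemma act_eq: "translation \<sigma> \<tau> a (rot u x) = act u a x"
  by (simp add: act_def translation_eq)

lemma act_act: "act v b (act u a x) = act (v * u) (v * a + b) x"
  by (simp add: act_def linear_add[OF rot_linear] rot_rot rot_pt pt_add add.assoc)

lemma act_one: "act 1 0 x = x"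
  by (simp add: act_def rot_one pt_zero)

lemma act_domain: "u \<in> U \<Longrightarrow> x \<in> ot_domain \<Longrightarrow> act u a x \<in> ot_domain"
  using \<sigma>_pos by (simp add: act_def in_ot_domain)

lemma act_inverse:
  assumes "u \<in> U"
  shows "act (inverse u) (- (inverse u * a)) (act u a x) = x"
  using U_nonzero[OF assms] by (simp add: act_act act_one)

lemma orbit_rel_iff:
  "(x, y) \<in> ot_orbit_rel \<sigma> \<tau> U \<longleftrightarrow> x \<in> ot_domain \<and> (\<exists>u\<in>U. \<exists>a\<in>O\<^sub>K. y = act u a x)"
  by (auto simp: ot_orbit_rel_def act_eq intro: act_domain)

lemma orbit_rel_refl: "x \<in> ot_domain \<Longrightarrow> (x, x) \<in> ot_orbit_rel \<sigma> \<tau> U"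
  unfolding orbit_rel_iff using U_one one_in_ring_of_integers(2) act_one[of x, symmetric] by blast

lemma orbit_rel_act:
  assumes u: "u \<in> U" and a: "a \<in> O\<^sub>K" and x: "x \<in> ot_domain"
  shows "(act u a x, y) \<in> ot_orbit_rel \<sigma> \<tau> U \<longleftrightarrow> (x, y) \<in> ot_orbit_rel \<sigma> \<tau> U"
proof
  assume "(act u a x, y) \<in> ot_orbit_rel \<sigma> \<tau> U"
  then obtain v b where vb: "v \<in> U" "b \<in> O\<^sub>K" "y = act v b (act u a x)" unfolding orbit_rel_iff by blast
  then have "y = act (v * u) (v * a + b) x" by (simp add: act_act)
  moreover have "v * u \<in> U" "v * a + b \<in> O\<^sub>K"
    using vb u a U_mult ring_of_integers_closed U_integers by simp_all
  ultimately show "(x, y) \<in> ot_orbit_rel \<sigma> \<tau> U" unfolding orbit_rel_iff using x by blast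
next
  assume "(x, y) \<in> ot_orbit_rel \<sigma> \<tau> U"
  then obtain v b where vb: "v \<in> U" "b \<in> O\<^sub>K" "y = act v b x" unfolding orbit_rel_iff by blast
  let ?w = "v * inverse u" and ?c = "v * (- (inverse u * a)) + b"
  have "y = act ?w ?c (act u a x)"
    using vb(3) act_act[of v b "inverse u" "- (inverse u * a)" "act u a x"] by (simp only: act_inverse[OF u])
  moreover have "?w \<in> U" by (intro U_mult U_inverse vb u)
  moreover have "?c \<in> O\<^sub>K" 
    by (intro ring_of_integers_closed(1,2) ring_of_integers_closed(3)[OF _ a] U_integers[OF vb(1)] U_integers[OF U_inverse[OF u]] vb(2) a)
  ultimately show "(act u a x, y) \<in> ot_orbit_rel \<sigma> \<tau> U"
    unfolding orbit_rel_iff using act_domain[OF u x] by blast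
qed

lemma proj_act:
  assumes "u \<in> U" "a \<in> O\<^sub>K" "x \<in> ot_domain"
  shows "proj (act u a x) = proj x"
  unfolding ot_proj_def using orbit_rel_act[OF assms] by blast

lemma proj_eqD:
  assumes "proj x = proj y" "x \<in> ot_domain" "y \<in> ot_domain"
  obtains u a where "u \<in> U" "a \<in> O\<^sub>K" "y = act u a x"
proof -
  have "y \<in> proj x" using orbit_rel_refl[OF assms(3)] assms(1) by (simp add: ot_proj_def)
  then have "\<exists>u\<in>U. \<exists>a\<in>O\<^sub>K. y = act u a x" by (simp add: ot_proj_def orbit_rel_iff)
  then show ?thesis using that by blast
qed

definition chart_domain :: "('r, 'c) cspace set \<Rightarrow> bool" where
  "chart_domain V \<longleftrightarrow> open V \<and> V \<subseteq> ot_domain \<and> inj_on proj V"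

definition chart_on :: "('r, 'c) cspace set \<Rightarrow> (('r, 'c) cspace set, ('r, 'c) cspace) chart" where
  "chart_on V = (proj ` V, inv_into V proj)"

lemma ot_atlas_eq: "ot_atlas \<sigma> \<tau> U = chart_on ` {V. chart_domain V}"
proof -
  have "proj ` V \<subseteq> ot_manifold \<sigma> \<tau> U" if "V \<subseteq> ot_domain" for V
    using that by (auto simp: ot_manifold_def ot_proj_def intro: quotientI)
  note sub = this
  show ?thesis
  proof (intro equalityI subsetI)
    fix c assume "c \<in> ot_atlas \<sigma> \<tau> U"
    then obtain P V where c: "c = (P, inv_into V proj)" and V: "open V" "V \<subseteq> ot_domain" "bij_betw proj V P"
      unfolding ot_atlas_def by blast
    then have "P = proj ` V" "inj_on proj V" by (simp_all add: bij_betw_def)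
    then have "c = chart_on V" "chart_domain V" using c V by (simp_all add: chart_on_def chart_domain_def)
    then show "c \<in> chart_on ` {V. chart_domain V}" by simp
  next
    fix c assume "c \<in> chart_on ` {V. chart_domain V}"
    then obtain V where V: "c = chart_on V" "chart_domain V" by blast
    then have "bij_betw proj V (proj ` V)" by (simp add: chart_domain_def bij_betw_def)
    then show "c \<in> ot_atlas \<sigma> \<tau> U"
      unfolding ot_atlas_def mem_Collect_eq V(1) chart_on_def
      using V(2) sub by (intro exI conjI) (auto simp: chart_domain_def)
  qed
qed

lemma chart_image: "chart_domain V \<Longrightarrow> inv_into V proj ` proj ` V = V"
  by (simp add: chart_domain_def inv_into_image_cancel)

lemma inv_into_chart:
  assumes V: "chart_domain V" and x: "x \<in> V"
  shows "inv_into (proj ` V) (inv_into V proj) x = proj x"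
proof -
  have inj: "inj_on proj V" using V by (simp add: chart_domain_def)
  have "inj_on (inv_into V proj) (proj ` V)" by (rule inj_on_inv_into) simp
  then have "inv_into (proj ` V) (inv_into V proj) (inv_into V proj (proj x)) = proj x"
    using x by (intro inv_into_f_f) auto
  then show ?thesis by (simp add: inv_into_f_f[OF inj x])
qed

lemma continuous_act: "continuous_on A (act u a)"
  unfolding act_def[abs_def]
  by (intro continuous_on_add continuous_on_const linear_continuous_on
      linear_conv_bounded_linear[THEN iffD1] rot_linear)

lemma act_has_derivative: "(act u a has_derivative rot u) (at x)"
proof -
  have "bounded_linear (rot u)" by (rule linear_conv_bounded_linear[THEN iffD1, OF rot_linear])
  then have "(rot u has_derivative rot u) (at x)" by (rule bounded_linear_imp_has_derivative)
  from has_derivative_add[OF this has_derivative_const[of "pt a"]] show ?thesis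
    by (simp add: act_def[abs_def])
qed

text \<open>
  Near a point \<open>x\<close> with \<open>act u a x \<in> V'\<close> the coordinate change is \<open>act u a\<close> itself, because \<open>act u a\<close> maps
  nearby points into the open set \<open>V'\<close>, where \<open>proj\<close> is injective.
\<close>

lemma coordinate_change:
  assumes V: "chart_domain V" and V': "chart_domain V'" and u: "u \<in> U" and a: "a \<in> O\<^sub>K"
    and x: "x \<in> V" and x': "act u a x \<in> V'"
  defines "f \<equiv> inv_into V' proj \<circ> inv_into (proj ` V) (inv_into V proj)"
  shows "f x = act u a x" and "frechet_derivative f (at x) = rot u"
proof -
  have eq: "f y = act u a y" if "y \<in> V" "act u a y \<in> V'" for y
  proof -
    have "proj y = proj (act u a y)"
      using V that(1) by (intro proj_act[symmetric] u a) (auto simp: chart_domain_def)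
    then have "f y = inv_into V' proj (proj (act u a y))"
      by (simp add: f_def inv_into_chart[OF V that(1)])
    also have "\<dots> = act u a y"
      using V' that(2) by (intro inv_into_f_f) (auto simp: chart_domain_def)
    finally show ?thesis .
  qed
  show "f x = act u a x" by (rule eq[OF x x'])
  have op: "open (V \<inter> act u a -` V')"
    using V V' by (intro open_Int open_vimage continuous_act) (auto simp: chart_domain_def)
  have "(f has_derivative rot u) (at x)"
    by (rule has_derivative_transform_within_open[OF act_has_derivative op]) (use x x' eq in auto)
  then show "frechet_derivative f (at x) = rot u" by (rule frechet_derivative_at[symmetric])
qed

text \<open>
  Two points have the same image in the quotient iff some \<open>act u a\<close> maps one to the other. So, by
  \<open>coordinate_change\<close>, compatibility of the local representations is equivariance.
\<close>

lemma hermitian_metric_iff: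
  "hermitian_metric (ot_atlas \<sigma> \<tau> U) \<Omega> \<longleftrightarrow>
     (\<forall>V. chart_domain V \<longrightarrow> hermitian_form_on V (\<Omega> (chart_on V))) \<and>
     (\<forall>V V' x u a v w. chart_domain V \<longrightarrow> chart_domain V' \<longrightarrow> u \<in> U \<longrightarrow> a \<in> O\<^sub>K \<longrightarrow> x \<in> V \<longrightarrow> act u a x \<in> V'
        \<longrightarrow> \<Omega> (chart_on V) x [v, w] = \<Omega> (chart_on V') (act u a x) [rot u v, rot u w])"
  (is "_ \<longleftrightarrow> ?H \<and> ?T")
proof -
  have img: "x \<in> inv_into V proj ` (proj ` V \<inter> proj ` V') \<longleftrightarrow> (\<exists>u\<in>U. \<exists>a\<in>O\<^sub>K. x \<in> V \<and> act u a x \<in> V')"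
    if V: "chart_domain V" and V': "chart_domain V'" for V V' x
  proof
    have inj: "inj_on proj V" using V by (simp add: chart_domain_def)
    assume "x \<in> inv_into V proj ` (proj ` V \<inter> proj ` V')"
    then obtain y z where yz: "y \<in> V" "z \<in> V'" "proj y = proj z" "x = inv_into V proj (proj y)" by auto
    have "x = y" unfolding yz(4) by (rule inv_into_f_f[OF inj yz(1)])
    obtain u a where ua: "u \<in> U" "a \<in> O\<^sub>K" "z = act u a y"
    proof (rule proj_eqD[OF yz(3)])
      show "y \<in> ot_domain" "z \<in> ot_domain" using yz(1,2) V V' by (auto simp: chart_domain_def)
    qed
    then show "\<exists>u\<in>U. \<exists>a\<in>O\<^sub>K. x \<in> V \<and> act u a x \<in> V'" 
      unfolding \<open>x = y\<close> using ua yz(1,2) by auto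
  next
    have inj: "inj_on proj V" using V by (simp add: chart_domain_def)
    assume "\<exists>u\<in>U. \<exists>a\<in>O\<^sub>K. x \<in> V \<and> act u a x \<in> V'"
    then obtain u a where ua: "u \<in> U" "a \<in> O\<^sub>K" "x \<in> V" "act u a x \<in> V'" by blast
    then have "proj x = proj (act u a x)"
      using V by (intro proj_act[symmetric]) (auto simp: chart_domain_def)
    then have "proj x \<in> proj ` V \<inter> proj ` V'" using ua by auto
    then show "x \<in> inv_into V proj ` (proj ` V \<inter> proj ` V')"
      using inv_into_f_f[OF inj ua(3)] by (intro image_eqI[where x = "proj x"]) simp_all
  qed
  have herm: "(\<forall>(P, \<phi>)\<in>ot_atlas \<sigma> \<tau> U. hermitian_form_on (\<phi> ` P) (\<Omega> (P, \<phi>))) \<longleftrightarrow> ?H"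
    unfolding ot_atlas_eq ball_simps(9) chart_on_def prod.case
    by (simp only: Ball_def mem_Collect_eq chart_image cong: imp_cong)
  have trans: "(\<forall>(P, \<phi>)\<in>ot_atlas \<sigma> \<tau> U. \<forall>(Q, \<psi>)\<in>ot_atlas \<sigma> \<tau> U. \<forall>x\<in>\<phi> ` (P \<inter> Q). \<forall>v w.
        (let f = \<psi> \<circ> inv_into P \<phi>; Df = frechet_derivative f (at x)
         in \<Omega> (P, \<phi>) x [v, w] = \<Omega> (Q, \<psi>) (f x) [Df v, Df w])) \<longleftrightarrow> ?T"
    (is "?L \<longleftrightarrow> _")
  proof -
    let ?F = "\<lambda>V V'. inv_into V' proj \<circ> inv_into (proj ` V) (inv_into V proj)"
    have "?L \<longleftrightarrow> (\<forall>V. chart_domain V \<longrightarrow> (\<forall>V'. chart_domain V' \<longrightarrow>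
        (\<forall>x\<in>inv_into V proj ` (proj ` V \<inter> proj ` V'). \<forall>v w. \<Omega> (chart_on V) x [v, w]
          = \<Omega> (chart_on V') (?F V V' x) [frechet_derivative (?F V V') (at x) v, frechet_derivative (?F V V') (at x) w])))"
      unfolding ot_atlas_eq ball_simps(9) chart_on_def prod.case Let_def
      by (simp only: Ball_def mem_Collect_eq)
    also have "\<dots> \<longleftrightarrow> ?T"
    proof
      assume L: "\<forall>V. chart_domain V \<longrightarrow> (\<forall>V'. chart_domain V' \<longrightarrow>
        (\<forall>x\<in>inv_into V proj ` (proj ` V \<inter> proj ` V'). \<forall>v w. \<Omega> (chart_on V) x [v, w]
          = \<Omega> (chart_on V') (?F V V' x) [frechet_derivative (?F V V') (at x) v, frechet_derivative (?F V V') (at x) w]))"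
      show ?T
      proof (intro allI impI)
        fix V V' x u a v w
        assume A: "chart_domain V" "chart_domain V'" "u \<in> U" "a \<in> O\<^sub>K" "x \<in> V" "act u a x \<in> V'"
        have "x \<in> inv_into V proj ` (proj ` V \<inter> proj ` V')"
          unfolding img[OF A(1,2)] using A(3-6) by blast
        from L[rule_format, OF A(1,2) this, of v w]
        show "\<Omega> (chart_on V) x [v, w] = \<Omega> (chart_on V') (act u a x) [rot u v, rot u w]"
          unfolding coordinate_change[OF A] .
      qed
    next
      assume T: ?T
      show "\<forall>V. chart_domain V \<longrightarrow> (\<forall>V'. chart_domain V' \<longrightarrow>
        (\<forall>x\<in>inv_into V proj ` (proj ` V \<inter> proj ` V'). \<forall>v w. \<Omega> (chart_on V) x [v, w]
          = \<Omega> (chart_on V') (?F V V' x) [frechet_derivative (?F V V') (at x) v, frechet_derivative (?F V V') (at x) w]))"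
      proof (intro allI impI ballI)
        fix V V' x v w
        assume V: "chart_domain V" "chart_domain V'" and x: "x \<in> inv_into V proj ` (proj ` V \<inter> proj ` V')"
        obtain u a where A: "u \<in> U" "a \<in> O\<^sub>K" "x \<in> V" "act u a x \<in> V'"
          using x unfolding img[OF V] by blast
        show "\<Omega> (chart_on V) x [v, w] = \<Omega> (chart_on V') (?F V V' x)
            [frechet_derivative (?F V V') (at x) v, frechet_derivative (?F V V') (at x) w]"
          unfolding coordinate_change[OF V A] by (rule T[rule_format, OF V A])
      qed
    qed
    finally show ?thesis .
  qed
  show ?thesis unfolding hermitian_metric_def herm trans ..
qed

lemma pluriclosed_iff:
  "pluriclosed (ot_atlas \<sigma> \<tau> U) \<Omega> \<longleftrightarrow>
     (\<forall>V. chart_domain V \<longrightarrow> (\<forall>x\<in>V. \<forall>vs. length vs = 4 \<longrightarrow> ext_deriv (dc (\<Omega> (chart_on V))) x vs = 0))"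
proof -
  have "pluriclosed (ot_atlas \<sigma> \<tau> U) \<Omega> \<longleftrightarrow> (\<forall>V. chart_domain V \<longrightarrow>
      (\<forall>x\<in>inv_into V proj ` proj ` V. \<forall>vs. length vs = 4 \<longrightarrow> ext_deriv (dc (\<Omega> (chart_on V))) x vs = 0))"
    unfolding pluriclosed_def ot_atlas_eq by (simp add: chart_on_def)
  then show ?thesis using chart_image by simp
qed

section \<open>Model metrics on the quotient\<close>

text \<open>
  The model form is equivariant, so it can serve as the representation in every chart.
\<close>

theorem pluriclosed_metric_if_relabelling:
  fixes m :: "'c \<Rightarrow> 'r option"
  assumes m: "\<And>u j. u \<in> U \<Longrightarrow>
    case m j of None \<Rightarrow> cmod (\<tau> j u) = 1 | Some i \<Rightarrow> (cmod (\<tau> j u))\<^sup>2 * \<sigma> i u = 1"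
  shows "\<exists>\<Omega>. hermitian_metric (ot_atlas \<sigma> \<tau> U) \<Omega> \<and> pluriclosed (ot_atlas \<sigma> \<tau> U) \<Omega>"
proof (intro exI conjI)
  let ?\<Omega> = "\<lambda>c :: (('r, 'c) cspace set, ('r, 'c) cspace) chart. model_form m"
  show "hermitian_metric (ot_atlas \<sigma> \<tau> U) ?\<Omega>"
    unfolding hermitian_metric_iff
  proof (intro conjI allI impI)
    show "hermitian_form_on V (model_form m)" if "chart_domain V" for V
      by (rule hermitian_form_on_subset[OF hermitian_model_form])
         (use that in \<open>simp add: chart_domain_def\<close>)
    show "model_form m x [v, w] = model_form m (act u a x) [rot u v, rot u w]" if "u \<in> U" for u a x v w
      using model_form_equivariant[where \<sigma> = \<sigma> and \<tau> = \<tau> and m = m and u = u, OF \<sigma>_pos[OF that] m[OF that]]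
      by (simp add: act_eq)
  qed
  show "pluriclosed (ot_atlas \<sigma> \<tau> U) ?\<Omega>"
    unfolding pluriclosed_iff length_4_eq
  proof (intro allI impI ballI, elim exE)
    fix V x v1 v2 v3 v4 and vs :: "('r, 'c) cspace list"
    assume "chart_domain V" "x \<in> V" and vs: "vs = [v1, v2, v3, v4]"
    then have "x \<in> ot_domain" by (auto simp: chart_domain_def)
    then show "ext_deriv (dc (model_form m)) x vs = 0"
      unfolding vs by (rule ddc_model_form)
  qed
qed

section \<open>From a pluriclosed metric to labels\<close>

text \<open>
  Discreteness of the lattice of logarithms makes all \<open>\<sigma>\<^sub>i(u)\<close> equal to \<open>1\<close>, and field embeddings are
  injective.
\<close>

lemma unit_one_if_log_small: "\<exists>\<delta>>0. \<forall>u\<in>U. (\<forall>i. \<bar>ln (\<sigma> i u)\<bar> < \<delta>) \<longrightarrow> u = 1"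
proof -
  have pos: "0 < CARD('r)" by simp
  obtain \<delta> where \<delta>: "\<delta> > 0" "\<And>l. l \<in> log_vector ` U \<Longrightarrow> norm l < \<delta> \<Longrightarrow> l = 0"
    by (rule lattice_discrete[OF log_lattice pos]) (rule that, assumption+)
  show ?thesis
  proof (intro exI[of _ "\<delta> / CARD('r)"] conjI ballI impI)
    show "\<delta> / CARD('r) > 0" using \<delta>(1) by simp
    fix u assume u: "u \<in> U" and small: "\<forall>i. \<bar>ln (\<sigma> i u)\<bar> < \<delta> / CARD('r)"
    have "norm (log_vector u) \<le> (\<Sum>i\<in>UNIV. \<bar>log_vector u $ i\<bar>)" by (rule norm_le_l1_cart)
    also have "\<dots> < (\<Sum>i\<in>(UNIV :: 'r set). \<delta> / CARD('r))"
      using small by (intro sum_strict_mono) (simp_all add: log_vector_def)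
    also have "\<dots> = \<delta>" by simp
    finally have "log_vector u = 0" using \<delta>(2) u by blast
    then have "log_vector u $ i = 0" for i by simp
    moreover obtain i :: 'r where True by simp
    ultimately have "ln (\<sigma> i u) = 0" by (simp add: log_vector_def)
    then have "\<sigma> i u = \<sigma> i 1"
      using ln_eq_zero_iff[OF \<sigma>_pos[OF u, of i]] by (simp add: \<sigma>_simps(1))
    then show "u = 1" using field_embedding_inject[OF \<sigma>_embedding] by blast
  qed
qed

lemma continuous_on_Im_component:
  "continuous_on A (\<lambda>y :: ('r, 'c) cspace. Im (fst y $ i))"
  by (rule has_derivative_continuous_on[OF has_derivative_Im_component])

text \<open>
  If \<open>z = act u a y\<close> with \<open>y\<close> and \<open>z\<close> close to \<open>x\<close>, the quotients \<open>\<sigma>\<^sub>i(u)\<close> of their imaginary parts are close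
  to \<open>1\<close>; so \<open>u = 1\<close>. Then \<open>a\<close> is small in all embeddings; so \<open>a = 0\<close>.
\<close>

lemma chart_domain_exists:
  assumes x: "x \<in> ot_domain"
  obtains V where "chart_domain V" "x \<in> V"
proof -
  obtain \<delta> where \<delta>: "\<delta> > 0" "\<forall>u\<in>U. (\<forall>i. \<bar>ln (\<sigma> i u)\<bar> < \<delta>) \<longrightarrow> u = 1"
    using unit_one_if_log_small by blast
  \<comment> \<open>so that logarithms of imaginary parts differ by less than \<open>\<delta> / 2\<close> from those of \<open>x\<close>\<close>
  define N where "N = (\<Inter>i. {y :: ('r, 'c) cspace. Im (fst x $ i) * exp (- (\<delta> / 2)) < Im (fst y $ i)}
      \<inter> {y. Im (fst y $ i) < Im (fst x $ i) * exp (\<delta> / 2)})"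
  define V where "V = ot_domain \<inter> N \<inter> ball x (1 / 2)"
  have "open N"
    unfolding N_def
    by (intro open_INT ballI open_Int open_Collect_less continuous_on_const
        continuous_on_Im_component finite)
  then have "open V" unfolding V_def by (intro open_Int open_ot_domain open_ball)
  have "x \<in> N" using x \<delta>(1) by (auto simp: N_def in_ot_domain)
  then have "x \<in> V" using x by (simp add: V_def)
  have "inj_on proj V"
  proof (rule inj_onI)
    fix y z assume y: "y \<in> V" and z: "z \<in> V" and eq: "proj y = proj z"
    have dom: "y \<in> ot_domain" "z \<in> ot_domain" using y z by (simp_all add: V_def)
    obtain u a where ua: "u \<in> U" "a \<in> O\<^sub>K" "z = act u a y"
      by (rule proj_eqD[OF eq dom]) (rule that, assumption+)
    have bounds: "\<bar>ln (Im (fst p $ i)) - ln (Im (fst x $ i))\<bar> < \<delta> / 2" if p: "p \<in> V" for p i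
    proof -
      have xi: "Im (fst x $ i) > 0" and pi: "Im (fst p $ i) > 0"
        using x p by (simp_all add: V_def in_ot_domain)
      have "Im (fst x $ i) * exp (- (\<delta> / 2)) < Im (fst p $ i)" "Im (fst p $ i) < Im (fst x $ i) * exp (\<delta> / 2)"
        using p by (auto simp: V_def N_def)
      then have "ln (Im (fst x $ i) * exp (- (\<delta> / 2))) < ln (Im (fst p $ i))"
        "ln (Im (fst p $ i)) < ln (Im (fst x $ i) * exp (\<delta> / 2))"
        using xi pi by simp_all
      moreover have "ln (Im (fst x $ i) * exp (- (\<delta> / 2))) = ln (Im (fst x $ i)) - \<delta> / 2"
        "ln (Im (fst x $ i) * exp (\<delta> / 2)) = ln (Im (fst x $ i)) + \<delta> / 2"
        using xi by (simp_all add: ln_mult_pos)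
      ultimately show ?thesis by linarith
    qed
    have "\<bar>ln (\<sigma> i u)\<bar> < \<delta>" for i
    proof -
      have yi: "Im (fst y $ i) > 0" using dom(1) by (simp add: in_ot_domain)
      have "ln (Im (fst z $ i)) = ln (\<sigma> i u * Im (fst y $ i))" by (simp add: ua(3) act_def)
      also have "\<dots> = ln (\<sigma> i u) + ln (Im (fst y $ i))"
        using \<sigma>_pos[OF ua(1), of i] yi by (simp add: ln_mult_pos)
      finally show ?thesis using bounds[OF y, of i] bounds[OF z, of i] by linarith
    qed
    then have "u = 1" using \<delta>(2) ua(1) by simp
    then have "z = y + pt a" by (simp add: ua(3) act_def rot_one)
    moreover have "norm (z - y) < 1"
    proof -
      have "dist x y < 1 / 2" "dist x z < 1 / 2" using y z by (simp_all add: V_def)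
      then have "dist z y < 1" using dist_triangle_half_r[of x z 1 y] by simp
      then show ?thesis by (simp add: dist_norm)
    qed
    ultimately have small: "norm (pt a) < 1" by simp
    have "\<bar>\<sigma> i a\<bar> < 1" for i
    proof -
      have "\<bar>\<sigma> i a\<bar> = norm (fst (pt a) $ i)" by simp
      also have "\<dots> \<le> norm (fst (pt a))" by (rule Finite_Cartesian_Product.norm_nth_le)
      also have "\<dots> \<le> norm (pt a)" by (rule norm_fst_le[of "fst (pt a)" "snd (pt a)", unfolded prod.collapse])
      finally show ?thesis using small by simp
    qed
    moreover have "cmod (\<tau> j a) < 1" for j
    proof -
      have "cmod (\<tau> j a) = norm (snd (pt a) $ j)" by simp
      also have "\<dots> \<le> norm (snd (pt a))" by (rule Finite_Cartesian_Product.norm_nth_le)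
      also have "\<dots> \<le> norm (pt a)" by (rule norm_snd_le[of "snd (pt a)" "fst (pt a)", unfolded prod.collapse])
      finally show ?thesis using small by simp
    qed
    ultimately have "a = 0" by (rule integer_zero_if_small[OF ua(2)])
    then show "y = z" using \<open>z = y + pt a\<close> by (simp add: pt_zero)
  qed
  moreover have "V \<subseteq> ot_domain" by (auto simp: V_def)
  ultimately have "chart_domain V" using \<open>open V\<close> by (simp add: chart_domain_def)
  then show ?thesis using \<open>x \<in> V\<close> by (rule that)
qed

text \<open>
  At a point take the representation in any chart domain around it; the choice does not matter, as
  the coordinate change between two such charts is the identity near the point.
\<close>

lemma invariant_form_on_ot_domain:
  assumes herm: "hermitian_metric (ot_atlas \<sigma> \<tau> U) \<Omega>" and pluri: "pluriclosed (ot_atlas \<sigma> \<tau> U) \<Omega>"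
  obtains \<omega> :: "('r, 'c) cspace form" where "hermitian_form_on ot_domain \<omega>"
    "\<And>x vs. x \<in> ot_domain \<Longrightarrow> length vs = 4 \<Longrightarrow> ext_deriv (dc \<omega>) x vs = 0"
    "\<And>u a x v w. u \<in> U \<Longrightarrow> a \<in> O\<^sub>K \<Longrightarrow> x \<in> ot_domain \<Longrightarrow> \<omega> (act u a x) [rot u v, rot u w] = \<omega> x [v, w]"
proof -
  have H: "hermitian_form_on V (\<Omega> (chart_on V))" if "chart_domain V" for V
    by (rule herm[unfolded hermitian_metric_iff, THEN conjunct1, rule_format, OF that])
  have T: "\<Omega> (chart_on V) x [v, w] = \<Omega> (chart_on V') (act u a x) [rot u v, rot u w]"
    if "chart_domain V" "chart_domain V'" "u \<in> U" "a \<in> O\<^sub>K" "x \<in> V" "act u a x \<in> V'" for V V' x u a v w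
    by (rule herm[unfolded hermitian_metric_iff, THEN conjunct2, rule_format, OF that])
  define nbhd where "nbhd = (\<lambda>x. SOME V. chart_domain V \<and> x \<in> V)"
  have nbhd: "chart_domain (nbhd x)" "x \<in> nbhd x" if x: "x \<in> ot_domain" for x
  proof -
    obtain V where "chart_domain V" "x \<in> V" by (rule chart_domain_exists[OF x]) (rule that, assumption+)
    then have "chart_domain V \<and> x \<in> V" ..
    then have "chart_domain (nbhd x) \<and> x \<in> nbhd x" unfolding nbhd_def by (rule someI)
    then show "chart_domain (nbhd x)" "x \<in> nbhd x" by simp_all
  qed
  define \<omega> where "\<omega> = (\<lambda>x. \<Omega> (chart_on (nbhd x)) x)"
  have \<omega>: "\<Omega> (chart_on V) x [v, w] = \<omega> x [v, w]" if V: "chart_domain V" and x: "x \<in> V" for V x v w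
  proof -
    have dom: "x \<in> ot_domain" using V x by (auto simp: chart_domain_def)
    have "act 1 0 x \<in> nbhd x" using nbhd(2)[OF dom] by (simp add: act_one)
    from T[OF V nbhd(1)[OF dom] U_one one_in_ring_of_integers(2) x this, of v w]
    show ?thesis by (simp add: act_one rot_one \<omega>_def)
  qed
  have smooth: "smooth_fun_on (\<lambda>x. \<omega> x [v, w]) V" if V: "chart_domain V" for V v w
  proof (rule smooth_fun_on_cong)
    show "open V" using V by (simp add: chart_domain_def)
    show "\<Omega> (chart_on V) x [v, w] = \<omega> x [v, w]" if "x \<in> V" for x by (rule \<omega>[OF V that])
    show "smooth_fun_on (\<lambda>x. \<Omega> (chart_on V) x [v, w]) V" by (rule hermitian_form_onD(1)[OF H[OF V]])
  qed
  show ?thesis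
  proof (rule that)
    show "hermitian_form_on ot_domain \<omega>"
      unfolding hermitian_form_on_def
    proof (rule conjI; intro ballI allI)
      fix v w
      show "smooth_fun_on (\<lambda>x. \<omega> x [v, w]) ot_domain"
      proof (rule smooth_fun_on_local)
        fix x :: "('r, 'c) cspace" assume x: "x \<in> ot_domain"
        have "open (nbhd x)" using nbhd(1)[OF x] by (simp add: chart_domain_def)
        then show "\<exists>V. open V \<and> x \<in> V \<and> smooth_fun_on (\<lambda>x. \<omega> x [v, w]) V"
          using nbhd[OF x] smooth by blast
      qed
    next
      fix x :: "('r, 'c) cspace" assume x: "x \<in> ot_domain"
      show "bilinear (\<lambda>v w. \<omega> x [v, w]) \<and> (\<forall>v. \<omega> x [v, v] = 0) \<and>
        (\<forall>v w. \<omega> x [Jmult v, Jmult w] = \<omega> x [v, w]) \<and> (\<forall>v. v \<noteq> 0 \<longrightarrow> \<omega> x [v, Jmult v] > 0)"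
        unfolding \<omega>_def using hermitian_form_onD(2-5)[OF H[OF nbhd(1)[OF x]] nbhd(2)[OF x]]
        by (intro conjI allI impI)
    qed
    show "ext_deriv (dc \<omega>) x vs = 0" if x: "x \<in> ot_domain" and len: "length vs = 4" for x vs
    proof -
      have op: "open (nbhd x)" using nbhd(1)[OF x] by (simp add: chart_domain_def)
      have "ext_deriv (dc \<omega>) x vs = ext_deriv (dc (\<Omega> (chart_on (nbhd x)))) x vs"
        by (rule ext_deriv_dc_cong[where \<omega> = \<omega> and \<omega>' = "\<Omega> (chart_on (nbhd x))", OF op nbhd(2)[OF x] smooth[OF nbhd(1)[OF x]] \<omega>[OF nbhd(1)[OF x], symmetric] len])
      also have "\<dots> = 0"
        by (rule pluri[unfolded pluriclosed_iff, rule_format, OF nbhd[OF x] len])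
      finally show ?thesis .
    qed
    show "\<omega> (act u a x) [rot u v, rot u w] = \<omega> x [v, w]"
      if "u \<in> U" "a \<in> O\<^sub>K" "x \<in> ot_domain" for u a x v w
      using T[OF nbhd(1)[OF that(3)] nbhd(1)[OF act_domain[OF that(1,3)]] that(1,2) nbhd(2)[OF that(3)]
          nbhd(2)[OF act_domain[OF that(1,3)]], of v w] by (simp add: \<omega>_def)
  qed
qed

lemma rot_real_directions:
  assumes "u \<in> U"
  shows "rot u ` real_directions = real_directions"
proof
  show "rot u ` real_directions \<subseteq> real_directions" by (rule linear_rotation_image_real_directions)
  show "real_directions \<subseteq> rot u ` real_directions"
  proof
    fix v :: "('r, 'c) cspace" assume "v \<in> real_directions"
    then have "rot (inverse u) v \<in> real_directions"
      using linear_rotation_image_real_directions[of \<sigma> \<tau> "inverse u"] by blast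
    moreover have "v = rot u (rot (inverse u) v)"
      using U_nonzero[OF assms] by (simp add: rot_rot rot_one)
    ultimately show "v \<in> rot u ` real_directions" by (rule rev_image_eqI)
  qed
qed

lemma lattice_basis_exists:
  obtains bs where "set bs \<subseteq> pt ` O\<^sub>K" "span (set bs) = real_directions"
proof -
  obtain B where B: "B \<subseteq> pt ` O\<^sub>K" "independent B" "pt ` O\<^sub>K \<subseteq> span B"
    using maximal_independent_subset[of "pt ` O\<^sub>K"] by auto
  have fin: "finite B" using independent_bound[OF B(2)] by simp
  obtain bs where bs: "set bs = B" using finite_list[OF fin] ..
  have "span B = span (pt ` O\<^sub>K)"
    using span_minimal[OF B(3) subspace_span] span_mono[OF B(1)] by auto
  then show ?thesis using that[of bs] B(1) bs by (simp add: span_ring_of_integers)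
qed

text \<open>
  The function \<open>f\<close> is the coefficient of \<open>\<omega>\<close> in the direction of the coordinate \<open>z\<^sub>j\<close>, and \<open>g\<close> is its average. The
  latter is affine in the imaginary parts and inherits the semi-invariance of \<open>f\<close> under \<open>U\<close>, because
  the average does not depend on the lattice basis.
\<close>

theorem alternative_for_complex_embedding:
  fixes j :: 'c
  assumes herm: "hermitian_form_on ot_domain \<omega>"
    and ddc: "\<And>x vs. x \<in> ot_domain \<Longrightarrow> length vs = 4 \<Longrightarrow> ext_deriv (dc \<omega>) x vs = 0"
    and inv: "\<And>u a x v w. u \<in> U \<Longrightarrow> a \<in> O\<^sub>K \<Longrightarrow> x \<in> ot_domain \<Longrightarrow> \<omega> (act u a x) [rot u v, rot u w] = \<omega> x [v, w]"
  shows "\<exists>k. \<forall>u\<in>U. case k of None \<Rightarrow> cmod (\<tau> j u) = 1 | Some i \<Rightarrow> (cmod (\<tau> j u))\<^sup>2 * \<sigma> i u = 1"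
proof -
  define e :: "('r, 'c) cspace" where "e = (0, axis j 1)"
  have e: "e \<in> real_directions" "Jmult e \<in> real_directions" by (simp_all add: e_def real_directions_def)
  have smooth: "smooth_fun_on (\<lambda>x. \<omega> x [v, w]) ot_domain" for v w
    by (rule hermitian_form_onD(1)[OF herm])
  define f where "f = (\<lambda>x. \<omega> x [e, Jmult e])"
  have f_smooth: "smooth_fun_on f ot_domain" unfolding f_def by (rule smooth)
  have "e \<noteq> 0" by (simp add: e_def zero_prod_def axis_eq_0_iff)
  then have f_pos: "f x > 0" if "x \<in> ot_domain" for x
    unfolding f_def by (rule hermitian_form_onD(5)[OF herm that])
  have per: "ot.periodic (pt a) (\<lambda>x. \<omega> x [v, w])" if "a \<in> O\<^sub>K" for a v w
    unfolding ot.periodic_def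
  proof
    fix x :: "('r, 'c) cspace" assume "x \<in> ot_domain"
    from inv[OF U_one that this, of v w] show "\<omega> (x + pt a) [v, w] = \<omega> x [v, w]"
      by (simp add: act_def rot_one)
  qed
  have f_rot: "f (rot u x) * (cmod (\<tau> j u))\<^sup>2 = f x" if u: "u \<in> U" and x: "x \<in> ot_domain" for u x
  proof -
    let ?y = "rot u x"
    have y: "?y \<in> ot_domain" using act_domain[OF u x, of 0] by (simp add: act_def pt_zero)
    have bil: "bilinear (\<lambda>v w. \<omega> ?y [v, w])" and alt: "\<And>v. \<omega> ?y [v, v] = 0"
      by (rule hermitian_form_onD(2,3)[OF herm y])+
    let ?a = "Re (\<tau> j u)" and ?b = "Im (\<tau> j u)"
    \<comment> \<open>\<open>rot u\<close> multiplies \<open>e\<close> by \<open>\<tau> j u\<close>, so \<open>\<omega>(e, J e)\<close> is scaled by \<open>?a\<^sup>2 + ?b\<^sup>2\<close>\<close>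
    have anti: "\<omega> ?y [Jmult e, e] = - \<omega> ?y [e, Jmult e]"
    proof -
      have "0 = \<omega> ?y [e + Jmult e, e + Jmult e]" by (rule alt[symmetric])
      also have "\<dots> = \<omega> ?y [e, e] + \<omega> ?y [e, Jmult e] + (\<omega> ?y [Jmult e, e] + \<omega> ?y [Jmult e, Jmult e])"
        unfolding bilinear_ladd[OF bil] bilinear_radd[OF bil] by simp
      finally show ?thesis unfolding alt by simp
    qed
    have re: "rot u e = ?a *\<^sub>R e + ?b *\<^sub>R Jmult e" "rot u (Jmult e) = ?a *\<^sub>R Jmult e + (- ?b) *\<^sub>R e"
      by (rule cspace_eqI; simp add: e_def axis_def complex_eq_iff)+
    have "f x = \<omega> (act u 0 x) [rot u e, rot u (Jmult e)]"
      unfolding f_def by (rule inv[OF u one_in_ring_of_integers(2) x, symmetric])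
    also have "\<dots> = \<omega> ?y [?a *\<^sub>R e + ?b *\<^sub>R Jmult e, ?a *\<^sub>R Jmult e + (- ?b) *\<^sub>R e]"
      unfolding re by (simp add: act_def pt_zero)
    also have "\<dots> = (?a\<^sup>2 + ?b\<^sup>2) * \<omega> ?y [e, Jmult e]"
      unfolding bilinear_ladd[OF bil] bilinear_radd[OF bil] bilinear_lmul[OF bil] bilinear_rmul[OF bil] alt anti
      by (simp add: algebra_simps power2_eq_square)
    finally show ?thesis by (simp add: f_def cmod_power2 mult.commute)
  qed
  obtain bs where bs: "set bs \<subseteq> pt ` O\<^sub>K" "span (set bs) = real_directions"
    by (rule lattice_basis_exists) (rule that, assumption+)
  have sub: "set bs \<subseteq> real_directions" using bs(2) span_superset by blast
  have per_bs: "ot.periodic b (\<lambda>x. \<omega> x [v, w])" if b: "b \<in> set bs" for b v w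
  proof -
    obtain a where "a \<in> O\<^sub>K" "b = pt a" using bs(1) b by blast
    then show ?thesis using per by simp
  qed
  define g where "g = mean_along bs f"
  have g_smooth: "smooth_fun_on g ot_domain" unfolding g_def by (rule ot.smooth_mean_along[OF f_smooth sub])
  have g_pos: "g x > 0" if "x \<in> ot_domain" for x
    unfolding g_def by (rule ot.mean_along_pos[OF f_smooth f_pos sub that])
  have per_f: "ot.periodic b f" if "b \<in> set bs" for b unfolding f_def by (rule per_bs[OF that])
  have g_inv: "ot.invariant w g" if "w \<in> real_directions" for w
    unfolding g_def
    by (rule ot.invariant_on_span[OF sub ot.invariant_mean_along[OF f_smooth sub]])
       (use per_f bs(2) that in auto)
  have g_zero: "dir_deriv (Jmult a) (dir_deriv (Jmult b) g) x = 0"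
    if "a \<in> real_directions" "b \<in> real_directions" "x \<in> ot_domain" for a b x
    unfolding g_def f_def
    by (rule second_derivative_of_mean_vanishes[OF smooth ddc bs(2) per_bs that(1,2) e that(3)])
  obtain c0 c where g: "\<And>x. x \<in> ot_domain \<Longrightarrow> g x = c0 + (\<Sum>i\<in>UNIV. c i * Im (fst x $ i))"
    by (rule affine_in_imaginary_parts[OF g_smooth]) (erule g_inv, erule (2) g_zero, rule that, assumption)
  have g_rot: "(cmod (\<tau> j u))\<^sup>2 * g (rot u x) = g x" if u: "u \<in> U" and x: "x \<in> ot_domain" for u x
  proof -
    let ?R = "rot (inverse u)" and ?m = "(cmod (\<tau> j u))\<^sup>2"
    have "?m \<noteq> 0" using \<tau>_nonzero[OF u] by simp
    \<comment> \<open>average along the basis \<open>?R bs\<close>, which \<open>rot u\<close> maps to \<open>bs\<close>\<close>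
    have roundtrip: "map (rot u) (map ?R bs) = bs"
      using U_nonzero[OF u] by (simp add: rot_rot rot_one o_def)
    have span': "span (set (map ?R bs)) = real_directions"
      using linear_span_image[OF rot_linear] bs(2) rot_real_directions[OF U_inverse[OF u]] by simp
    have sub': "set (map ?R bs) \<subseteq> real_directions" using span' span_superset by blast
    have per': "\<forall>b\<in>set (map ?R bs). ot.periodic b f"
    proof
      fix b assume "b \<in> set (map ?R bs)"
      then obtain a where a: "a \<in> O\<^sub>K" "b = pt (inverse u * a)" using bs(1) by (auto simp: rot_pt)
      have "inverse u * a \<in> O\<^sub>K" by (intro ring_of_integers_closed(2) U_integers U_inverse u a(1))
      then show "ot.periodic b f" unfolding f_def a(2) by (rule per)
    qed
    have "g (rot u x) = mean_along (map ?R bs) (f \<circ> rot u) x"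
      unfolding g_def using mean_along_linear_image[OF rot_linear, of u "map ?R bs" f x] roundtrip by simp
    also have "\<dots> = mean_along (map ?R bs) (\<lambda>y. (1 / ?m) * f y) x"
    proof (rule ot.mean_along_cong[OF _ sub' x])
      fix y :: "('r, 'c) cspace" assume "y \<in> ot_domain"
      from f_rot[OF u this] show "(f \<circ> rot u) y = (1 / ?m) * f y"
        using \<open>?m \<noteq> 0\<close> by (simp add: field_simps)
    qed
    also have "\<dots> = (1 / ?m) * mean_along (map ?R bs) f x" by (rule ot.mean_along_cmult)
    also have "mean_along (map ?R bs) f x = g x"
      unfolding g_def using per_f by (intro ot.mean_along_unique[OF f_smooth span' bs(2) per' _ x]) blast
    finally show ?thesis using \<open>?m \<noteq> 0\<close> by simp
  qed
  have semi: "(cmod (\<tau> j u))\<^sup>2 * (c0 + (\<Sum>i\<in>UNIV. c i * (\<sigma> i u * y i))) = c0 + (\<Sum>i\<in>UNIV. c i * y i)"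
    if u: "u \<in> U" and y: "\<And>i. y i > 0" for u y
  proof -
    define x :: "('r, 'c) cspace" where "x = ((\<chi> i. \<i> * of_real (y i)), 0)"
    have x: "x \<in> ot_domain" using y by (simp add: x_def in_ot_domain)
    have rx: "rot u x \<in> ot_domain" using act_domain[OF u x, of 0] by (simp add: act_def pt_zero)
    show ?thesis using g_rot[OF u x] unfolding g[OF x] g[OF rx] by (simp add: x_def)
  qed
  show ?thesis
  proof (cases "c0 = 0")
    case False
    have "(cmod (\<tau> j u))\<^sup>2 = 1" if "u \<in> U" for u
      by (rule affine_semi_invariance(1)[OF semi[OF that] False])
    then have "\<forall>u\<in>U. cmod (\<tau> j u) = 1" by (simp add: power2_eq_1_iff) (smt (verit) norm_ge_zero)
    then show ?thesis by (intro exI[of _ None]) simp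
  next
    case True
    define p :: "('r, 'c) cspace" where "p = ((\<chi> i. \<i>), 0)"
    have p: "p \<in> ot_domain" by (simp add: p_def in_ot_domain)
    have "\<exists>i. c i \<noteq> 0"
    proof (rule ccontr)
      assume "\<nexists>i. c i \<noteq> 0"
      then have "g p = 0" using g[OF p] True by simp
      then show False using g_pos[OF p] by simp
    qed
    then obtain i where i: "c i \<noteq> 0" ..
    have "\<sigma> i u * (cmod (\<tau> j u))\<^sup>2 = 1" if "u \<in> U" for u
      by (rule affine_semi_invariance(2)[OF semi[OF that] i])
    then show ?thesis by (intro exI[of _ "Some i"]) (simp add: mult.commute)
  qed
qed

theorem labels_from_pluriclosed_metric:
  assumes herm: "hermitian_metric (ot_atlas \<sigma> \<tau> U) \<Omega>" and pluri: "pluriclosed (ot_atlas \<sigma> \<tau> U) \<Omega>"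
  obtains m :: "'c \<Rightarrow> 'r option" where "\<And>u j. u \<in> U \<Longrightarrow>
    case m j of None \<Rightarrow> cmod (\<tau> j u) = 1 | Some i \<Rightarrow> (cmod (\<tau> j u))\<^sup>2 * \<sigma> i u = 1"
proof -
  obtain \<omega> :: "('r, 'c) cspace form" where \<omega>: "hermitian_form_on ot_domain \<omega>"
    "\<And>x vs. x \<in> ot_domain \<Longrightarrow> length vs = 4 \<Longrightarrow> ext_deriv (dc \<omega>) x vs = 0"
    "\<And>u a x v w. u \<in> U \<Longrightarrow> a \<in> O\<^sub>K \<Longrightarrow> x \<in> ot_domain \<Longrightarrow> \<omega> (act u a x) [rot u v, rot u w] = \<omega> x [v, w]"
    by (rule invariant_form_on_ot_domain[OF herm pluri]) (rule that, assumption+)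
  have "\<forall>j. \<exists>k. \<forall>u\<in>U. case k of None \<Rightarrow> cmod (\<tau> j u) = 1 | Some i \<Rightarrow> (cmod (\<tau> j u))\<^sup>2 * \<sigma> i u = 1"
    using alternative_for_complex_embedding[OF \<omega>] by simp
  from choice[OF this] obtain m where
    "\<forall>j. \<forall>u\<in>U. case m j of None \<Rightarrow> cmod (\<tau> j u) = 1 | Some i \<Rightarrow> (cmod (\<tau> j u))\<^sup>2 * \<sigma> i u = 1" ..
  then show ?thesis by (intro that[of m]) simp
qed

end

theorem theorem1p1:
  fixes \<sigma> :: "'r::finite \<Rightarrow> 'k::field_char_0 \<Rightarrow> real"
    and \<tau> :: "'c::finite \<Rightarrow> 'k \<Rightarrow> complex"
    and U :: "'k set"
    and s t :: nat
  assumes "s = CARD('r)" and "t = CARD('c)"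
    and "number_field_of_degree TYPE('k) (s + 2 * t)"
    and "embedding_labelling \<sigma> \<tau>"
    and "admissible \<sigma> \<tau> U"
  shows "(\<exists>\<Omega>. hermitian_metric (ot_atlas \<sigma> \<tau> U) \<Omega> \<and> pluriclosed (ot_atlas \<sigma> \<tau> U) \<Omega>)
     \<longleftrightarrow> s \<le> t \<and>
         (\<exists>p q. bij_betw p {1..s} (UNIV :: 'r set) \<and> bij_betw q {1..t} (UNIV :: 'c set) \<and>
            (\<forall>u\<in>U. \<forall>i\<in>{1..s}. (cmod (\<tau> (q i) u))\<^sup>2 * \<sigma> (p i) u = 1) \<and>
            (\<forall>u\<in>U. \<forall>i. s < i \<and> i \<le> t \<longrightarrow> cmod (\<tau> (q i) u) = 1))"
proof -
  interpret ot_data \<sigma> \<tau> U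
    using assms by unfold_locales simp_all
  show ?thesis
    unfolding assms(1,2)
  proof
    assume "\<exists>\<Omega>. hermitian_metric (ot_atlas \<sigma> \<tau> U) \<Omega> \<and> pluriclosed (ot_atlas \<sigma> \<tau> U) \<Omega>"
    then obtain \<Omega> where \<Omega>: "hermitian_metric (ot_atlas \<sigma> \<tau> U) \<Omega>" "pluriclosed (ot_atlas \<sigma> \<tau> U) \<Omega>"
      by (elim exE conjE)
    obtain m :: "'c \<Rightarrow> 'r option" where "\<And>u j. u \<in> U \<Longrightarrow>
        case m j of None \<Rightarrow> cmod (\<tau> j u) = 1 | Some i \<Rightarrow> (cmod (\<tau> j u))\<^sup>2 * \<sigma> i u = 1"
      by (rule labels_from_pluriclosed_metric[OF \<Omega>]) (rule that, assumption+)
    then show "CARD('r) \<le> CARD('c) \<and>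
       (\<exists>p q. bij_betw p {1..CARD('r)} (UNIV :: 'r set) \<and> bij_betw q {1..CARD('c)} (UNIV :: 'c set) \<and>
          (\<forall>u\<in>U. \<forall>i\<in>{1..CARD('r)}. (cmod (\<tau> (q i) u))\<^sup>2 * \<sigma> (p i) u = 1) \<and>
          (\<forall>u\<in>U. \<forall>i. CARD('r) < i \<and> i \<le> CARD('c) \<longrightarrow> cmod (\<tau> (q i) u) = 1))"
      by (rule relabelling_exists)
  next
    assume "CARD('r) \<le> CARD('c) \<and>
       (\<exists>p q. bij_betw p {1..CARD('r)} (UNIV :: 'r set) \<and> bij_betw q {1..CARD('c)} (UNIV :: 'c set) \<and>
          (\<forall>u\<in>U. \<forall>i\<in>{1..CARD('r)}. (cmod (\<tau> (q i) u))\<^sup>2 * \<sigma> (p i) u = 1) \<and>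
          (\<forall>u\<in>U. \<forall>i. CARD('r) < i \<and> i \<le> CARD('c) \<longrightarrow> cmod (\<tau> (q i) u) = 1))"
    then obtain p q where pq: "bij_betw p {1..CARD('r)} (UNIV :: 'r set)" "bij_betw q {1..CARD('c)} (UNIV :: 'c set)"
      "\<forall>u\<in>U. \<forall>i\<in>{1..CARD('r)}. (cmod (\<tau> (q i) u))\<^sup>2 * \<sigma> (p i) u = 1"
      "\<forall>u\<in>U. \<forall>i. CARD('r) < i \<and> i \<le> CARD('c) \<longrightarrow> cmod (\<tau> (q i) u) = 1"
      by (elim exE conjE)
    obtain m :: "'c \<Rightarrow> 'r option" where "\<And>u j. u \<in> U \<Longrightarrow>
        case m j of None \<Rightarrow> cmod (\<tau> j u) = 1 | Some i \<Rightarrow> (cmod (\<tau> j u))\<^sup>2 * \<sigma> i u = 1"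
      by (rule labels_from_relabelling[OF pq]) (rule that, assumption+)
    then show "\<exists>\<Omega>. hermitian_metric (ot_atlas \<sigma> \<tau> U) \<Omega> \<and> pluriclosed (ot_atlas \<sigma> \<tau> U) \<Omega>"
      by (rule pluriclosed_metric_if_relabelling)
  qed
qed

end
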